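(* Let $t\ge 2$ be an integer, $g=2t$, and $\mathbf{x}=(x_1,\dots,x_t)$ be independent variables. Then $$\sum_{\omega\in\mathcal{SC}_{(g)}} (-1)^{|H_{<g,+}|+|H_{<g,+}\cap \Delta|+d_\omega}\,T^{|\omega|/2}\,\mathrm{so}_{\mu}(\mathbf{x})=(T^{1/2};T^{1/2})_\infty\,(T;T)_\infty^{t-1}\,K_T(t,\mathbf{x})\prod_{i=1}^t (T^{1/2}x_i;T^{1/2})_\infty(T^{1/2}x_i^{-1};T^{1/2})_\infty,$$ where the sum runs over all self-conjugate $g$-core partitions $\omega$, $\Delta$ is the main diagonal of $\omega$, $d_\omega$ is its length, $H_{<g,+}=\{s\in\omega\mid h_s<g,\ \varepsilon_s=1\}$, and $\mu=\mu(\omega)$ is the partition given by $\mu_i=v_i+i-g$ for $1\le i\le t$, with $\mathbf{v}$ the $V_{g,t}$-coding of $\omega$.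
   Context: $(a;T)_\infty=\prod_{j\ge0}(1-aT^j)$, and $K_T(t,\mathbf{x})=\prod_{1\le i<j\le t}(Tx_ix_j;T)_\infty(Tx_ix_j^{-1};T)_\infty(Tx_i^{-1}x_j;T)_\infty(Tx_i^{-1}x_j^{-1};T)_\infty$. The identity is between formal power series in $T^{1/2}$ with Laurent polynomial coefficients in the $x_i$. For a partition $\lambda$, $h_s$ is the hook length of a box $s$, $\Delta$ is the set of boxes on the main diagonal of the Ferrers diagram (English convention), and $\varepsilon_s=-1$ if $s$ is strictly below the main diagonal, $\varepsilon_s=1$ otherwise. A $g$-core is a partition with no hook length divisible by $g$. $\mathcal{SC}$ is the set of self-conjugate partitions and $\mathcal{SC}_{(g)}$ the set of $g$-cores in it (including the empty partition). Word of a partition: $\psi(\lambda)=(c_k)_{k\in\mathbb{Z}}\in\{0,1\}^{\mathbb{Z}}$ encodes the border of the Ferrers diagram read from South-West to North-East ($0$ vertical step, $1$ horizontal step), indexed so that $\#\{k\le -1: c_k=1\}=\#\{k\ge 0: c_k=0\}$; equivalently $c_k=0$ iff $k=\lambda_i-i$ for some $i\ge1$ (with $\lambda_i=0$ beyond the length). $V_{g,t}$-coding: for $i\in\{0,\dots,g-1\}$ let $\beta_i=\max\{(k+1)g+i\mid k\in\mathbb{Z},\ c_{kg+i}=0\}$; the $V_{g,t}$-coding is $\mathbf{v}=(v_1>\dots>v_t)$, the $t$ largest of the distinct integers $\beta_0,\dots,\beta_{g-1}$ in decreasing order. Odd orthogonal character: $\mathrm{so}_\mu(\mathbf{x})=\dfrac{\det_{1\le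 i,j\le t}\big(x_i^{\mu_j+t-j+1}-x_i^{-(\mu_j+t-j)}\big)}{\det_{1\le i,j\le t}\big(x_i^{t-j+1}-x_i^{-(t-j)}\big)}$. *)

theory Defs
  imports
    "HOL-Library.Poly_Mapping"
    "HOL-Computational_Algebra.Fraction_Field"
    "HOL-Computational_Algebra.Formal_Power_Series"
    "HOL-Analysis.Infinite_Sum"
    "HOL-Analysis.Infinite_Products"
    "Jordan_Normal_Form.Determinant"
begin

section \<open>Partitions and their Ferrers diagrams\<close>

text \<open>A partition is the list of its nonzero parts in weakly decreasing order.\<close>

definition is_partition :: "nat list \<Rightarrow> bool" where
  "is_partition l \<longleftrightarrow> sorted_wrt (\<ge>) l \<and> 0 \<notin> set l"

text \<open>Parts are numbered from 1, and are 0 beyond the length.\<close>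

definition part :: "nat list \<Rightarrow> nat \<Rightarrow> nat" where
  "part l i = (if 1 \<le> i \<and> i \<le> length l then l ! (i - 1) else 0)"

text \<open>The box \<open>(i, j)\<close> lies in row \<open>i\<close> from the top and column \<open>j\<close> from the left, both
  numbered from 1.\<close>

definition diagram :: "nat list \<Rightarrow> (nat \<times> nat) set" where
  "diagram l = {(i, j). 1 \<le> i \<and> i \<le> length l \<and> 1 \<le> j \<and> j \<le> part l i}"

definition conjugate :: "nat list \<Rightarrow> nat list" where
  "conjugate l = map (\<lambda>j. card {i. (i, j) \<in> diagram l}) [1..<Suc (part l 1)]"

definition hook :: "nat list \<Rightarrow> nat \<times> nat \<Rightarrow> (nat \<times> nat) set" where
  "hook l s = {(i, j) \<in> diagram l. i = fst s \<and> snd s \<le> j \<or> j = snd s \<and> fst s \<le> i}"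

definition hook_length :: "nat list \<Rightarrow> nat \<times> nat \<Rightarrow> nat" where
  "hook_length l s = card (hook l s)"

definition eps :: "nat \<times> nat \<Rightarrow> int" where
  "eps s = (if snd s < fst s then -1 else 1)"

definition main_diagonal :: "nat list \<Rightarrow> (nat \<times> nat) set" where
  "main_diagonal l = {(i, j) \<in> diagram l. i = j}"

definition is_core :: "nat \<Rightarrow> nat list \<Rightarrow> bool" where
  "is_core g l \<longleftrightarrow> (\<forall>s \<in> diagram l. \<not> g dvd hook_length l s)"

definition SC_cores :: "nat \<Rightarrow> nat list set" where
  "SC_cores g = {l. is_partition l \<and> conjugate l = l \<and> is_core g l}"

definition H_less_plus :: "nat \<Rightarrow> nat list \<Rightarrow> (nat \<times> nat) set" where
  "H_less_plus g l = {s \<in> diagram l. hook_length l s < g \<and> eps s = 1}"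

section \<open>The word of a partition and the $V_{g,t}$-coding\<close>

text \<open>The border word, read from South-West to North-East, with 0 for a vertical and 1 for a
  horizontal step: the vertical step at the end of row \<open>i\<close> has index \<open>part l i - i\<close>. This is
  the indexing for which as many 1s have negative index as 0s have nonnegative index.\<close>

definition word :: "nat list \<Rightarrow> int \<Rightarrow> nat" where
  "word l k = (if \<exists>i\<ge>1. k = int (part l i) - int i then 0 else 1)"

text \<open>The set below is infinite, so its maximum is \<open>GREATEST\<close> rather than \<open>Max\<close>. It is
  nonempty and bounded above for \<open>0 < g\<close> and every partition, as the word is eventually 0 to the
  left and eventually 1 to the right.\<close>

definition beta :: "nat \<Rightarrow> nat list \<Rightarrow> nat \<Rightarrow> int" where
  "beta g l i =
    (GREATEST b. \<exists>k::int. b = (k + 1) * int g + int i \<and> word l (k * int g + int i) = 0)"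

definition V_coding :: "nat \<Rightarrow> nat \<Rightarrow> nat list \<Rightarrow> int list" where
  "V_coding g t l = take t (rev (sorted_list_of_set (beta g l ` {0..<g})))"

definition mu :: "nat \<Rightarrow> nat \<Rightarrow> nat list \<Rightarrow> nat \<Rightarrow> int" where
  "mu g t l i = V_coding g t l ! (i - 1) + int i - int g"

section \<open>Odd orthogonal characters\<close>

text \<open>The families \<open>x\<close> and \<open>m\<close> are indexed from 1, matrices of the library from 0.\<close>

definition so_det :: "nat \<Rightarrow> (nat \<Rightarrow> int) \<Rightarrow> (nat \<Rightarrow> 'a::field) \<Rightarrow> 'a" where
  "so_det t m x = Determinant.det (mat t t (\<lambda>(i', j').
     let i = i' + 1; j = j' + 1
     in x i powi (m j + int t - int j + 1) - x i powi (- (m j + int t - int j))))"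

definition so_char :: "nat \<Rightarrow> (nat \<Rightarrow> int) \<Rightarrow> (nat \<Rightarrow> 'a::field) \<Rightarrow> 'a" where
  "so_char t m x = so_det t m x / so_det t (\<lambda>_. 0) x"

section \<open>The coefficient ring and the product side\<close>

text \<open>The group ring of the free abelian group on countably many generators: Laurent polynomials
  over the integers in independent variables indexed by \<open>nat\<close>. Its field of fractions is used so
  that the quotient defining \<open>so_char\<close> is a quotient of field elements.\<close>

type_synonym laurent = "(nat \<Rightarrow>\<^sub>0 int) \<Rightarrow>\<^sub>0 int"

definition X :: "nat \<Rightarrow> laurent fract" where
  "X i = Fract (Poly_Mapping.single (Poly_Mapping.single i 1) 1) 1"

text \<open>The infinite product is taken in the metric topology of \<^typ>\<open>'a fps\<close>, that is, with
  respect to coefficientwise stabilisation.\<close>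

definition qpoch_inf :: "'a::field fps \<Rightarrow> 'a fps \<Rightarrow> 'a fps" where
  "qpoch_inf a q = prodinf (\<lambda>j. 1 - a * q ^ j)"

definition K_prod :: "'a::field fps \<Rightarrow> nat \<Rightarrow> (nat \<Rightarrow> 'a) \<Rightarrow> 'a fps" where
  "K_prod T t x = (\<Prod>(i, j) \<in> {(i, j). 1 \<le> i \<and> i < j \<and> j \<le> t}.
     qpoch_inf (T * fps_const (x i * x j)) T *
     qpoch_inf (T * fps_const (x i * inverse (x j))) T *
     qpoch_inf (T * fps_const (inverse (x i) * x j)) T *
     qpoch_inf (T * fps_const (inverse (x i) * inverse (x j))) T)"

end

theory Submission
  imports Defs "HOL-Library.Function_Algebras"
begin

text \<open>Write \<open>q\<close> for the square root of \<open>T\<close>. Multiplied by the Weyl denominator of type \<open>B\<close>, the product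
  side becomes a product of theta functions, by the Jacobi triple product. It is quasi-periodic under
  each \<open>x\<^sub>i \<mapsto> q\<^sup>2 x\<^sub>i\<close> and antisymmetric, up to a monomial, under the hyperoctahedral group. These
  symmetries propagate a single Laurent coefficient to all others, so the product is a scalar series
  \<open>c(q)\<close> times a determinant of one-variable theta series with the same symmetries. The scalar
  is found by specialising \<open>x\<^sub>i = w\<^sup>i\<close> with \<open>w\<close> a primitive \<open>2t\<close>-th root of unity, where both sides
  factor. Expanding the determinant gives a sum of odd orthogonal determinants over integer vectors
  \<open>n\<close>, and the same vectors parametrise the self-conjugate \<open>2t\<close>-cores: residue class \<open>j\<close> of the set of
  all \<open>\<lambda>\<^sub>i - i\<close> is full below a level \<open>\<plusminus>n\<^sub>j\<close>. Under this bijection the exponent of \<open>q\<close> is the size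
  of the core, and the sign in the theorem is the sign of the signed permutation that sorts the
  exponents \<open>2 t n\<^sub>j + t - j\<close> of the determinant.\<close>

text \<open>The substitution of q^2 x_i for x_i is not an operation on power series in q with
  Laurent coefficients, since monomials with negative exponents would acquire negative powers of q.
  The functional equations are therefore never stated as substitutions: they are affine symmetries
  of the array of coefficients.

  The comparison of the two sides takes place over the integers, so the scalar c(q) has integer
  coefficients. It can then be computed over the complex numbers, where primitive roots of unity
  exist, and used in the field of Laurent fractions, where the x_i are independent. Only c(q) / c(0)
  is computed. The part of degree 0 in q of the same identity says that c(0) is the ratio of the
  product form and the determinant form of the type B denominator, so c(0) cancels and the Weyl
  denominator formula is not presupposed.

  The specialisation at roots of unity works because all exponents 2 t n_j + t - j of column j agree
  modulo 2 t. Every determinant in the sum over n then has the same value, and the sum becomes a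
  product of theta constants.\<close>

unbundle fps_syntax
no_notation Matrix.vec_index (infixl "$" 100)
no_notation Finite_Cartesian_Product.vec_nth (infixl "$" 90)

section \<open>Infinite products and weighted sums of power series\<close>

lemma tendsto_fps_mult:
  fixes f g :: "'b \<Rightarrow> 'a::comm_ring_1 fps"
  assumes "(f \<longlongrightarrow> F) A" "(g \<longlongrightarrow> G) A"
  shows "((\<lambda>x. f x * g x) \<longlongrightarrow> F * G) A"
proof (rule tendsto_fpsI)
  fix n
  have f: "\<forall>\<^sub>F x in A. \<forall>i\<in>{0..n}. f x $ i = F $ i"
    using assms(1) by (intro eventually_ball_finite) (auto simp: tendsto_fps_iff)
  have g: "\<forall>\<^sub>F x in A. \<forall>i\<in>{0..n}. g x $ i = G $ i"
    using assms(2) by (intro eventually_ball_finite) (auto simp: tendsto_fps_iff)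
  show "\<forall>\<^sub>F x in A. (f x * g x) $ n = (F * G) $ n"
    using f g by eventually_elim (auto simp: fps_mult_nth intro!: sum.cong)
qed

lemma tendsto_fps_prod:
  fixes f :: "'c \<Rightarrow> 'b \<Rightarrow> 'a::comm_ring_1 fps"
  assumes "\<And>i. i \<in> I \<Longrightarrow> (f i \<longlongrightarrow> F i) A"
  shows "((\<lambda>x. \<Prod>i\<in>I. f i x) \<longlongrightarrow> (\<Prod>i\<in>I. F i)) A"
  using assms
  by (induction I rule: infinite_finite_induct) (auto intro: tendsto_fps_mult)

lemma fps_power_nth_below:
  fixes p :: "'a::comm_ring_1 fps"
  assumes "p $ 0 = 0" "n < k"
  shows "(p ^ k) $ n = 0"
  using startsby_zero_power_prefix[OF assms(1)] assms(2) by auto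

lemma fps_mult_power_nth_below:
  fixes a p :: "'a::comm_ring_1 fps"
  assumes "a $ 0 = 0" "p $ 0 = 0" "n \<le> k"
  shows "(a * p ^ k) $ n = 0"
proof -
  have "a $ i * (p ^ k) $ (n - i) = 0" if "i \<le> n" for i
    using that assms by (cases "i = 0") (auto simp: fps_power_nth_below[OF assms(2)])
  then show ?thesis by (simp add: fps_mult_nth)
qed

text \<open>The factor of index j differs from 1 by \<open>a * p ^ j\<close>, which vanishes through
  degree j. So coefficient n sees only the first n factors. This explicit bound also gives an
  integer version of the product, \<open>euler_fps\<close>.\<close>

lemma partial_qpoch_nth:
  fixes a p :: "'a::comm_ring_1 fps"
  assumes "a $ 0 = 0" "p $ 0 = 0" "n \<le> N"
  shows "(\<Prod>j<N. 1 - a * p ^ j) $ n = (\<Prod>j<n. 1 - a * p ^ j) $ n"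
  using assms(3)
proof (induction N rule: dec_induct)
  case (step N)
  have "(\<Prod>j<Suc N. 1 - a * p ^ j) $ n = (\<Prod>j<N. 1 - a * p ^ j) $ n - ((\<Prod>j<N. 1 - a * p ^ j) * (a * p ^ N)) $ n"
    by (simp add: algebra_simps)
  moreover have "((\<Prod>j<N. 1 - a * p ^ j) * (a * p ^ N)) $ n = 0"
    by (subst fps_mult_nth, rule sum.neutral)
       (use step in \<open>auto simp: fps_mult_power_nth_below[OF assms(1,2)]\<close>)
  ultimately show ?case using step by simp
qed simp

lemma tendsto_qpoch:
  fixes a p :: "'a::field fps"
  assumes "a $ 0 = 0" "p $ 0 = 0"
  shows "(\<lambda>N. \<Prod>j<N. 1 - a * p ^ j) \<longlonglongrightarrow> qpoch_inf a p"
proof -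
  define P where "P N = (\<Prod>j<N. 1 - a * p ^ j)" for N
  have stable: "P N $ n = P n $ n" if "n \<le> N" for n N
    unfolding P_def by (rule partial_qpoch_nth[OF assms that])
  define L where "L = Abs_fps (\<lambda>n. P n $ n)"
  have lim: "P \<longlonglongrightarrow> L"
  proof (rule tendsto_fpsI)
    fix n show "\<forall>\<^sub>F N in sequentially. P N $ n = L $ n"
      using eventually_ge_at_top[of n] by eventually_elim (auto simp: L_def intro: stable)
  qed
  have "L $ 0 = 1" by (simp add: L_def P_def)
  then have "L \<noteq> 0" by auto
  moreover have "(\<lambda>n. \<Prod>i\<le>n. 1 - a * p ^ i) \<longlonglongrightarrow> L"
    using LIMSEQ_Suc[OF lim] by (simp add: P_def lessThan_Suc_atMost)
  ultimately have "(\<lambda>j. 1 - a * p ^ j) has_prod L"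
    by (auto simp: has_prod_def raw_has_prod_def)
  then have "qpoch_inf a p = L"
    unfolding qpoch_inf_def by (metis has_prod_unique)
  with lim show ?thesis by (simp add: P_def[abs_def])
qed

lemma qpoch_eqI:
  fixes a p L :: "'a::field fps"
  assumes "a $ 0 = 0" "p $ 0 = 0" "(\<lambda>N. \<Prod>j<N. 1 - a * p ^ j) \<longlonglongrightarrow> L"
  shows "qpoch_inf a p = L"
  using LIMSEQ_unique[OF tendsto_qpoch[OF assms(1,2)] assms(3)] .

lemma qpoch_nth_0 [simp]:
  fixes a p :: "'a::field fps"
  assumes "a $ 0 = 0" "p $ 0 = 0"
  shows "qpoch_inf a p $ 0 = 1"
proof -
  have "\<forall>\<^sub>F N in sequentially. (\<Prod>j<N. 1 - a * p ^ j) $ 0 = qpoch_inf a p $ 0"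
    using tendsto_qpoch[OF assms] by (auto simp: tendsto_fps_iff)
  moreover have "(\<Prod>j<N. 1 - a * p ^ j) $ 0 = 1" for N
    by (induction N) (auto simp: assms)
  ultimately show ?thesis by simp
qed

lemma qpoch_nonzero:
  fixes a p :: "'a::field fps"
  assumes "a $ 0 = 0" "p $ 0 = 0"
  shows "qpoch_inf a p \<noteq> 0"
  using qpoch_nth_0[OF assms] by (metis fps_zero_nth zero_neq_one)

text \<open>The factors are sorted by the residue of their index modulo r; partial products are
  compared along the multiples of r.\<close>

lemma qpoch_split:
  fixes a p :: "'a::field fps"
  assumes "a $ 0 = 0" "p $ 0 = 0" "r > 0"
  shows "qpoch_inf a p = (\<Prod>i<r. qpoch_inf (a * p ^ i) (p ^ r))"
proof (rule qpoch_eqI[OF assms(1,2)])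
  have eq: "(\<Prod>j<r*N. 1 - a * p ^ j) = (\<Prod>i<r. \<Prod>k<N. 1 - (a * p ^ i) * (p ^ r) ^ k)" for N
  proof (induction N)
    case (Suc N)
    have "(\<Prod>j<r * Suc N. 1 - a * p ^ j) = (\<Prod>j<r * N. 1 - a * p ^ j) * (\<Prod>j\<in>{r*N..<r*N+r}. 1 - a * p ^ j)"
      by (simp add: lessThan_atLeast0 prod.atLeastLessThan_concat add.commute)
    also have "(\<Prod>j\<in>{r*N..<r*N+r}. 1 - a * p ^ j) = (\<Prod>i<r. 1 - a * p ^ i * (p ^ r) ^ N)"
    proof (subst prod.atLeastLessThan_shift_0, simp add: lessThan_atLeast0, rule prod.cong[OF refl])
      fix i
      have "p ^ (i + r * N) = p ^ i * (p ^ r) ^ N" by (simp add: power_add power_mult)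
      then show "1 - a * p ^ (r * N + i) = 1 - a * p ^ i * (p ^ r) ^ N"
        by (simp add: add.commute mult.assoc)
    qed
    finally show ?case using Suc by (simp add: prod.distrib)
  qed simp
  have sub: "filterlim (\<lambda>N. r * N) sequentially sequentially"
    using assms(3) by (simp add: filterlim_subseq strict_mono_def)
  have lim: "(\<lambda>N. \<Prod>i<r. \<Prod>k<N. 1 - (a * p ^ i) * (p ^ r) ^ k) \<longlonglongrightarrow> (\<Prod>i<r. qpoch_inf (a * p ^ i) (p ^ r))"
    using assms by (intro tendsto_fps_prod tendsto_qpoch) (auto simp: startsby_zero_power)
  have "(\<lambda>N. \<Prod>j<r*N. 1 - a * p ^ j) \<longlonglongrightarrow> qpoch_inf a p"
    using filterlim_compose[OF tendsto_qpoch[OF assms(1,2)] sub] .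
  then have "(\<Prod>i<r. qpoch_inf (a * p ^ i) (p ^ r)) = qpoch_inf a p"
    unfolding eq using LIMSEQ_unique lim by blast
  then show "(\<lambda>N. \<Prod>j<N. 1 - a * p ^ j) \<longlonglongrightarrow> (\<Prod>i<r. qpoch_inf (a * p ^ i) (p ^ r))"
    using tendsto_qpoch[OF assms(1,2)] by simp
qed

section \<open>Series summed over weighted index sets\<close>

definition fsum :: "'i set \<Rightarrow> ('i \<Rightarrow> nat) \<Rightarrow> ('i \<Rightarrow> 'a::comm_ring_1) \<Rightarrow> 'a fps" where
  "fsum I w a = Abs_fps (\<lambda>N. \<Sum>i | i \<in> I \<and> w i = N. a i)"

text \<open>The condition under which \<open>fsum I w a\<close> is the formal sum of the
  \<open>a i\<close> times q to the power \<open>w i\<close>: over an infinite fibre the coefficient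
  of \<open>fsum\<close> would silently be 0.\<close>

definition fin_fibres :: "'i set \<Rightarrow> ('i \<Rightarrow> nat) \<Rightarrow> bool" where
  "fin_fibres I w \<longleftrightarrow> (\<forall>N. finite {i \<in> I. w i = N})"

lemma fsum_nth: "fsum I w a $ N = (\<Sum>i | i \<in> I \<and> w i = N. a i)"
  by (simp add: fsum_def)

lemma fsum_cong:
  assumes "\<And>i. i \<in> I \<Longrightarrow> w i = w' i" "\<And>i. i \<in> I \<Longrightarrow> a i = a' i"
  shows "fsum I w a = fsum I w' a'"
  by (rule fps_ext) (auto simp: fsum_nth assms intro!: sum.cong)

lemma fsum_reindex:
  assumes "bij_betw h I J"
  shows "fsum J w a = fsum I (w \<circ> h) (a \<circ> h)"
proof (rule fps_ext)
  fix N
  have "bij_betw h {i \<in> I. w (h i) = N} {j \<in> J. w j = N}"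
    using assms by (auto simp: bij_betw_def inj_on_def image_def)
  then show "fsum J w a $ N = fsum I (w \<circ> h) (a \<circ> h) $ N"
    by (simp add: fsum_nth sum.reindex_bij_betw[symmetric])
qed

lemma fin_fibres_times:
  assumes "fin_fibres I w" "fin_fibres J v"
  shows "fin_fibres (I \<times> J) (\<lambda>(i, j). w i + v j)"
  unfolding fin_fibres_def
proof
  fix N
  have "{x \<in> I \<times> J. (case x of (i, j) \<Rightarrow> w i + v j) = N} \<subseteq>
    (\<Union>m\<le>N. {i \<in> I. w i = m} \<times> {j \<in> J. v j = N - m})" by auto
  moreover have "finite \<dots>" using assms by (auto simp: fin_fibres_def)
  ultimately show "finite {x \<in> I \<times> J. (case x of (i, j) \<Rightarrow> w i + v j) = N}"
    by (rule finite_subset)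
qed

lemma fsum_times:
  assumes "fin_fibres I w" "fin_fibres J v"
  shows "fsum I w a * fsum J v b = fsum (I \<times> J) (\<lambda>(i, j). w i + v j) (\<lambda>(i, j). a i * b j)"
proof (rule fps_ext)
  fix N
  let ?F = "\<lambda>m. {i \<in> I. w i = m} \<times> {j \<in> J. v j = N - m}"
  have "(fsum I w a * fsum J v b) $ N = (\<Sum>m=0..N. \<Sum>(i,j)\<in>?F m. a i * b j)"
    by (simp add: fps_mult_nth fsum_nth sum_product sum.cartesian_product)
  also have "\<dots> = (\<Sum>(i,j)\<in>(\<Union>m\<in>{0..N}. ?F m). a i * b j)"
    using assms by (subst sum.UNION_disjoint) (auto simp: fin_fibres_def)
  also have "(\<Union>m\<in>{0..N}. ?F m) = {x \<in> I \<times> J. (case x of (i, j) \<Rightarrow> w i + v j) = N}"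
    by auto
  finally show "(fsum I w a * fsum J v b) $ N =
      fsum (I \<times> J) (\<lambda>(i, j). w i + v j) (\<lambda>(i, j). a i * b j) $ N"
    by (simp add: fsum_nth)
qed

lemma bij_betw_PiE_insert:
  assumes "k \<notin> J"
  shows "bij_betw (\<lambda>(y, n). n(k := y)) (I k \<times> PiE J I) (PiE (insert k J) I)"
proof (rule bij_betwI')
  fix x y assume xy: "x \<in> I k \<times> PiE J I" "y \<in> I k \<times> PiE J I"
  have *: "n = n'" if "n(k := u) = n'(k := v)" "n \<in> PiE J I" "n' \<in> PiE J I" for n n' u v
  proof
    fix z show "n z = n' z"
      using that(2,3) assms fun_cong[OF that(1), of z] by (cases "z = k") (auto simp: PiE_def extensional_def)
  qed
  have "fst x = fst y \<and> snd x = snd y"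
    if eq: "(snd x)(k := fst x) = (snd y)(k := fst y)"
    using fun_cong[OF eq, of k] *[OF eq] xy by (auto simp: mem_Times_iff)
  then show "((case x of (y, n) \<Rightarrow> n(k := y)) = (case y of (y, n) \<Rightarrow> n(k := y))) = (x = y)"
    unfolding case_prod_unfold prod_eq_iff by metis
next
  fix x assume "x \<in> I k \<times> PiE J I"
  then show "(case x of (y, n) \<Rightarrow> n(k := y)) \<in> PiE (insert k J) I"
    unfolding PiE_insert_eq by blast
next
  fix n assume "n \<in> PiE (insert k J) I"
  then show "\<exists>x\<in>I k \<times> PiE J I. n = (case x of (y, n) \<Rightarrow> n(k := y))"
    unfolding PiE_insert_eq by blast
qed

text \<open>A tuple of summation indices is an extensional function, so that every choice is listed
  exactly once. Finiteness of the fibres is proved in the same induction because multiplying by one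
  more series requires it.\<close>

lemma fsum_prod:
  assumes "finite J" "\<And>j. j \<in> J \<Longrightarrow> fin_fibres (I j) (w j)"
  shows "fin_fibres (PiE J I) (\<lambda>n. \<Sum>j\<in>J. w j (n j)) \<and>
    (\<Prod>j\<in>J. fsum (I j) (w j) (a j)) = fsum (PiE J I) (\<lambda>n. \<Sum>j\<in>J. w j (n j)) (\<lambda>n. \<Prod>j\<in>J. a j (n j))"
  using assms
proof (induction J rule: finite_induct)
  case empty
  show ?case
  proof
    show "fin_fibres (PiE {} I) (\<lambda>n. \<Sum>j\<in>{}. w j (n j))" by (auto simp: fin_fibres_def)
    show "(\<Prod>j\<in>{}. fsum (I j) (w j) (a j)) =
      fsum (PiE {} I) (\<lambda>n. \<Sum>j\<in>{}. w j (n j)) (\<lambda>n. \<Prod>j\<in>{}. a j (n j))"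
    proof (rule fps_ext)
      fix N :: nat
      have "{i :: 'a \<Rightarrow> 'b. i = (\<lambda>x. undefined) \<and> 0 = N} = (if N = 0 then {\<lambda>x. undefined} else {})" by auto
      then show "(\<Prod>j\<in>{}. fsum (I j) (w j) (a j)) $ N =
        fsum (PiE {} I) (\<lambda>n. \<Sum>j\<in>{}. w j (n j)) (\<lambda>n. \<Prod>j\<in>{}. a j (n j)) $ N"
        by (simp add: fsum_nth)
    qed
  qed
next
  case (insert k J)
  let ?h = "\<lambda>(y, n). n(k := y)"
  let ?W = "\<lambda>n. \<Sum>j\<in>J. w j (n j)" and ?A = "\<lambda>n. \<Prod>j\<in>J. a j (n j)"
  let ?W' = "\<lambda>n. \<Sum>j\<in>insert k J. w j (n j)" and ?A' = "\<lambda>n. \<Prod>j\<in>insert k J. a j (n j)"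
  note bij = bij_betw_PiE_insert[OF insert.hyps(2), of I]
  have IH: "fin_fibres (PiE J I) ?W"
    "(\<Prod>j\<in>J. fsum (I j) (w j) (a j)) = fsum (PiE J I) ?W ?A"
    using insert by auto
  have fk: "fin_fibres (I k) (w k)" using insert by auto
  have s: "(\<Sum>j\<in>J. w j ((n(k := y)) j)) = ?W n" "(\<Prod>j\<in>J. a j ((n(k := y)) j)) = ?A n" for n y
    using insert.hyps by (auto intro!: sum.cong prod.cong)
  have W: "?W' \<circ> ?h = (\<lambda>(i, j). w k i + ?W j)" and A: "?A' \<circ> ?h = (\<lambda>(i, j). a k i * ?A j)"
    using insert.hyps s by (auto simp: fun_eq_iff)
  have "(\<Prod>j\<in>insert k J. fsum (I j) (w j) (a j)) = fsum (I k \<times> PiE J I) (?W' \<circ> ?h) (?A' \<circ> ?h)"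
    unfolding W A fsum_times[OF fk IH(1), symmetric] IH(2)[symmetric] using insert.hyps by simp
  also have "\<dots> = fsum (PiE (insert k J) I) ?W' ?A'"
    by (rule fsum_reindex[OF bij, symmetric])
  finally have 1: "(\<Prod>j\<in>insert k J. fsum (I j) (w j) (a j)) = fsum (PiE (insert k J) I) ?W' ?A'" .
  have "finite {n \<in> PiE (insert k J) I. ?W' n = N}" for N
  proof -
    have "{n \<in> PiE (insert k J) I. ?W' n = N} \<subseteq> ?h ` {x \<in> I k \<times> PiE J I. (?W' \<circ> ?h) x = N}"
    proof
      fix n assume n: "n \<in> {n \<in> PiE (insert k J) I. ?W' n = N}"
      then obtain x where "x \<in> I k \<times> PiE J I" "n = ?h x"
        using bij unfolding bij_betw_def by blast
      then show "n \<in> ?h ` {x \<in> I k \<times> PiE J I. (?W' \<circ> ?h) x = N}" using n by auto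
    qed
    moreover have "finite {x \<in> I k \<times> PiE J I. (?W' \<circ> ?h) x = N}"
      unfolding W using fin_fibres_times[OF fk IH(1)] by (auto simp: fin_fibres_def)
    ultimately show ?thesis using finite_surj by blast
  qed
  then have "fin_fibres (PiE (insert k J) I) ?W'" by (simp add: fin_fibres_def)
  with 1 show ?case by blast
qed

section \<open>The Jacobi triple product\<close>

fun qbinom :: "'a::comm_ring_1 \<Rightarrow> nat \<Rightarrow> nat \<Rightarrow> 'a" where
  "qbinom p n 0 = 1"
| "qbinom p 0 (Suc k) = 0"
| "qbinom p (Suc n) (Suc k) = qbinom p n k + p ^ Suc k * qbinom p n (Suc k)"

definition qfact :: "'a::comm_ring_1 \<Rightarrow> nat \<Rightarrow> 'a" where
  "qfact p n = (\<Prod>j<n. 1 - p ^ Suc j)"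

lemma qfact_0 [simp]: "qfact p 0 = 1" by (simp add: qfact_def)

lemma qfact_Suc: "qfact p (Suc n) = qfact p n * (1 - p ^ Suc n)" by (simp add: qfact_def)

lemma qbinom_eq_0: "n < k \<Longrightarrow> qbinom p n k = 0"
  by (induction p n k rule: qbinom.induct) auto

text \<open>Clearing denominators keeps the quotient formula for Gaussian binomials meaningful in
  every commutative ring. With n = k + d + 1 the two Pascal terms combine by (1 - p^(k+1)) + p^(k+1)
  (1 - p^(d+1)) = 1 - p^(k+d+2).\<close>

lemma qbinom_qfact: "k \<le> n \<Longrightarrow> qbinom p n k * qfact p k * qfact p (n - k) = qfact p n"
proof (induction p n k rule: qbinom.induct)
  case (3 p n k)
  show ?case
  proof (cases "k = n")
    case True
    then have "qbinom p n (Suc k) = 0" by (simp add: qbinom_eq_0)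
    with 3 True show ?thesis by (simp add: qfact_Suc algebra_simps)
  next
    case False
    then have lt: "k < n" using 3 by simp
    then obtain d where d: "n = Suc (k + d)" using less_imp_Suc_add by blast
    have 1: "qbinom p n k * qfact p k * qfact p (Suc d) = qfact p n"
      using 3 lt d by simp
    have 2: "qbinom p n (Suc k) * qfact p (Suc k) * qfact p d = qfact p n"
      using 3 lt d by simp
    have "qbinom p (Suc n) (Suc k) * qfact p (Suc k) * qfact p (Suc d) =
       (qbinom p n k * qfact p k * qfact p (Suc d)) * (1 - p ^ Suc k) +
       p ^ Suc k * (qbinom p n (Suc k) * qfact p (Suc k) * qfact p d) * (1 - p ^ Suc d)"
      by (simp add: qfact_Suc algebra_simps)
    also have "\<dots> = qfact p n * (1 - p ^ Suc k * p ^ Suc d)"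
      unfolding 1 2 by (simp add: algebra_simps)
    also have "\<dots> = qfact p (Suc n)"
      by (simp add: qfact_Suc d power_add algebra_simps)
    finally show ?thesis using d by simp
  qed
qed auto

text \<open>The mirror image of the defining Pascal rule. In the finite triple product this rule
  absorbs the factors with x, the defining one those with 1 / x.\<close>

lemma qbinom_Suc_Suc':
  fixes p :: "'a::idom"
  assumes nz: "\<And>n. qfact p n \<noteq> 0" and "k \<le> n"
  shows "qbinom p (Suc n) (Suc k) = p ^ (n - k) * qbinom p n k + qbinom p n (Suc k)"
proof -
  have "(1 - p ^ (n - k)) * qbinom p n k = (1 - p ^ Suc k) * qbinom p n (Suc k)"
  proof (cases "k = n")
    case True
    then show ?thesis by (simp add: qbinom_eq_0)
  next
    case False
    then have lt: "k < n" using assms by simp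
    then obtain d where d: "n = Suc (k + d)" using less_imp_Suc_add by blast
    have "qbinom p n k * qfact p k * qfact p (Suc d) = qbinom p n (Suc k) * qfact p (Suc k) * qfact p d"
      using qbinom_qfact[of k n p] qbinom_qfact[of "Suc k" n p] lt d by simp
    then have "(qfact p k * qfact p d) * ((1 - p ^ Suc d) * qbinom p n k) =
       (qfact p k * qfact p d) * ((1 - p ^ Suc k) * qbinom p n (Suc k))"
      by (simp add: qfact_Suc algebra_simps)
    then show ?thesis using nz d by simp
  qed
  then show ?thesis by (simp add: algebra_simps)
qed

section \<open>Exponents of theta series\<close>

definition tri :: "int \<Rightarrow> int" where "tri n = n * (n - 1) div 2"

lemma two_tri: "2 * tri n = n * (n - 1)"
proof -
  have "even (n * (n - 1))" by simp
  then show ?thesis by (simp add: tri_def)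
qed

lemma tri_add_1: "tri (n + 1) = tri n + n"
  using two_tri[of n] two_tri[of "n + 1"] by (simp add: algebra_simps)

lemma tri_ge: "n - 1 \<le> tri n" "0 \<le> tri n" "- n \<le> tri n"
proof -
  have "0 \<le> (n - 1) * (n - 2)"
    by (cases "n \<le> 1") (auto simp: mult_nonneg_nonneg mult_nonpos_nonpos)
  then have "2 * (n - 1) \<le> n * (n - 1)" by (simp add: algebra_simps)
  then show "n - 1 \<le> tri n" unfolding two_tri[symmetric] by simp
  have "0 \<le> n * (n - 1)"
    by (cases "n \<le> 0") (auto simp: mult_nonneg_nonneg mult_nonpos_nonpos)
  then show "0 \<le> tri n" unfolding two_tri[symmetric] by simp
  have "0 \<le> n * (n + 1)"
    by (cases "n \<ge> 0") (auto simp: mult_nonneg_nonneg mult_nonpos_nonpos)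
  then have "2 * (- n) \<le> n * (n - 1)" by (simp add: algebra_simps)
  then show "- n \<le> tri n" unfolding two_tri[symmetric] by simp
qed

text \<open>The exponent of q in term n of the theta series in base q^r with argument x q^s. For s <
  r it is nonnegative for every integer n, so \<open>nat\<close> loses nothing.\<close>

definition theta_wt :: "nat \<Rightarrow> nat \<Rightarrow> int \<Rightarrow> nat" where
  "theta_wt r s n = nat (int r * tri n + int s * n)"

text \<open>The quadratic term dominates the linear one as soon as s < r. The two linear lower
  bounds confine n to a finite interval for each weight, which gives finite fibres and the cut-off
  in the limit of the triple product.\<close>

lemma int_theta_wt:
  assumes "s < r"
  shows "int (theta_wt r s n) = int r * tri n + int s * n"
    and "n - 1 \<le> int (theta_wt r s n)" "- n \<le> int (theta_wt r s n)"
proof -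
  define E where "E = int r * tri n + int s * n"
  have E: "n - 1 \<le> E \<and> - n \<le> E \<and> 0 \<le> E"
  proof (cases "n \<ge> 1")
    case True
    have "1 * tri n \<le> int r * tri n" using assms tri_ge by (intro mult_right_mono) auto
    moreover have "0 \<le> int s * n" using True by simp
    ultimately show ?thesis using tri_ge(1,2)[of n] True unfolding E_def by linarith
  next
    case False
    define k where "k = - n"
    have k: "k \<ge> 0" using False k_def by simp
    have "int r * k \<le> int r * tri n" unfolding k_def using tri_ge(3) by (intro mult_left_mono) auto
    moreover have "int s * k \<le> (int r - 1) * k" using k assms by (intro mult_right_mono) auto
    ultimately have "k \<le> E" unfolding E_def k_def by (simp add: algebra_simps)
    then show ?thesis using k unfolding k_def by linarith
  qed
  then show "int (theta_wt r s n) = int r * tri n + int s * n"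
    and "n - 1 \<le> int (theta_wt r s n)" "- n \<le> int (theta_wt r s n)"
    unfolding theta_wt_def E_def[symmetric] by simp_all
qed

lemma fin_fibres_theta:
  assumes "s < r"
  shows "fin_fibres UNIV (theta_wt r s)"
  unfolding fin_fibres_def
proof
  fix N
  have "{i \<in> UNIV. theta_wt r s i = N} \<subseteq> {- int N..int N + 1}"
    using int_theta_wt[OF assms] by (auto simp: minus_le_iff) (smt (verit))+
  then show "finite {i \<in> UNIV. theta_wt r s i = N}" by (rule finite_subset) simp
qed

lemma fps_nth_mult_cong:
  fixes A B C D :: "'a::comm_ring_1 fps"
  assumes "\<forall>i\<le>M. A $ i = B $ i" "\<forall>i\<le>M. C $ i = D $ i"
  shows "\<forall>i\<le>M. (A * C) $ i = (B * D) $ i"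
  using assms by (auto simp: fps_mult_nth intro!: sum.cong)

section \<open>The finite triple product and its limit\<close>

context
  fixes x :: "'a::field" and r s :: nat
  assumes x: "x \<noteq> 0" and sr: "s < r"
begin

definition theta_term :: "int \<Rightarrow> 'a fps" where
  "theta_term n = fps_const (x powi n) * fps_X ^ theta_wt r s n"

text \<open>The weights of neighbouring terms differ by a linear function of k. So the next factor
  with x moves term k to term k + 1 at the price of the power 2 N - k of the base, exactly the power
  in the second Pascal rule. \<open>theta_term_down\<close> yields the power k in the same way, for
  the defining rule.\<close>

lemma theta_term_up:
  assumes "k \<le> 2 * N"
  shows "fps_const x * fps_X ^ (s + r * N) * theta_term (int k - int N) =
    (fps_X ^ r) ^ (2 * N - k) * theta_term (int (Suc k) - int N)"
proof -
  have c: "x * x powi (int k - int N) = x powi (int (Suc k) - int N)"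
    using power_int_add_1[of x "int k - int N"] x by (simp add: mult.commute algebra_simps)
  have "int (s + r * N + theta_wt r s (int k - int N)) =
      int (r * (2 * N - k) + theta_wt r s (int (Suc k) - int N))"
  proof -
    define m where "m = int k - int N"
    have m: "int (Suc k) - int N = m + 1" "int k = m + int N" by (simp_all add: m_def)
    have d: "int (2 * N - k) = int N - m" using assms by (simp add: m_def of_nat_diff)
    show ?thesis
      unfolding m_def[symmetric] m(1) of_nat_add of_nat_mult int_theta_wt(1)[OF sr] tri_add_1 d
      by (simp add: algebra_simps)
  qed
  then have e: "s + r * N + theta_wt r s (int k - int N) = r * (2 * N - k) + theta_wt r s (int (Suc k) - int N)"
    by (simp only: of_nat_eq_iff)
  have "fps_const x * fps_X ^ (s + r * N) * theta_term (int k - int N) =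
    fps_const (x * x powi (int k - int N)) * fps_X ^ (s + r * N + theta_wt r s (int k - int N))"
    unfolding theta_term_def power_add fps_const_mult[symmetric] by (simp only: mult_ac)
  also have "\<dots> = (fps_X ^ r) ^ (2 * N - k) * theta_term (int (Suc k) - int N)"
    unfolding c e theta_term_def power_add power_mult by (simp only: mult_ac)
  finally show ?thesis .
qed

lemma theta_term_down:
  "fps_const (inverse x) * fps_X ^ (r - s + r * N) * theta_term (int k - int N) =
    (fps_X ^ r) ^ k * theta_term (int k - int (Suc N))"
proof -
  have c: "inverse x * x powi (int k - int N) = x powi (int k - int (Suc N))"
    using power_int_diff[of x "int k - int N" 1] x by (simp add: field_simps)
  have "int (r - s + r * N + theta_wt r s (int k - int N)) =
      int (r * k + theta_wt r s (int k - int (Suc N)))"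
  proof -
    define m where "m = int k - int (Suc N)"
    have m: "int k - int N = m + 1" "int k = m + 1 + int N" by (simp_all add: m_def)
    have d: "int (r - s) = int r - int s" using sr by simp
    show ?thesis
      unfolding m_def[symmetric] m(1) of_nat_add of_nat_mult int_theta_wt(1)[OF sr] tri_add_1 d
      unfolding m(2) by (simp add: algebra_simps)
  qed
  then have e: "r - s + r * N + theta_wt r s (int k - int N) = r * k + theta_wt r s (int k - int (Suc N))"
    by (simp only: of_nat_eq_iff)
  have "fps_const (inverse x) * fps_X ^ (r - s + r * N) * theta_term (int k - int N) =
    fps_const (inverse x * x powi (int k - int N)) * fps_X ^ (r - s + r * N + theta_wt r s (int k - int N))"
    unfolding theta_term_def power_add fps_const_mult[symmetric] by (simp only: mult_ac)
  also have "\<dots> = (fps_X ^ r) ^ k * theta_term (int k - int (Suc N))"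
    unfolding c e theta_term_def power_add power_mult by (simp only: mult_ac)
  finally show ?thesis .
qed

lemma qfact_fps_X_nonzero: "qfact (fps_X ^ r :: 'a fps) n \<noteq> 0"
proof -
  have "qfact (fps_X ^ r :: 'a fps) n $ 0 = 1"
    using sr by (induction n) (auto simp: qfact_Suc simp flip: power_mult power_add power_Suc)
  then show ?thesis by auto
qed

text \<open>Cauchy's finite form of the triple product. Each induction step multiplies by one factor
  with x and one with 1 / x, and each of them raises the upper index of the Gaussian binomials by
  one.\<close>

lemma finite_triple_product:
  "(\<Prod>j<N. (1 + fps_const x * fps_X ^ (s + r * j)) * (1 + fps_const (inverse x) * fps_X ^ (r - s + r * j))) =
   (\<Sum>k\<le>2*N. qbinom (fps_X ^ r) (2 * N) k * theta_term (int k - int N))"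
proof (induction N)
  case 0
  show ?case by (simp add: theta_term_def theta_wt_def tri_def)
next
  case (Suc N)
  let ?p = "fps_X ^ r :: 'a fps"
  let ?a = "fps_const x * fps_X ^ (s + r * N)" and ?b = "fps_const (inverse x) * fps_X ^ (r - s + r * N)"
  let ?u = "\<lambda>k. theta_term (int k - int N)" and ?v = "\<lambda>k. theta_term (int k - int (Suc N))"
  let ?S = "\<Sum>k\<le>2*N. qbinom ?p (2*N) k * ?u k"
  let ?S' = "\<Sum>k\<le>Suc (2*N). qbinom ?p (Suc (2*N)) k * ?u k"
  note P2 = qbinom_Suc_Suc'[OF qfact_fps_X_nonzero]
  have "?a * ?S = (\<Sum>k\<le>2*N. qbinom ?p (2*N) k * (?p ^ (2*N - k) * ?u (Suc k)))"
    unfolding sum_distrib_left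
  proof (rule sum.cong[OF refl])
    fix k assume "k \<in> {..2*N}"
    then have "k \<le> 2 * N" by simp
    from theta_term_up[OF this]
    show "?a * (qbinom ?p (2*N) k * ?u k) = qbinom ?p (2*N) k * (?p ^ (2*N - k) * ?u (Suc k))"
      by (metis mult.left_commute)
  qed
  moreover have "?S = ?u 0 + (\<Sum>k\<le>2*N. qbinom ?p (2*N) (Suc k) * ?u (Suc k))"
  proof -
    have "?S = (\<Sum>k\<le>Suc (2*N). qbinom ?p (2*N) k * ?u k)" by (simp add: qbinom_eq_0)
    also have "\<dots> = ?u 0 + (\<Sum>k\<le>2*N. qbinom ?p (2*N) (Suc k) * ?u (Suc k))"
      by (subst sum.atMost_Suc_shift) simp
    finally show ?thesis .
  qed
  ultimately have "(1 + ?a) * ?S = ?u 0 + (\<Sum>k\<le>2*N. (?p ^ (2*N - k) * qbinom ?p (2*N) k + qbinom ?p (2*N) (Suc k)) * ?u (Suc k))"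
  proof -
    assume 1: "?a * ?S = (\<Sum>k\<le>2*N. qbinom ?p (2*N) k * (?p ^ (2*N - k) * ?u (Suc k)))"
      and 2: "?S = ?u 0 + (\<Sum>k\<le>2*N. qbinom ?p (2*N) (Suc k) * ?u (Suc k))"
    have "(1 + ?a) * ?S = ?S + ?a * ?S" by (simp only: distrib_right mult_1)
    also have "\<dots> = ?u 0 + (\<Sum>k\<le>2*N. qbinom ?p (2*N) (Suc k) * ?u (Suc k)) +
        (\<Sum>k\<le>2*N. qbinom ?p (2*N) k * (?p ^ (2*N - k) * ?u (Suc k)))"
      unfolding 1 by (subst 2) (rule refl)
    also have "\<dots> = ?u 0 + (\<Sum>k\<le>2*N. qbinom ?p (2*N) (Suc k) * ?u (Suc k) +
        qbinom ?p (2*N) k * (?p ^ (2*N - k) * ?u (Suc k)))"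
      by (simp only: sum.distrib add.assoc)
    also have "\<dots> = ?u 0 + (\<Sum>k\<le>2*N. (?p ^ (2*N - k) * qbinom ?p (2*N) k + qbinom ?p (2*N) (Suc k)) * ?u (Suc k))"
      by (intro arg_cong2[where f = "(+)"] refl sum.cong) (simp add: algebra_simps)
    finally show ?thesis .
  qed
  also have "(\<Sum>k\<le>2*N. (?p ^ (2*N - k) * qbinom ?p (2*N) k + qbinom ?p (2*N) (Suc k)) * ?u (Suc k)) =
     (\<Sum>k\<le>2*N. qbinom ?p (Suc (2*N)) (Suc k) * ?u (Suc k))"
    by (rule sum.cong[OF refl]) (simp only: P2 atMost_iff)
  also have "?u 0 + \<dots> = ?S'"
    by (subst sum.atMost_Suc_shift[of "\<lambda>k. qbinom ?p (Suc (2*N)) k * ?u k"]) (simp only: qbinom.simps mult_1)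
  finally have half: "(1 + ?a) * ?S = ?S'" .
  \<comment> \<open>The factor with 1 / x lowers the exponents of x, so the terms are recentred from
    N to N + 1.\<close>
  have "?b * ?S' = (\<Sum>k\<le>Suc (2*N). ?p ^ k * qbinom ?p (Suc (2*N)) k * ?v k)"
    unfolding sum_distrib_left
  proof (rule sum.cong[OF refl])
    fix k
    show "?b * (qbinom ?p (Suc (2*N)) k * ?u k) = ?p ^ k * qbinom ?p (Suc (2*N)) k * ?v k"
    proof -
      have "?b * (qbinom ?p (Suc (2*N)) k * ?u k) = qbinom ?p (Suc (2*N)) k * (?b * ?u k)"
        by (simp only: mult_ac)
      also have "\<dots> = ?p ^ k * qbinom ?p (Suc (2*N)) k * ?v k"
        unfolding theta_term_down by (simp only: mult_ac)
      finally show ?thesis .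
    qed
  qed
  also have "\<dots> = (\<Sum>k\<le>Suc (Suc (2*N)). ?p ^ k * qbinom ?p (Suc (2*N)) k * ?v k)"
    unfolding sum.atMost_Suc[of _ "Suc (2*N)"] by (simp only: qbinom_eq_0[OF lessI] mult_zero_left mult_zero_right add_0_right)
  also have "\<dots> = ?v 0 + (\<Sum>k\<le>Suc (2*N). ?p ^ Suc k * qbinom ?p (Suc (2*N)) (Suc k) * ?v (Suc k))"
    unfolding sum.atMost_Suc_shift[of _ "Suc (2*N)"] by (simp only: qbinom.simps power_0 mult_1)
  finally have "?b * ?S' = \<dots>" .
  moreover have "?S' = (\<Sum>k\<le>Suc (2*N). qbinom ?p (Suc (2*N)) k * ?v (Suc k))"
    by simp
  ultimately have "(1 + ?b) * ?S' = ?v 0 + (\<Sum>k\<le>Suc (2*N).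
       (qbinom ?p (Suc (2*N)) k + ?p ^ Suc k * qbinom ?p (Suc (2*N)) (Suc k)) * ?v (Suc k))"
    unfolding distrib_right sum.distrib mult_1 by (simp only: add_ac)
  also have "\<dots> = ?v 0 + (\<Sum>k\<le>Suc (2*N). qbinom ?p (Suc (Suc (2*N))) (Suc k) * ?v (Suc k))"
    by (simp only: qbinom.simps)
  also have "\<dots> = (\<Sum>k\<le>Suc (Suc (2*N)). qbinom ?p (Suc (Suc (2*N))) k * ?v k)"
    unfolding sum.atMost_Suc_shift[of _ "Suc (2*N)"] by (simp only: qbinom.simps mult_1)
  finally have "(1 + ?b) * ((1 + ?a) * ?S) = (\<Sum>k\<le>2 * Suc N. qbinom ?p (2 * Suc N) k * ?v k)"
    unfolding half by (simp only: mult_Suc_right add_2_eq_Suc)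
  then show ?case unfolding prod.lessThan_Suc Suc.IH by (simp only: mult_ac)
qed

text \<open>The limit of the finite form, multiplied by (q^r; q^r) because the central Gaussian
  binomials tend to its inverse. The first factor with x stands apart: for s = 0 its variable part
  has constant term x, while the convergence of \<open>qpoch_inf\<close> is established for
  arguments without constant term.\<close>

theorem jacobi_triple_product:
  "(1 + fps_const x * fps_X ^ s) *
   qpoch_inf (- fps_const x * fps_X ^ (s + r)) (fps_X ^ r) *
   qpoch_inf (- fps_const (inverse x) * fps_X ^ (r - s)) (fps_X ^ r) *
   qpoch_inf (fps_X ^ r) (fps_X ^ r) = fsum UNIV (theta_wt r s) (\<lambda>n. x powi n)"
proof -
  let ?p = "fps_X ^ r :: 'a fps"
  define B where "B = qpoch_inf ?p ?p"
  have p0: "?p $ 0 = 0" using sr by simp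
  have a0: "(- fps_const x * fps_X ^ (s + r)) $ 0 = 0" and b0: "(- fps_const (inverse x) * fps_X ^ (r - s)) $ 0 = 0"
    using sr by (simp_all add: fps_mult_nth)
  define P where "P N = (\<Prod>j<N. (1 + fps_const x * fps_X ^ (s + r * j)) * (1 + fps_const (inverse x) * fps_X ^ (r - s + r * j)))" for N
  have "P (Suc N) = (1 + fps_const x * fps_X ^ s) *
      (\<Prod>j<N. 1 - (- fps_const x * fps_X ^ (s + r)) * ?p ^ j) *
      (\<Prod>j<Suc N. 1 - (- fps_const (inverse x) * fps_X ^ (r - s)) * ?p ^ j)" for N
  proof -
    have 1: "1 + fps_const x * fps_X ^ (s + r * Suc j) = 1 - (- fps_const x * fps_X ^ (s + r)) * ?p ^ j" for j
      by (simp add: power_add power_mult mult.assoc flip: fps_const_neg)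
    have 2: "1 + fps_const (inverse x) * fps_X ^ (r - s + r * j) =
        1 - (- fps_const (inverse x) * fps_X ^ (r - s)) * ?p ^ j" for j
      by (simp add: power_add power_mult mult.assoc flip: fps_const_neg)
    show ?thesis unfolding P_def prod.distrib 2
      by (subst prod.lessThan_Suc_shift) (simp only: 1 mult_0_right add_0_right)
  qed
  moreover have "(\<lambda>N. (1 + fps_const x * fps_X ^ s) *
      (\<Prod>j<N. 1 - (- fps_const x * fps_X ^ (s + r)) * ?p ^ j) *
      (\<Prod>j<Suc N. 1 - (- fps_const (inverse x) * fps_X ^ (r - s)) * ?p ^ j)) \<longlonglongrightarrow>
    (1 + fps_const x * fps_X ^ s) *
     qpoch_inf (- fps_const x * fps_X ^ (s + r)) ?p *
     qpoch_inf (- fps_const (inverse x) * fps_X ^ (r - s)) ?p"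
    by (intro tendsto_fps_mult tendsto_const tendsto_qpoch[OF a0 p0] LIMSEQ_Suc[OF tendsto_qpoch[OF b0 p0]])
  ultimately have lim1: "(\<lambda>N. P (Suc N) * B) \<longlonglongrightarrow> (1 + fps_const x * fps_X ^ s) *
     qpoch_inf (- fps_const x * fps_X ^ (s + r)) ?p *
     qpoch_inf (- fps_const (inverse x) * fps_X ^ (r - s)) ?p * B"
    by (simp add: tendsto_fps_mult)

  have lim2: "(\<lambda>N. P N * B) \<longlonglongrightarrow> fsum UNIV (theta_wt r s) (\<lambda>n. x powi n)"
  proof (rule tendsto_fpsI)
    fix M
    have "\<forall>\<^sub>F l in sequentially. \<forall>i\<in>{..M}. qfact ?p l $ i = B $ i"
    proof (intro eventually_ball_finite ballI)
      fix i
      have "(\<lambda>l. \<Prod>j<l. 1 - ?p * ?p ^ j) \<longlonglongrightarrow> B" unfolding B_def by (rule tendsto_qpoch[OF p0 p0])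
      then show "\<forall>\<^sub>F l in sequentially. qfact ?p l $ i = B $ i"
        by (simp add: tendsto_fps_iff qfact_def)
    qed simp
    then obtain L where L: "\<And>l i. l \<ge> L \<Longrightarrow> i \<le> M \<Longrightarrow> qfact ?p l $ i = B $ i"
      by (auto simp: eventually_sequentially)
    \<comment> \<open>From this N on, the linear bounds force k \<ge> L and 2 N - k \<ge> L for
      every term of weight at most M; the extra 1 comes from the bound \<open>n - 1\<close>.\<close>
    show "\<forall>\<^sub>F N in sequentially. (P N * B) $ M = fsum UNIV (theta_wt r s) (\<lambda>n. x powi n) $ M"
      using eventually_ge_at_top[of "L + M + 1"]
    proof eventually_elim
      case (elim N)
      have B0: "B $ 0 \<noteq> 0" unfolding B_def by (simp add: qpoch_nth_0[OF p0 p0])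
      \<comment> \<open>In degrees up to M each of the three q-factorials may be replaced by its
        limit B. The product formula for the Gaussian binomial then reads
        \<open>qbinom * B * B = B\<close>, and one B is divided out.\<close>
      have one: "(qbinom ?p (2*N) k * B) $ i = 1 $ i"
        if k: "k \<le> 2 * N" "k \<ge> L" "2 * N - k \<ge> L" and i: "i \<le> M" for k i
      proof -
        have 1: "\<forall>i\<le>M. (qbinom ?p (2*N) k * qfact ?p k * qfact ?p (2*N - k)) $ i = (qbinom ?p (2*N) k * B * B) $ i"
          using L k by (intro fps_nth_mult_cong) auto
        have 2: "\<forall>i\<le>M. (qbinom ?p (2*N) k * B * B) $ i = B $ i"
          using 1 L k elim by (auto simp: qbinom_qfact)
        have "\<forall>i\<le>M. (qbinom ?p (2*N) k * B * B * inverse B) $ i = (B * inverse B) $ i"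
          using 2 by (intro fps_nth_mult_cong) auto
        then show ?thesis using i B0 by (simp add: mult.assoc inverse_mult_eq_1')
      qed
      have coef: "(qbinom ?p (2*N) k * theta_term (int k - int N) * B) $ M =
          (if theta_wt r s (int k - int N) = M then x powi (int k - int N) else 0)"
        if k: "k \<le> 2 * N" for k
      proof -
        let ?w = "theta_wt r s (int k - int N)"
        have "(qbinom ?p (2*N) k * theta_term (int k - int N) * B) $ M =
           x powi (int k - int N) * ((qbinom ?p (2*N) k * B) * fps_X ^ ?w) $ M"
        proof -
          have "qbinom ?p (2*N) k * theta_term (int k - int N) * B =
              fps_const (x powi (int k - int N)) * ((qbinom ?p (2*N) k * B) * fps_X ^ ?w)"
            unfolding theta_term_def by (simp only: mult_ac)
          then show ?thesis by (simp only: fps_mult_left_const_nth)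
        qed
        also have "((qbinom ?p (2*N) k * B) * fps_X ^ ?w) $ M = (if ?w = M then 1 else 0)"
        proof (cases "?w \<le> M")
          case True
          have "int k - int N - 1 \<le> M" "int N - int k \<le> M"
            using int_theta_wt[OF sr, of "int k - int N"] True by linarith+
          then have "k \<ge> L" "2 * N - k \<ge> L" using elim k by linarith+
          then show ?thesis using True one[OF k, of "M - ?w"] by (simp add: fps_X_power_mult_right_nth)
        next
          case False
          then show ?thesis by (simp add: fps_X_power_mult_right_nth)
        qed
        finally show ?thesis by simp
      qed
      have "(P N * B) $ M = (\<Sum>k\<le>2*N. if theta_wt r s (int k - int N) = M then x powi (int k - int N) else 0)"
        unfolding P_def finite_triple_product sum_distrib_right fps_sum_nth
        by (rule sum.cong[OF refl]) (simp add: coef)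
      also have "\<dots> = (\<Sum>k | k \<le> 2 * N \<and> theta_wt r s (int k - int N) = M. x powi (int k - int N))"
        by (subst sum.inter_filter[symmetric]) (auto intro!: sum.cong)
      also have "\<dots> = (\<Sum>n | n \<in> UNIV \<and> theta_wt r s n = M. x powi n)"
      proof (rule sum.reindex_bij_betw)
        show "bij_betw (\<lambda>k. int k - int N) {k. k \<le> 2 * N \<and> theta_wt r s (int k - int N) = M}
            {n. n \<in> UNIV \<and> theta_wt r s n = M}"
        proof (rule bij_betwI[of _ _ _ "\<lambda>n. nat (n + int N)"])
          have bd: "n \<le> int N \<and> - n \<le> int N" if "theta_wt r s n = M" for n
            using int_theta_wt[OF sr, of n] that elim by linarith
          show "(\<lambda>n. nat (n + int N)) \<in> {n. n \<in> UNIV \<and> theta_wt r s n = M} \<rightarrow>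
              {k. k \<le> 2 * N \<and> theta_wt r s (int k - int N) = M}"
          proof
            fix n assume "n \<in> {n. n \<in> UNIV \<and> theta_wt r s n = M}"
            then have n: "theta_wt r s n = M" by simp
            from bd[OF n] have "int (nat (n + int N)) - int N = n" "nat (n + int N) \<le> 2 * N" by linarith+
            then show "nat (n + int N) \<in> {k. k \<le> 2 * N \<and> theta_wt r s (int k - int N) = M}"
              using n by simp
          qed
          fix n assume "n \<in> {n. n \<in> UNIV \<and> theta_wt r s n = M}"
          then show "int (nat (n + int N)) - int N = n" using bd[of n] by auto
        qed auto
      qed
      finally show ?case by (simp add: fsum_nth)
    qed
  qed
  have "(\<lambda>N. P (Suc N) * B) \<longlonglongrightarrow> fsum UNIV (theta_wt r s) (\<lambda>n. x powi n)"
    using LIMSEQ_Suc[OF lim2] .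
  with lim1 show ?thesis unfolding B_def using LIMSEQ_unique by blast
qed

end

section \<open>Laurent coefficients and their symmetries\<close>

text \<open>Unlike in \<^typ>\<open>laurent\<close>, the exponent vectors are arbitrary functions, so that the affine maps of
  exponents below need no finiteness conditions.\<close>

type_synonym lp = "(nat \<Rightarrow> int) \<Rightarrow>\<^sub>0 int"

text \<open>\<open>coe F (m, k)\<close> is the coefficient of \<open>q\<^sup>m x\<^sup>k\<close>, and is 0 for negative \<open>m\<close>.\<close>

definition coe :: "lp fps \<Rightarrow> int \<times> (nat \<Rightarrow> int) \<Rightarrow> int" where
  "coe F v = (if fst v < 0 then 0 else Poly_Mapping.lookup (F $ nat (fst v)) (snd v))"

section \<open>Arithmetic of coefficient arrays\<close>

lemma coe_eqI: "(\<And>v. coe F v = coe G v) \<Longrightarrow> F = G"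
proof (rule fps_ext, rule poly_mapping_eqI)
  fix n k assume "\<And>v. coe F v = coe G v"
  from this[of "(int n, k)"] show "Poly_Mapping.lookup (F $ n) k = Poly_Mapping.lookup (G $ n) k" by (simp add: coe_def)
qed

lemma coe_0 [simp]: "coe 0 v = 0" by (simp add: coe_def)
lemma coe_add: "coe (F + G) v = coe F v + coe G v" by (simp add: coe_def lookup_add)
lemma coe_uminus: "coe (- F) v = - coe F v" by (simp add: coe_def lookup_uminus)
lemma coe_diff: "coe (F - G) v = coe F v - coe G v" by (simp add: coe_def lookup_minus)
lemma coe_sum: "coe (\<Sum>i\<in>I. F i) v = (\<Sum>i\<in>I. coe (F i) v)"
  by (induction I rule: infinite_finite_induct) (auto simp: coe_add)

lemma coe_of_int: "coe (of_int c * F) v = c * coe F v"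
proof -
  have "coe (of_nat n * F) v = int n * coe F v" for n
    by (induction n) (auto simp: coe_add algebra_simps)
  then show ?thesis by (cases c) (auto simp: coe_uminus simp del: of_nat_Suc)
qed

lemma lookup_mult_diff:
  "Poly_Mapping.lookup (f * g) k = (\<Sum>l\<in>Poly_Mapping.keys f. Poly_Mapping.lookup f l * Poly_Mapping.lookup g (k - l))" for f g :: lp
proof -
  have "(\<Sum>q. Poly_Mapping.lookup g q when k = l + q) = Poly_Mapping.lookup g (k - l)" for l
  proof -
    have "(Poly_Mapping.lookup g q when k = l + q) = (Poly_Mapping.lookup g q when q = k - l)" for q
      by (auto simp: when_def algebra_simps)
    then show ?thesis by simp
  qed
  then have "Poly_Mapping.lookup (f * g) k = (\<Sum>l. Poly_Mapping.lookup f l * Poly_Mapping.lookup g (k - l))"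
    by (simp add: lookup_mult)
  also have "\<dots> = (\<Sum>l\<in>Poly_Mapping.keys f. Poly_Mapping.lookup f l * Poly_Mapping.lookup g (k - l))"
    by (rule Sum_any.expand_superset) (auto simp: in_keys_iff)
  finally show ?thesis .
qed

text \<open>The Cauchy product is written as a convolution over the whole lattice, without bounds on
  the indices, so that an affine lattice map can be applied to the summation index. Finitely many
  terms survive: both powers of q must be nonnegative, and each coefficient of F is a Laurent
  polynomial.\<close>

lemma coe_mult:
  shows "finite {u. coe F u * coe G (v - u) \<noteq> 0}" (is "finite ?S")
    and "coe (F * G) v = (\<Sum>u | coe F u * coe G (v - u) \<noteq> 0. coe F u * coe G (v - u))"
proof -
  obtain m k where v: "v = (m, k)" by force
  let ?D = "SIGMA i:{0..nat m}. Poly_Mapping.keys (F $ i)"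
  let ?h = "\<lambda>(i, l). (int i, l)"
  have sub: "?S \<subseteq> ?h ` ?D"
  proof
    fix u assume u: "u \<in> ?S"
    obtain a l where ul: "u = (a, l)" by force
    from u have a: "a \<ge> 0" "a \<le> m" and l: "l \<in> Poly_Mapping.keys (F $ nat a)"
      by (auto simp: coe_def ul v in_keys_iff split: if_splits)
    have "u = ?h (nat a, l)" using a ul by simp
    moreover have "(nat a, l) \<in> ?D" using a l by (auto simp: nat_mono)
    ultimately show "u \<in> ?h ` ?D" by blast
  qed
  then show fin: "finite ?S" by (rule finite_subset) auto
  show "coe (F * G) v = (\<Sum>u\<in>?S. coe F u * coe G (v - u))"
  proof (cases "m < 0")
    case True
    then have "?S = {}" by (auto simp: coe_def v)
    then show ?thesis using True by (simp add: coe_def v)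
  next
    case False
    have "coe (F * G) v = (\<Sum>i=0..nat m. \<Sum>l\<in>Poly_Mapping.keys (F $ i). Poly_Mapping.lookup (F $ i) l * Poly_Mapping.lookup (G $ (nat m - i)) (k - l))"
      using False by (simp add: coe_def v fps_mult_nth lookup_sum lookup_mult_diff)
    also have "\<dots> = (\<Sum>(i, l)\<in>?D. Poly_Mapping.lookup (F $ i) l * Poly_Mapping.lookup (G $ (nat m - i)) (k - l))"
      by (subst sum.Sigma) auto
    also have "\<dots> = (\<Sum>x\<in>?D. coe F (?h x) * coe G (v - ?h x))"
    proof (rule sum.cong[OF refl])
      fix x assume "x \<in> ?D"
      moreover obtain i l where x: "x = (i, l)" by force
      ultimately have "i \<le> nat m" by simp
      then have "nat (m - int i) = nat m - i" "m - int i \<ge> 0" using False by auto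
      then show "(case x of (i, l) \<Rightarrow> Poly_Mapping.lookup (F $ i) l * Poly_Mapping.lookup (G $ (nat m - i)) (k - l)) =
          coe F (?h x) * coe G (v - ?h x)" by (simp add: x coe_def v)
    qed
    also have "\<dots> = (\<Sum>u\<in>?h ` ?D. coe F u * coe G (v - u))"
      by (subst sum.reindex) (auto simp: inj_on_def)
    also have "\<dots> = (\<Sum>u\<in>?S. coe F u * coe G (v - u))"
      using sub by (intro sum.mono_neutral_right) auto
    finally show ?thesis .
  qed
qed

lemma bij_betw_restrict_preimage:
  "bij_betw s I J \<Longrightarrow> bij_betw s {i \<in> I. P (s i)} {j \<in> J. P j}"
  by (auto simp: bij_betw_def inj_on_def image_def)

text \<open>For \<open>L\<close> induced by a substitution of the variables, this is the functional equation that the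
  substitution takes \<open>F\<close> to \<open>e\<close> times a monomial times \<open>G\<close>, read off on coefficients.\<close>

definition quasi_inv ::
  "(int \<times> (nat \<Rightarrow> int) \<Rightarrow> int \<times> (nat \<Rightarrow> int)) \<Rightarrow> int \<times> (nat \<Rightarrow> int) \<Rightarrow> int \<Rightarrow> lp fps \<Rightarrow> lp fps \<Rightarrow> bool" where
  "quasi_inv L b e F G \<longleftrightarrow> (\<forall>v. coe F (L v + b) = e * coe G v)"

text \<open>Additivity is phrased through differences because the convolution in
  \<open>coe_mult\<close> involves \<open>v - u\<close>.\<close>

definition lattice_aut :: "(int \<times> (nat \<Rightarrow> int) \<Rightarrow> int \<times> (nat \<Rightarrow> int)) \<Rightarrow> bool" where
  "lattice_aut L \<longleftrightarrow> bij L \<and> (\<forall>u v. L (u - v) = L u - L v)"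

text \<open>Substitute \<open>w \<mapsto> L w + b\<close> in the convolution: the two shifts add up
  and the two scalars multiply.\<close>

lemma quasi_inv_mult:
  assumes L: "lattice_aut L" and FG: "quasi_inv L b e F G" and FG': "quasi_inv L b' e' F' G'"
  shows "quasi_inv L (b + b') (e * e') (F * F') (G * G')"
  unfolding quasi_inv_def
proof
  fix v
  let ?h = "\<lambda>w. L w + b"
  have bij: "bij ?h"
    using L bij_comp[of L "\<lambda>x. x + b"] bij_plus_right[of b] by (simp add: lattice_aut_def o_def)
  have bb: "bij_betw ?h {w. coe F (?h w) * coe F' (L v + (b + b') - ?h w) \<noteq> 0}
      {u. coe F u * coe F' (L v + (b + b') - u) \<noteq> 0}"
    using bij_betw_restrict_preimage[OF bij, of "\<lambda>u. coe F u * coe F' (L v + (b + b') - u) \<noteq> 0"]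
    by (simp only: UNIV_I simp_thms)
  have d: "L v + (b + b') - ?h w = L (v - w) + b'" for w
  proof -
    have "L (v - w) = L v - L w" using L unfolding lattice_aut_def by blast
    then show ?thesis by (simp add: algebra_simps)
  qed
  have "coe (F * F') (L v + (b + b')) =
    (\<Sum>w | coe F (?h w) * coe F' (L v + (b + b') - ?h w) \<noteq> 0. coe F (?h w) * coe F' (L v + (b + b') - ?h w))"
    by (subst coe_mult(2), rule sum.reindex_bij_betw[OF bb, symmetric])
  also have "\<dots> = (\<Sum>w | e * coe G w * (e' * coe G' (v - w)) \<noteq> 0. e * coe G w * (e' * coe G' (v - w)))"
    unfolding d using FG FG' by (simp only: quasi_inv_def)
  also have "\<dots> = (\<Sum>w | coe G w * coe G' (v - w) \<noteq> 0. e * coe G w * (e' * coe G' (v - w)))"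
    using coe_mult(1) by (intro sum.mono_neutral_left) auto
  also have "\<dots> = e * e' * coe (G * G') v"
    unfolding coe_mult(2) sum_distrib_left by (simp only: mult_ac)
  finally show "coe (F * F') (L v + (b + b')) = e * e' * coe (G * G') v" .
qed

lemma coe_1: "coe 1 v = (if v = 0 then 1 else 0)"
  by (auto simp: coe_def lookup_one zero_prod_def prod_eq_iff nat_eq_iff when_def)

lemma lattice_aut_eq_0: "lattice_aut L \<Longrightarrow> L v = 0 \<longleftrightarrow> v = 0"
proof -
  assume L: "lattice_aut L"
  then have "L (0 - 0) = L 0 - L 0" unfolding lattice_aut_def by blast
  then have "L 0 = 0" by simp
  moreover have "inj L" using L by (auto simp: lattice_aut_def bij_def)
  ultimately show ?thesis by (metis injD)
qed

lemma quasi_inv_1: "lattice_aut L \<Longrightarrow> quasi_inv L 0 1 1 1"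
  by (simp add: quasi_inv_def coe_1 lattice_aut_eq_0)

lemma quasi_inv_prod:
  assumes "lattice_aut L" "\<And>i. i \<in> I \<Longrightarrow> quasi_inv L (b i) (e i) (F i) (G i)" "finite I"
  shows "quasi_inv L (\<Sum>i\<in>I. b i) (\<Prod>i\<in>I. e i) (\<Prod>i\<in>I. F i) (\<Prod>i\<in>I. G i)"
  using assms(3,2)
  by (induction I rule: finite_induct) (auto intro: quasi_inv_mult quasi_inv_1 assms(1))

lemma quasi_inv_sum:
  assumes "\<And>i. i \<in> I \<Longrightarrow> quasi_inv L b e (F i) (G i)"
  shows "quasi_inv L b e (\<Sum>i\<in>I. F i) (\<Sum>i\<in>I. G i)"
  using assms by (auto simp: quasi_inv_def coe_sum sum_distrib_left)

lemma quasi_inv_of_int: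
  "quasi_inv L b e F G \<Longrightarrow> quasi_inv L b e (of_int c * F) (of_int c * G)"
  by (simp add: quasi_inv_def coe_of_int)

lemma quasi_inv_diff:
  "quasi_inv L b e F G \<Longrightarrow> quasi_inv L b e F' G' \<Longrightarrow> quasi_inv L b e (F - F') (G - G')"
  by (simp add: quasi_inv_def coe_diff algebra_simps)

lemma det_mat_leibniz:
  fixes f :: "nat \<Rightarrow> nat \<Rightarrow> 'a::comm_ring_1"
  shows "Determinant.det (mat n n (\<lambda>(i, j). f i j)) =
    (\<Sum>p | p permutes {0..<n}. of_int (sign p) * (\<Prod>i=0..<n. f i (p i)))"
proof -
  have "(\<Prod>i=0..<n. mat n n (\<lambda>(i, j). f i j) $$ (i, p i)) = (\<Prod>i=0..<n. f i (p i))"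
    if "p permutes {0..<n}" for p
    using permutes_in_image[OF that] by (intro prod.cong) auto
  then show ?thesis by (subst det_def'[of _ n]) (auto intro!: sum.cong)
qed

text \<open>The shift and the scalar depend on the row alone, so all Leibniz terms transform
  alike.\<close>

lemma quasi_inv_det:
  assumes L: "lattice_aut L"
    and "\<And>i j. i < n \<Longrightarrow> j < n \<Longrightarrow> quasi_inv L (b i) (e i) (f i j) (h i j)"
  shows "quasi_inv L (\<Sum>i=0..<n. b i) (\<Prod>i=0..<n. e i)
    (Determinant.det (mat n n (\<lambda>(i, j). f i j))) (Determinant.det (mat n n (\<lambda>(i, j). h i j)))"
  unfolding det_mat_leibniz
  by (intro quasi_inv_sum quasi_inv_of_int quasi_inv_prod L assms(2)) (auto dest: permutes_in_image)

definition lsum :: "'i set \<Rightarrow> ('i \<Rightarrow> nat) \<Rightarrow> ('i \<Rightarrow> nat \<Rightarrow> int) \<Rightarrow> ('i \<Rightarrow> int) \<Rightarrow> lp fps" where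
  "lsum I w k a = fsum I w (\<lambda>i. Poly_Mapping.single (k i) (a i))"

lemma coe_lsum:
  assumes "fin_fibres I w"
  shows "coe (lsum I w k a) v = (\<Sum>i | i \<in> I \<and> (int (w i), k i) = v. a i)"
proof (cases "fst v < 0")
  case True
  then have "{i. i \<in> I \<and> (int (w i), k i) = v} = {}" by auto
  then show ?thesis using True by (simp only: coe_def if_True) simp
next
  case False
  let ?m = "nat (fst v)"
  have fin: "finite {i \<in> I. w i = ?m}" using assms by (simp add: fin_fibres_def)
  have "coe (lsum I w k a) v = (\<Sum>i | i \<in> I \<and> w i = ?m. if k i = snd v then a i else 0)"
    using False by (simp add: coe_def lsum_def fsum_nth lookup_sum lookup_single when_def)
  also have "\<dots> = (\<Sum>i\<in>{i \<in> {i \<in> I. w i = ?m}. k i = snd v}. a i)"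
    using fin by (rule sum.inter_filter[symmetric])
  also have "{i \<in> {i \<in> I. w i = ?m}. k i = snd v} = {i. i \<in> I \<and> (int (w i), k i) = v}"
    using False by (auto simp: prod_eq_iff)
  finally show ?thesis .
qed

text \<open>The symmetries of the theta series below come from a relabelling s of their terms; this
  turns such a relabelling into a functional equation.\<close>

lemma quasi_inv_lsum:
  assumes L: "lattice_aut L" and fin: "fin_fibres I w" "fin_fibres I' w'"
    and s: "bij_betw s I' I"
    and eq: "\<And>i. i \<in> I' \<Longrightarrow> (int (w (s i)), k (s i)) = L (int (w' i), k' i) + b"
    and a: "\<And>i. i \<in> I' \<Longrightarrow> a (s i) = e * a' i"
  shows "quasi_inv L b e (lsum I w k a) (lsum I' w' k' a')"
  unfolding quasi_inv_def
proof
  fix v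
  have inj: "L x + b = L y + b \<longleftrightarrow> x = y" for x y
    using L by (auto simp: lattice_aut_def bij_def dest: injD)
  have "{i. i \<in> I' \<and> (int (w' i), k' i) = v} = {i \<in> I'. (int (w (s i)), k (s i)) = L v + b}"
    using inj by (intro Collect_cong conj_cong refl) (simp only: eq)
  then have bb: "bij_betw s {i. i \<in> I' \<and> (int (w' i), k' i) = v} {i. i \<in> I \<and> (int (w i), k i) = L v + b}"
    using bij_betw_restrict_preimage[OF s, of "\<lambda>j. (int (w j), k j) = L v + b"] by simp
  have "coe (lsum I w k a) (L v + b) = (\<Sum>i | i \<in> I' \<and> (int (w' i), k' i) = v. a (s i))"
    by (simp only: coe_lsum[OF fin(1)] sum.reindex_bij_betw[OF bb, symmetric])
  also have "\<dots> = e * coe (lsum I' w' k' a') v"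
    by (simp add: coe_lsum[OF fin(2)] a sum_distrib_left)
  finally show "coe (lsum I w k a) (L v + b) = e * coe (lsum I' w' k' a') v" .
qed

text \<open>The next three maps of exponents come from \<open>x\<^sub>i \<mapsto> q\<^sup>2 x\<^sub>i\<close>, from \<open>x\<^sub>i \<mapsto> 1 / x\<^sub>i\<close> and from swapping
  \<open>x\<^sub>i\<close> and \<open>x\<^sub>j\<close>.\<close>

definition shear :: "nat \<Rightarrow> int \<times> (nat \<Rightarrow> int) \<Rightarrow> int \<times> (nat \<Rightarrow> int)" where
  "shear i v = (fst v + 2 * snd v i, snd v)"

definition negate :: "nat \<Rightarrow> int \<times> (nat \<Rightarrow> int) \<Rightarrow> int \<times> (nat \<Rightarrow> int)" where
  "negate i v = (fst v, (snd v)(i := - snd v i))"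

definition exchange :: "nat \<Rightarrow> nat \<Rightarrow> int \<times> (nat \<Rightarrow> int) \<Rightarrow> int \<times> (nat \<Rightarrow> int)" where
  "exchange i j v = (fst v, snd v \<circ> Transposition.transpose i j)"

lemma lattice_aut_shear: "lattice_aut (shear i)"
  unfolding lattice_aut_def
proof
  show "bij (shear i)"
    by (rule bij_betwI[of _ _ _ "\<lambda>v. (fst v - 2 * snd v i, snd v)"]) (auto simp: shear_def)
qed (auto simp: shear_def prod_eq_iff)

lemma lattice_aut_negate: "lattice_aut (negate i)"
  unfolding lattice_aut_def
proof
  show "bij (negate i)"
    by (rule bij_betwI[of _ _ _ "negate i"]) (auto simp: negate_def)
qed (auto simp: negate_def prod_eq_iff)

lemma lattice_aut_exchange: "lattice_aut (exchange i j)"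
  unfolding lattice_aut_def
proof
  show "bij (exchange i j)"
    by (rule bij_betwI[of _ _ _ "exchange i j"]) (auto simp: exchange_def o_assoc fun_eq_iff)
qed (auto simp: exchange_def prod_eq_iff)

lemma lattice_aut_id: "lattice_aut (\<lambda>v. v)"
  by (simp add: lattice_aut_def bij_id[unfolded id_def])

section \<open>Rigidity of series with the affine symmetries\<close>

definition unitv :: "nat \<Rightarrow> nat \<Rightarrow> int" where "unitv i = (\<lambda>j. if j = i then 1 else 0)"

text \<open>On exponents, \<open>shear_inv\<close> is the translation of \<open>k i\<close> by 2 t
  accompanied by a power of q, \<open>negate_inv\<close> is the reflection of \<open>k i\<close>
  into \<open>1 - k i\<close> with a sign, and \<open>exchange_inv\<close> is antisymmetry.
  \<open>shear_triv\<close> encodes that only variables of index below t occur.\<close>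

locale weyl_inv =
  fixes t :: nat and F :: "lp fps"
  assumes shear_inv: "\<And>i. i < t \<Longrightarrow> quasi_inv (shear i) (int (2 * t) - 1, \<lambda>j. int (2 * t) * unitv i j) 1 F F"
    and shear_triv: "\<And>i. i \<ge> t \<Longrightarrow> quasi_inv (shear i) 0 1 F F"
    and negate_inv: "\<And>i. i < t \<Longrightarrow> quasi_inv (negate i) (0, unitv i) (- 1) F F"
    and exchange_inv: "\<And>i j. i < t \<Longrightarrow> j < t \<Longrightarrow> i \<noteq> j \<Longrightarrow> quasi_inv (exchange i j) 0 (- 1) F F"
begin

text \<open>Vanishing is required for all powers of q at once, because a shear changes the power of
  q by an amount that depends on k.\<close>

definition vanish :: "(nat \<Rightarrow> int) \<Rightarrow> bool" where "vanish k \<longleftrightarrow> (\<forall>m. coe F (m, k) = 0)"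

lemma vanish_shear:
  assumes "i < t" shows "vanish (k(i := z + 2 * int t)) \<longleftrightarrow> vanish (k(i := z))"
proof -
  have "shear i (m, k(i := z)) + (int (2 * t) - 1, \<lambda>j. int (2 * t) * unitv i j) =
     (m + (2 * z + 2 * int t - 1), k(i := z + 2 * int t))" for m
    by (auto simp: shear_def unitv_def)
  with shear_inv[OF assms]
  have *: "coe F (m + (2 * z + 2 * int t - 1), k(i := z + 2 * int t)) = coe F (m, k(i := z))" for m
    unfolding quasi_inv_def by (metis mult_1)
  show ?thesis unfolding vanish_def
  proof
    assume "\<forall>m. coe F (m, k(i := z)) = 0"
    then show "\<forall>m. coe F (m, k(i := z + 2 * int t)) = 0"
      using *[of "m - (2 * z + 2 * int t - 1)" for m] by simp
  qed (use * in metis)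
qed

lemma vanish_negate:
  assumes "i < t" shows "vanish (k(i := 1 - z)) \<longleftrightarrow> vanish (k(i := z))"
proof -
  have "negate i (m, k(i := z)) + (0, unitv i) = (m, k(i := 1 - z))" for m
    by (auto simp: negate_def unitv_def)
  with negate_inv[OF assms] have "coe F (m, k(i := 1 - z)) = - coe F (m, k(i := z))" for m
    unfolding quasi_inv_def by (metis mult_minus1)
  then show ?thesis by (simp add: vanish_def)
qed

lemma coe_exchange:
  assumes "i < t" "j < t" "i \<noteq> j" shows "coe F (m, k \<circ> Transposition.transpose i j) = - coe F (m, k)"
proof -
  have "exchange i j (m, k) + 0 = (m, k \<circ> Transposition.transpose i j)" by (simp add: exchange_def)
  with exchange_inv[OF assms] show ?thesis unfolding quasi_inv_def by (metis mult_minus1)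
qed

text \<open>The coefficient is constant along steps of \<open>2 * k i\<close> in the power of q.
  With a nonzero step this progression reaches negative powers, where coefficients are 0.\<close>

lemma vanish_outside:
  assumes "i \<ge> t" "k i \<noteq> 0" shows "vanish k"
proof -
  have *: "coe F (m + 2 * k i, k) = coe F (m, k)" for m
    using shear_triv[OF assms(1)] by (simp add: quasi_inv_def shear_def)
  have **: "coe F (m + 2 * k i * int n, k) = coe F (m, k)" for m n
  proof (induction n)
    case (Suc n)
    have "m + 2 * k i * int (Suc n) = (m + 2 * k i * int n) + 2 * k i" by (simp add: algebra_simps)
    then show ?case using Suc * by metis
  qed simp
  show ?thesis unfolding vanish_def
  proof
    fix m
    define n where "n = nat m + 1"
    have n: "int n > m" by (simp add: n_def)
    show "coe F (m, k) = 0"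
    proof (cases "k i < 0")
      case True
      then have "2 * k i * int n \<le> (-1) * int n" by (intro mult_right_mono) auto
      then have "m + 2 * k i * int n < 0" using n by linarith
      then show ?thesis using **[of m n] by (simp add: coe_def)
    next
      case False
      then have "1 * int n \<le> 2 * k i * int n" using assms(2) by (intro mult_right_mono) auto
      then have "m - 2 * k i * int n < 0" using n by linarith
      then show ?thesis using **[of "m - 2 * k i * int n" n] by (simp add: coe_def)
    qed
  qed
qed

text \<open>The translation by 2 t and the reflection \<open>z \<mapsto> 1 - z\<close> generate an
  infinite dihedral group on the integers, with fundamental domain {1..t}.\<close>

lemma vanish_reduce:
  assumes "i < t" "\<And>r. 1 \<le> r \<Longrightarrow> r \<le> int t \<Longrightarrow> vanish (k(i := r))"
  shows "vanish k"
proof -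
  have mult: "vanish (k(i := z + 2 * int t * int n)) \<longleftrightarrow> vanish (k(i := z))" for z n
  proof (induction n)
    case (Suc n)
    have "z + 2 * int t * int (Suc n) = (z + 2 * int t * int n) + 2 * int t" by (simp add: algebra_simps)
    then show ?case using Suc vanish_shear[OF assms(1)] by metis
  qed simp
  have multz: "vanish (k(i := z + 2 * int t * n)) \<longleftrightarrow> vanish (k(i := z))" for z n
  proof (cases "n \<ge> 0")
    case True
    then show ?thesis using mult[of z "nat n"] by simp
  next
    case False
    then show ?thesis using mult[of "z + 2 * int t * n" "nat (- n)"] by simp
  qed
  define r where "r = k i mod (2 * int t)"
  have r: "0 \<le> r" "r < 2 * int t" using assms(1) by (simp_all add: r_def)
  have "vanish (k(i := r))"
  proof -
    \<comment> \<open>The residue 0 reflects to 1, and r > t reflects to 1 - r, which translates to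
      2 t + 1 - r in {1..t}.\<close>
    consider "r = 0" | "1 \<le> r" "r \<le> int t" | "int t < r" using r by linarith
    then show ?thesis
    proof cases
      case 1
      then show ?thesis using assms vanish_negate[OF assms(1), of k 0] by simp
    next
      case 2
      then show ?thesis using assms by simp
    next
      case 3
      have "vanish (k(i := 1 - r + 2 * int t))" using 3 r by (intro assms(2)) linarith+
      then show ?thesis using vanish_shear[OF assms(1)] vanish_negate[OF assms(1)] by metis
    qed
  qed
  then have "vanish (k(i := r + 2 * int t * (k i div (2 * int t))))" using multz by blast
  moreover have "r + 2 * int t * (k i div (2 * int t)) = k i" by (simp add: r_def)
  ultimately show ?thesis by simp
qed

text \<open>The exponent vector (t, ..., 1) of the leading diagonal monomial of
  \<open>so_det t (\<lambda>_. 0)\<close>. It is the one vector whose coefficients control all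
  others.\<close>

definition base :: "nat \<Rightarrow> int" where "base i = (if i < t then int (t - i) else 0)"

text \<open>Exponents in \<open>{1..t}\<close> are the representatives of the affine reflections of one variable. By
  antisymmetry only the permutations of \<open>(t, \<dots>, 1)\<close> matter among them.\<close>

lemma vanish_alcove:
  assumes b: "vanish base" and k: "\<And>i. i < t \<Longrightarrow> 1 \<le> k i \<and> k i \<le> int t" "\<And>i. i \<ge> t \<Longrightarrow> k i = 0"
  shows "vanish k"
proof (cases "inj_on k {..<t}")
  case False
  then obtain i j where ij: "i < t" "j < t" "i \<noteq> j" "k i = k j" by (auto simp: inj_on_def)
  then have "k \<circ> Transposition.transpose i j = k" by (auto simp: fun_eq_iff Transposition.transpose_def)
  then show ?thesis using coe_exchange[OF ij(1-3), of _ k] by (simp add: vanish_def)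
next
  case True
  \<comment> \<open>Since \<open>base\<close> takes the value v at index t - v, this is the
    permutation with \<open>k = base \<circ> p\<close>.\<close>
  define p where "p i = (if i < t then t - nat (k i) else i)" for i
  have "p permutes {..<t}"
  proof (rule bij_imp_permutes)
    have "inj_on p {..<t}"
    proof (rule inj_onI)
      fix x y assume xy: "x \<in> {..<t}" "y \<in> {..<t}" "p x = p y"
      then have "k x = k y" using k(1)[of x] k(1)[of y] by (auto simp: p_def)
      then show "x = y" using True xy by (auto dest: inj_onD)
    qed
    moreover have "p ` {..<t} \<subseteq> {..<t}"
    proof
      fix y assume "y \<in> p ` {..<t}"
      then obtain i where "i < t" "y = p i" by auto
      then show "y \<in> {..<t}" using k(1)[of i] by (auto simp: p_def)
    qed
    ultimately show "bij_betw p {..<t} {..<t}"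
      by (metis bij_betw_def endo_inj_surj finite_lessThan)
  qed (simp add: p_def)
  moreover have "k = base \<circ> p"
  proof
    fix i show "k i = (base \<circ> p) i"
      using k(1)[of i] k(2)[of i] by (cases "i < t") (auto simp: base_def p_def)
  qed
  moreover have "vanish (base \<circ> p)" if "p permutes {..<t}" for p
    using finite_lessThan that
  proof (induction rule: permutes_rev_induct)
    case (swap a b p)
    then have "coe F (m, (base \<circ> p) \<circ> Transposition.transpose a b) = - coe F (m, base \<circ> p)" for m
      by (intro coe_exchange) auto
    then show ?case using swap by (simp only: vanish_def o_assoc minus_zero simp_thms)
  qed (simp add: b)
  ultimately show ?thesis by simp
qed

text \<open>Induction on the number of leading coordinates not yet known to lie in {1..t}; each is
  moved there by the dihedral group of its own variable.\<close>

lemma vanish_all: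
  assumes "vanish base" shows "F = 0"
proof -
  have "vanish k" if "n \<le> t" "\<And>i. n \<le> i \<Longrightarrow> i < t \<Longrightarrow> 1 \<le> k i \<and> k i \<le> int t" "\<And>i. i \<ge> t \<Longrightarrow> k i = 0" for n k
    using that
  proof (induction n arbitrary: k)
    case 0
    then show ?case using vanish_alcove[OF assms] by simp
  next
    case (Suc n)
    show ?case
    proof (rule vanish_reduce[of n])
      fix r assume r: "1 \<le> r" "r \<le> int t"
      show "vanish (k(n := r))" using Suc r by (intro Suc.IH) auto
    qed (use Suc in simp)
  qed
  from this[of t] have "vanish k" for k
    using vanish_outside[of _ k] by (metis le_refl not_le)
  then show ?thesis by (intro coe_eqI) (auto simp: vanish_def)
qed

end

section \<open>Uniqueness up to a series in q alone\<close>

lemma weyl_inv_diff: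
  assumes "weyl_inv t F" "weyl_inv t G" shows "weyl_inv t (F - G)"
  using assms unfolding weyl_inv_def by (auto intro: quasi_inv_diff)

definition scalar :: "int fps \<Rightarrow> lp fps" where
  "scalar c = Abs_fps (\<lambda>n. Poly_Mapping.single 0 (c $ n))"

lemma coe_scalar: "coe (scalar c) v = (if fst v \<ge> 0 \<and> snd v = 0 then c $ nat (fst v) else 0)"
  by (auto simp: coe_def scalar_def lookup_single when_def)

text \<open>Each of these maps fixes the zero exponent vector together with its power of q and sends
  no other vector to it, so series in q alone behave like constants.\<close>

lemma quasi_inv_scalar:
  assumes "L \<in> {shear i, negate i, exchange i j}"
  shows "quasi_inv L 0 1 (scalar c) (scalar c)"
proof -
  have "L (m, 0) = (m, 0)" for m
    using assms by (auto simp: shear_def negate_def exchange_def fun_eq_iff)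
  moreover have "snd (L v) = 0 \<Longrightarrow> snd v = 0" for v
  proof -
    have "(snd v)(i := - snd v i) = 0 \<Longrightarrow> snd v = 0"
      by (auto simp: fun_eq_iff split: if_splits)
    moreover have "snd v \<circ> Transposition.transpose i j = 0 \<Longrightarrow> snd v = 0"
    proof
      fix x assume "snd v \<circ> Transposition.transpose i j = 0"
      from fun_cong[OF this, of "Transposition.transpose i j x"] show "snd v x = 0 x" by simp
    qed
    ultimately show "snd (L v) = 0 \<Longrightarrow> snd v = 0"
      using assms by (auto simp: shear_def negate_def exchange_def)
  qed
  ultimately have "coe (scalar c) (L v) = coe (scalar c) v" for v
    by (cases "snd v = 0") (auto simp: coe_scalar, (metis fst_conv prod.collapse snd_conv)+)
  then show ?thesis by (simp add: quasi_inv_def)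
qed

lemma weyl_inv_scalar_mult:
  assumes "weyl_inv t F" shows "weyl_inv t (scalar c * F)"
proof -
  have "quasi_inv L b e (scalar c * F) (scalar c * F)"
    if "lattice_aut L" "quasi_inv L 0 1 (scalar c) (scalar c)" "quasi_inv L b e F F" for L b e
    using quasi_inv_mult[OF that] by simp
  note mult = this
  interpret weyl_inv t F by (rule assms)
  show ?thesis
  proof unfold_locales
    fix i assume "i < t"
    show "quasi_inv (shear i) (int (2 * t) - 1, \<lambda>j. int (2 * t) * unitv i j) 1 (scalar c * F) (scalar c * F)"
      by (rule mult[OF lattice_aut_shear quasi_inv_scalar shear_inv[OF \<open>i < t\<close>]]) blast
    show "quasi_inv (negate i) (0, unitv i) (- 1) (scalar c * F) (scalar c * F)"
      by (rule mult[OF lattice_aut_negate quasi_inv_scalar negate_inv[OF \<open>i < t\<close>]]) blast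
  next
    fix i assume "i \<ge> t"
    show "quasi_inv (shear i) 0 1 (scalar c * F) (scalar c * F)"
      by (rule mult[OF lattice_aut_shear quasi_inv_scalar shear_triv[OF \<open>i \<ge> t\<close>]]) blast
  next
    fix i j assume ij: "i < t" "j < t" "i \<noteq> j"
    show "quasi_inv (exchange i j) 0 (- 1) (scalar c * F) (scalar c * F)"
      by (rule mult[OF lattice_aut_exchange quasi_inv_scalar exchange_inv[OF ij]]) blast
  qed
qed

lemma coe_scalar_mult:
  "coe (scalar c * F) (int m, k) = (\<Sum>i\<le>m. c $ i * coe F (int (m - i), k))"
proof -
  have "Poly_Mapping.lookup (Poly_Mapping.single 0 a * f) k = a * Poly_Mapping.lookup f k" for a and f :: lp
    by (cases "a = 0") (auto simp: lookup_mult_diff)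
  then show ?thesis
    by (auto simp: coe_def fps_mult_nth scalar_def lookup_sum atLeast0AtMost nat_diff_distrib intro!: sum.cong)
qed

text \<open>As G has the row 1 at \<open>base\<close>, the row of F there is the only candidate for
  c. The difference \<open>F - scalar c * G\<close> keeps the symmetries and has no coefficients
  left at \<open>base\<close>.\<close>

lemma weyl_inv_unique:
  assumes F: "weyl_inv t F" and G: "weyl_inv t G"
    and base: "\<And>m. coe G (int m, weyl_inv.base t) = (if m = 0 then 1 else 0)"
  obtains c where "F = scalar c * G"
proof -
  define c where "c = Abs_fps (\<lambda>n. coe F (int n, weyl_inv.base t))"
  interpret D: weyl_inv t "F - scalar c * G"
    using F G by (intro weyl_inv_diff weyl_inv_scalar_mult)
  interpret F: weyl_inv t F by (rule F)
  have "coe (F - scalar c * G) (m, D.base) = 0" for m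
  proof (cases "m < 0")
    case False
    then obtain n where m: "m = int n" by (metis not_less nonneg_int_cases)
    have "coe (scalar c * G) (int n, D.base) = (\<Sum>i\<le>n. if i = n then c $ i else 0)"
      unfolding coe_scalar_mult base by (rule sum.cong) auto
    then show ?thesis by (simp add: coe_diff m c_def)
  qed (simp add: coe_def)
  then have "F - scalar c * G = 0" by (intro D.vanish_all) (simp add: D.vanish_def)
  then show ?thesis using that by simp
qed

section \<open>The theta product and the theta determinant\<close>

definition altsign :: "int \<Rightarrow> int" where "altsign n = (if even n then 1 else - 1)"

text \<open>With z the monomial of exponent u, this is the sum of (-1)^n q^(r n (n-1)/2) z^n, by the
  triple product equal to (1 - z) (q^r z; q^r) (q^r / z; q^r) (q^r; q^r).\<close>

definition thetav :: "nat \<Rightarrow> (nat \<Rightarrow> int) \<Rightarrow> lp fps" where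
  "thetav r u = lsum UNIV (theta_wt r 0) (\<lambda>n j. n * u j) altsign"

definition monov :: "(nat \<Rightarrow> int) \<Rightarrow> lp fps" where
  "monov u = lsum {()} (\<lambda>_. 0) (\<lambda>_. u) (\<lambda>_. 1)"

lemma quasi_inv_monov:
  assumes "lattice_aut L" "(0, u) = L (0, u') + b"
  shows "quasi_inv L b 1 (monov u) (monov u')"
  unfolding monov_def
  by (rule quasi_inv_lsum[OF assms(1), of _ _ _ _ "\<lambda>x. x"]) (use assms(2) in \<open>auto simp: fin_fibres_def\<close>)

text \<open>The terms are relabelled by \<open>n \<mapsto> s * n + d\<close>: translations give
  quasi-periodicity, and s = - 1 gives the behaviour under inversion of the argument.\<close>

lemma quasi_inv_thetav:
  assumes L: "lattice_aut L" and "r > 0" and s: "s = 1 \<or> s = (- 1 :: int)"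
    and eq: "\<And>n. (int r * tri (s * n + d), \<lambda>j. (s * n + d) * u j) = L (int r * tri n, \<lambda>j. n * u' j) + b"
  shows "quasi_inv L b (altsign d) (thetav r u) (thetav r u')"
  unfolding thetav_def
proof (rule quasi_inv_lsum[OF L])
  show "fin_fibres UNIV (theta_wt r 0)" "fin_fibres UNIV (theta_wt r 0)"
    using assms(2) by (auto intro: fin_fibres_theta)
  show "bij_betw (\<lambda>n. s * n + d) UNIV UNIV"
    by (rule bij_betwI[of _ _ _ "\<lambda>m. s * (m - d)"]) (use s in \<open>auto simp: algebra_simps\<close>)
  show "(int (theta_wt r 0 (s * n + d)), \<lambda>j. (s * n + d) * u j) =
      L (int (theta_wt r 0 n), \<lambda>j. n * u' j) + b" for n
    using eq[of n] assms(2) by (simp add: int_theta_wt(1))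
  show "altsign (s * n + d) = altsign d * altsign n" for n
    using s by (auto simp: altsign_def)
qed

lemma tri_shift: "tri (n + 2) = tri n + 2 * n + 1" "tri (n - 1) = tri n - n + 1" "tri (1 - n) = tri n"
  using two_tri[of n] two_tri[of "n + 2"] two_tri[of "n - 1"] two_tri[of "1 - n"]
  by (simp_all add: algebra_simps)

lemma altsign_simps [simp]: "altsign 0 = 1" "altsign 1 = - 1" "altsign 2 = 1" "altsign (- 1) = - 1"
  by (simp_all add: altsign_def)

text \<open>In base q a shear moves the terms by two places, hence without sign; in base q^2 it
  moves them by one place, hence the sign - 1. The last two cases are the two exponents with which
  x_l can enter.\<close>

lemma thetav_shear:
  "r > 0 \<Longrightarrow> u l = 0 \<Longrightarrow> quasi_inv (shear l) 0 1 (thetav r u) (thetav r u)"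
  "quasi_inv (shear i) (1, \<lambda>x. 2 * unitv i x) 1 (thetav 1 (unitv i)) (thetav 1 (unitv i))"
  "u l = 1 \<Longrightarrow> quasi_inv (shear l) (0, u) (- 1) (thetav 2 u) (thetav 2 u)"
  "u l = - 1 \<Longrightarrow> quasi_inv (shear l) (2, - u) (- 1) (thetav 2 u) (thetav 2 u)"
proof -
  show "quasi_inv (shear l) 0 1 (thetav r u) (thetav r u)" if "r > 0" "u l = 0"
    using quasi_inv_thetav[OF lattice_aut_shear, of r 1 0 u l u 0] that
    by (simp add: shear_def zero_prod_def zero_fun_def)
  show "quasi_inv (shear i) (1, \<lambda>x. 2 * unitv i x) 1 (thetav 1 (unitv i)) (thetav 1 (unitv i))"
    using quasi_inv_thetav[OF lattice_aut_shear, of 1 1 2 "unitv i" i "unitv i" "(1, \<lambda>x. 2 * unitv i x)"]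
    by (simp add: shear_def tri_shift unitv_def fun_eq_iff algebra_simps)
  show "quasi_inv (shear l) (0, u) (- 1) (thetav 2 u) (thetav 2 u)" if "u l = 1"
    using quasi_inv_thetav[OF lattice_aut_shear, of 2 1 1 u l u "(0, u)"] that
    by (simp add: shear_def tri_add_1 fun_eq_iff algebra_simps)
  show "quasi_inv (shear l) (2, - u) (- 1) (thetav 2 u) (thetav 2 u)" if "u l = - 1"
    using quasi_inv_thetav[OF lattice_aut_shear, of 2 1 "- 1" u l u "(2, - u)"] that
    by (simp add: shear_def tri_shift fun_eq_iff algebra_simps)
qed

lemma thetav_same:
  assumes "lattice_aut L" "r > 0" "\<And>m n. L (m, \<lambda>j. n * u' j) = (m, \<lambda>j. n * u j)"
  shows "quasi_inv L 0 1 (thetav r u) (thetav r u')"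
  using quasi_inv_thetav[OF assms(1), of r 1 0 u u' 0] assms(2,3) by simp

lemma thetav_opposite:
  assumes "lattice_aut L" "r > 0" "\<And>m n. L (m, \<lambda>j. n * u' j) = (m, \<lambda>j. - n * u j)"
  shows "quasi_inv L (0, u) (- 1) (thetav r u) (thetav r u')"
  using quasi_inv_thetav[OF assms(1), of r "- 1" 1 u u' "(0, u)"] assms(2,3)
  using tri_shift(3) by (simp add: fun_eq_iff algebra_simps)

text \<open>The theta function with the zeros of \<open>(1 - x\<^sub>i x\<^sub>j) (1 - x\<^sub>i / x\<^sub>j) / x\<^sub>i\<close>.\<close>

definition psi :: "nat \<Rightarrow> nat \<Rightarrow> lp fps" where
  "psi i j = monov (- unitv i) * thetav 2 (unitv i + unitv j) * thetav 2 (unitv i - unitv j)"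

text \<open>Inverting one variable interchanges the theta functions of x_i x_j and x_i / x_j, up to
  inversion of their arguments; hence the two alternatives for u and u'.\<close>

lemma quasi_inv_psi:
  assumes "lattice_aut L"
    "quasi_inv L b1 1 (monov (- unitv i)) (monov (- unitv i'))"
    "quasi_inv L b2 e2 (thetav 2 (unitv i + unitv j)) (thetav 2 u)"
    "quasi_inv L b3 e3 (thetav 2 (unitv i - unitv j)) (thetav 2 u')"
    "b1 + b2 + b3 = b" "e2 * e3 = e"
    "u = unitv i' + unitv j' \<and> u' = unitv i' - unitv j' \<or> u' = unitv i' + unitv j' \<and> u = unitv i' - unitv j'"
  shows "quasi_inv L b e (psi i j) (psi i' j')"
proof -
  have "quasi_inv L b e (psi i j) (monov (- unitv i') * thetav 2 u * thetav 2 u')"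
    using quasi_inv_mult[OF assms(1) quasi_inv_mult[OF assms(1,2,3)] assms(4)] assms(5,6)
    by (simp add: psi_def)
  moreover have "monov (- unitv i') * thetav 2 u * thetav 2 u' = psi i' j'"
    using assms(7) by (auto simp: psi_def mult_ac)
  ultimately show ?thesis by simp
qed

text \<open>The prefactor 1 / x_i makes up for the asymmetry between i and j: a shear in either
  variable produces the shift of the same shape.\<close>

lemma psi_shear:
  assumes "i \<noteq> j"
  shows "quasi_inv (shear l) (if l = i \<or> l = j then (2, \<lambda>x. 2 * unitv l x) else 0) 1 (psi i j) (psi i j)"
proof -
  note A = lattice_aut_shear[of l]
  have m: "quasi_inv (shear l) (if l = i then 2 else 0, 0) 1 (monov (- unitv i)) (monov (- unitv i))"
    by (rule quasi_inv_monov[OF A]) (auto simp: shear_def unitv_def)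
  consider "l = i" | "l = j" | "l \<noteq> i" "l \<noteq> j" by blast
  then show ?thesis
  proof cases
    case 1
    with assms show ?thesis
      by (intro quasi_inv_psi[OF A m thetav_shear(3) thetav_shear(3)])
         (auto simp: unitv_def fun_eq_iff)
  next
    case 2
    with assms show ?thesis
      by (intro quasi_inv_psi[OF A m thetav_shear(3) thetav_shear(4)])
         (auto simp: unitv_def fun_eq_iff)
  next
    case 3
    with assms show ?thesis
      by (intro quasi_inv_psi[OF A m thetav_shear(1) thetav_shear(1)])
         (auto simp: unitv_def fun_eq_iff zero_prod_def)
  qed
qed

lemma psi_negate:
  assumes "i \<noteq> j"
  shows "quasi_inv (negate l) 0 1 (psi i j) (psi i j)"
proof -
  note A = lattice_aut_negate[of l]
  have m: "quasi_inv (negate l) (0, if l = i then (\<lambda>x. - 2 * unitv i x) else 0) 1 (monov (- unitv i)) (monov (- unitv i))"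
    by (rule quasi_inv_monov[OF A]) (auto simp: negate_def unitv_def fun_eq_iff)
  consider "l = i" | "l = j" | "l \<noteq> i" "l \<noteq> j" by blast
  then show ?thesis
  proof cases
    case 1
    with assms show ?thesis
      by (intro quasi_inv_psi[OF A m thetav_opposite[OF A, of _ "unitv i - unitv j"]
            thetav_opposite[OF A, of _ "unitv i + unitv j"]])
         (auto simp: unitv_def negate_def fun_eq_iff zero_prod_def)
  next
    case 2
    with assms show ?thesis
      by (intro quasi_inv_psi[OF A m thetav_same[OF A, of _ "unitv i - unitv j"]
            thetav_same[OF A, of _ "unitv i + unitv j"]])
         (auto simp: unitv_def negate_def fun_eq_iff zero_prod_def)
  next
    case 3
    with assms show ?thesis
      by (intro quasi_inv_psi[OF A m thetav_same[OF A, of _ "unitv i + unitv j"]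
            thetav_same[OF A, of _ "unitv i - unitv j"]])
         (auto simp: unitv_def negate_def fun_eq_iff zero_prod_def)
  qed
qed

lemma unitv_transpose: "unitv i (Transposition.transpose a b x) = unitv (Transposition.transpose a b i) x"
  by (auto simp: unitv_def Transposition.transpose_def)

lemma psi_exchange:
  "quasi_inv (exchange a b) 0 1 (psi (Transposition.transpose a b i) (Transposition.transpose a b j)) (psi i j)"
proof -
  note A = lattice_aut_exchange[of a b]
  have m: "quasi_inv (exchange a b) 0 1 (monov (- unitv (Transposition.transpose a b i))) (monov (- unitv i))"
    by (rule quasi_inv_monov[OF A]) (auto simp: exchange_def unitv_transpose fun_eq_iff)
  show ?thesis
    by (intro quasi_inv_psi[OF A m thetav_same[OF A, of _ "unitv i + unitv j"]
            thetav_same[OF A, of _ "unitv i - unitv j"]])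
       (auto simp: exchange_def unitv_transpose fun_eq_iff)
qed

text \<open>The theta function of x_j / x_i is that of x_i / x_j times - x_j / x_i, and this
  monomial turns the prefactor 1 / x_j into 1 / x_i.\<close>

lemma psi_antisym: "psi j i = - psi i j"
proof -
  note A = lattice_aut_id
  have m: "quasi_inv (\<lambda>v. v) (0, unitv i - unitv j) 1 (monov (- unitv j)) (monov (- unitv i))"
    by (rule quasi_inv_monov[OF A]) (auto simp: fun_eq_iff)
  have "quasi_inv (\<lambda>v. v) 0 (- 1) (psi j i) (psi i j)"
    by (intro quasi_inv_psi[OF A m thetav_same[OF A, of _ "unitv i + unitv j"]
            thetav_opposite[OF A, of _ "unitv i - unitv j"]])
       (auto simp: fun_eq_iff zero_prod_def algebra_simps)
  then have "coe (psi j i) v = coe (- psi i j) v" for v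
    unfolding quasi_inv_def using spec[of _ v] by (simp add: coe_uminus)
  then show ?thesis by (rule coe_eqI)
qed

section \<open>Products over pairs of indices and the theta product\<close>

definition pairs :: "nat \<Rightarrow> (nat \<times> nat) set" where "pairs t = {(i, j). i < j \<and> j < t}"

lemma finite_pairs [simp]: "finite (pairs t)"
  by (rule finite_subset[of _ "{..<t} \<times> {..<t}"]) (auto simp: pairs_def)

context comm_monoid_set
begin

text \<open>Stated for an abstract commutative monoid because it serves for a product of series and
  for a sum of hook counts.\<close>

lemma square_split:
  fixes G :: "nat \<Rightarrow> nat \<Rightarrow> 'a"
  shows "F (\<lambda>i. F (G i) {..<t}) {..<t} = F (\<lambda>(i, j). G i j \<^bold>* G j i) (pairs t) \<^bold>* F (\<lambda>i. G i i) {..<t}"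
proof -
  let ?sw = "\<lambda>(i, j). (j, i) :: nat \<times> nat" and ?d = "(\<lambda>i. (i, i)) ` {..<t}"
  let ?G = "\<lambda>(i, j). G i j"
  have "F (\<lambda>i. F (G i) {..<t}) {..<t} = F ?G ({..<t} \<times> {..<t})"
    by (rule cartesian_product)
  also have "{..<t} \<times> {..<t} = (pairs t \<union> ?sw ` pairs t) \<union> ?d"
    by (auto simp: pairs_def image_iff)
  also have "F ?G \<dots> = F ?G (pairs t \<union> ?sw ` pairs t) \<^bold>* F ?G ?d"
    by (intro union_disjoint finite_pairs finite_imageI finite_UnI) (auto simp: pairs_def)
  also have "F ?G (pairs t \<union> ?sw ` pairs t) = F ?G (pairs t) \<^bold>* F ?G (?sw ` pairs t)"
    by (intro union_disjoint finite_pairs finite_imageI) (auto simp: pairs_def)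
  also have "F ?G (?sw ` pairs t) = F (\<lambda>(i, j). G j i) (pairs t)"
    by (subst reindex) (auto simp: inj_on_def intro!: cong)
  also have "F ?G ?d = F (\<lambda>i. G i i) {..<t}"
    by (subst reindex) (auto simp: inj_on_def intro!: cong)
  finally show ?thesis by (simp add: distrib case_prod_unfold)
qed

end

lemma card_pairs_containing:
  assumes "i < t" shows "card {p \<in> pairs t. i = fst p \<or> i = snd p} = t - 1"
proof -
  let ?f = "\<lambda>j. if j < i then (j, i) else (i, j)"
  have "bij_betw ?f ({..<t} - {i}) {p \<in> pairs t. i = fst p \<or> i = snd p}"
    by (rule bij_betwI[of _ _ _ "\<lambda>p. if fst p = i then snd p else fst p"])
       (use assms in \<open>auto simp: pairs_def split: if_splits\<close>)
  from bij_betw_same_card[OF this] show ?thesis using assms by simp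
qed

text \<open>Putting each transposed pair back into increasing order costs a sign for every
  inversion, and a transposition has an odd number of inversions.\<close>

lemma prod_pairs_transpose:
  fixes f :: "nat \<Rightarrow> nat \<Rightarrow> 'a::comm_ring_1"
  assumes anti: "\<And>i j. i \<noteq> j \<Longrightarrow> f j i = - f i j" and ab: "a < t" "b < t" "a \<noteq> b"
  shows "(\<Prod>(i, j)\<in>pairs t. f (Transposition.transpose a b i) (Transposition.transpose a b j)) =
    - (\<Prod>(i, j)\<in>pairs t. f i j)"
proof -
  have *: "(\<Prod>(i, j)\<in>pairs t. f (Transposition.transpose a b i) (Transposition.transpose a b j)) =
    - (\<Prod>(i, j)\<in>pairs t. f i j)" if lt: "a < b" and b: "b < t" for a b
  proof -
    let ?s = "Transposition.transpose a b"
    let ?so = "\<lambda>(i, j). (min (?s i) (?s j), max (?s i) (?s j))"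
    let ?I = "{(i, j) \<in> pairs t. ?s j < ?s i}"
    have inj: "?s i = ?s j \<longleftrightarrow> i = j" for i j by (metis transpose_involutory)
    have lts: "?s i < t" if "i < t" for i using that lt b by (auto simp: Transposition.transpose_def)
    have "bij_betw ?so (pairs t) (pairs t)"
    proof (rule bij_betwI[of _ _ _ ?so])
      show "?so \<in> pairs t \<rightarrow> pairs t"
      proof
        fix p assume "p \<in> pairs t"
        moreover obtain i j where p: "p = (i, j)" by force
        ultimately have "?s i \<noteq> ?s j" "?s i < t" "?s j < t" using inj lts by (auto simp: pairs_def)
        then show "?so p \<in> pairs t" by (auto simp: p pairs_def min_def max_def)
      qed
      then show "?so \<in> pairs t \<rightarrow> pairs t" .
    qed (auto simp: pairs_def min_def max_def)
    then have "(\<Prod>(i, j)\<in>pairs t. f i j) = (\<Prod>p\<in>pairs t. case ?so p of (i, j) \<Rightarrow> f i j)"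
      by (rule prod.reindex_bij_betw[symmetric])
    also have "\<dots> = (\<Prod>p\<in>pairs t. (if p \<in> ?I then - 1 else 1) * (case p of (i, j) \<Rightarrow> f (?s i) (?s j)))"
    proof (rule prod.cong[OF refl])
      fix p assume "p \<in> pairs t"
      moreover obtain i j where p: "p = (i, j)" by force
      ultimately have ij: "?s i \<noteq> ?s j" and "(i, j) \<in> pairs t" by (auto simp: pairs_def inj)
      then show "(case ?so p of (i, j) \<Rightarrow> f i j) =
          (if p \<in> ?I then - 1 else 1) * (case p of (i, j) \<Rightarrow> f (?s i) (?s j))"
        using anti[OF ij] by (auto simp: p min_def max_def)
    qed
    also have "\<dots> = (\<Prod>p\<in>pairs t. if p \<in> ?I then - 1 else 1) * (\<Prod>(i, j)\<in>pairs t. f (?s i) (?s j))"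
      by (rule prod.distrib)
    also have "(\<Prod>p\<in>pairs t. if p \<in> ?I then - 1 else 1 :: 'a) = (\<Prod>p\<in>{p \<in> pairs t. p \<in> ?I}. - 1)"
      by (rule prod.inter_filter[symmetric]) simp
    also have "{p \<in> pairs t. p \<in> ?I} = ?I" by auto
    also have "(\<Prod>p\<in>?I. - 1 :: 'a) = (- 1) ^ card ?I" by (rule prod_constant)
    \<comment> \<open>The inversions of the transposition of a < b: a with everything in {a<..b},
      and everything strictly between with b, together 2 (b - a) - 1.\<close>
    also have "?I = (\<lambda>c. (a, c)) ` {a<..b} \<union> (\<lambda>c. (c, b)) ` {a<..<b}"
      using lt b by (auto simp: pairs_def Transposition.transpose_def split: if_splits)
    also have "card \<dots> = (b - a) + (b - a - 1)"
      by (subst card_Un_disjoint) (auto simp: card_image inj_on_def)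
    also have "(- 1 :: 'a) ^ \<dots> = - 1" using lt by (simp add: minus_one_power_iff)
    finally show ?thesis by simp
  qed
  show ?thesis
    using *[of a b] *[of b a] ab by (cases "a < b") (auto simp: transpose_commute[of a b])
qed

definition theta_prod :: "nat \<Rightarrow> lp fps" where
  "theta_prod t = (\<Prod>i<t. thetav 1 (unitv i)) * (\<Prod>(i, j)\<in>pairs t. psi i j)"

lemma sum_const_pair:
  "(\<Sum>x\<in>S. (c, \<lambda>j. d j)) = (int (card S) * c, \<lambda>j. int (card S) * d j)" if "finite S" for c :: int and d :: "nat \<Rightarrow> int"
  using that by (induction S rule: finite_induct) (auto simp: zero_prod_def fun_eq_iff algebra_simps)

lemma quasi_inv_theta_prod:
  assumes L: "lattice_aut L"
    and "\<And>i. i < t \<Longrightarrow> quasi_inv L (b i) (e i) (thetav 1 (unitv (s i))) (thetav 1 (unitv i))"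
    and "\<And>i j. (i, j) \<in> pairs t \<Longrightarrow> quasi_inv L (c (i, j)) 1 (psi (s i) (s j)) (psi i j)"
    and "(\<Sum>i<t. b i) + (\<Sum>p\<in>pairs t. c p) = b'" "(\<Prod>i<t. e i) = e'"
  shows "quasi_inv L b' e' ((\<Prod>i<t. thetav 1 (unitv (s i))) * (\<Prod>(i, j)\<in>pairs t. psi (s i) (s j))) (theta_prod t)"
proof -
  have "quasi_inv L (\<Sum>p\<in>pairs t. c p) (\<Prod>p\<in>pairs t. 1) (\<Prod>(i, j)\<in>pairs t. psi (s i) (s j)) (\<Prod>(i, j)\<in>pairs t. psi i j)"
    by (rule quasi_inv_prod[OF L]) (use assms(3) in \<open>auto simp: case_prod_unfold\<close>)
  moreover have "quasi_inv L (\<Sum>i<t. b i) (\<Prod>i<t. e i) (\<Prod>i<t. thetav 1 (unitv (s i))) (\<Prod>i<t. thetav 1 (unitv i))"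
    by (rule quasi_inv_prod[OF L]) (use assms(2) in auto)
  ultimately show ?thesis
    using quasi_inv_mult[OF L, of "\<Sum>i<t. b i" "\<Prod>i<t. e i" _ _ "\<Sum>p\<in>pairs t. c p" "\<Prod>p\<in>pairs t. 1"]
    unfolding theta_prod_def assms(4)[symmetric] assms(5)[symmetric] by simp
qed

text \<open>The constants of \<open>weyl_inv\<close> arise by counting. With e_i the unit vector,
  the theta function of x_i alone contributes (1, 2 e_i) to the shear and each of the t - 1 pairs
  containing i contributes (2, 2 e_i). Inversion changes the sign of the factor of x_i only; a swap
  changes the sign through the pairs only.\<close>

lemma weyl_inv_theta_prod: "weyl_inv t (theta_prod t)"
proof
  fix i assume i: "i < t"
  let ?c = "(2, \<lambda>x. 2 * unitv i x) :: int \<times> (nat \<Rightarrow> int)"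
  let ?d = "(1, \<lambda>x. 2 * unitv i x) :: int \<times> (nat \<Rightarrow> int)"
  have 1: "(\<Sum>l<t. if l = i then ?d else 0) = ?d" using i by simp
  have "(\<Sum>p\<in>pairs t. if i = fst p \<or> i = snd p then ?c else 0) =
     (\<Sum>p\<in>{p \<in> pairs t. i = fst p \<or> i = snd p}. ?c)" by (rule sum.inter_filter[symmetric]) simp
  also have "\<dots> = (int (t - 1) * 2, \<lambda>x. int (t - 1) * (2 * unitv i x))"
    using card_pairs_containing[OF i] by (subst sum_const_pair) auto
  finally have 2: "(\<Sum>p\<in>pairs t. if i = fst p \<or> i = snd p then ?c else 0) = \<dots>" .
  have "quasi_inv (shear i) (int (2 * t) - 1, \<lambda>j. int (2 * t) * unitv i j) 1
     ((\<Prod>i<t. thetav 1 (unitv ((\<lambda>x. x) i))) * (\<Prod>(i, j)\<in>pairs t. psi ((\<lambda>x. x) i) ((\<lambda>x. x) j))) (theta_prod t)"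
  proof (rule quasi_inv_theta_prod[OF lattice_aut_shear,
      where b = "\<lambda>l. if l = i then ?d else 0" and e = "\<lambda>_. 1" and c = "\<lambda>p. if i = fst p \<or> i = snd p then ?c else 0"])
    fix l show "quasi_inv (shear i) (if l = i then ?d else 0) 1 (thetav 1 (unitv l)) (thetav 1 (unitv l))"
      using thetav_shear(2)[of i] thetav_shear(1)[of 1 "unitv l" i] by (simp add: unitv_def)
  next
    fix l j assume "(l, j) \<in> pairs t"
    then show "quasi_inv (shear i) (if i = fst (l, j) \<or> i = snd (l, j) then ?c else 0) 1 (psi l j) (psi l j)"
      using psi_shear[of l j i] by (simp add: pairs_def)
  next
    show "(\<Sum>l<t. if l = i then ?d else 0) + (\<Sum>p\<in>pairs t. if i = fst p \<or> i = snd p then ?c else 0) =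
        (int (2 * t) - 1, \<lambda>j. int (2 * t) * unitv i j)"
      unfolding 1 2 using i by (auto simp: fun_eq_iff of_nat_diff algebra_simps)
  qed simp
  then show "quasi_inv (shear i) (int (2 * t) - 1, \<lambda>j. int (2 * t) * unitv i j) 1 (theta_prod t) (theta_prod t)"
    by (simp only: theta_prod_def)
  have "quasi_inv (negate i) (0, unitv i) (- 1)
     ((\<Prod>i<t. thetav 1 (unitv ((\<lambda>x. x) i))) * (\<Prod>(i, j)\<in>pairs t. psi ((\<lambda>x. x) i) ((\<lambda>x. x) j))) (theta_prod t)"
  proof (rule quasi_inv_theta_prod[OF lattice_aut_negate,
      where b = "\<lambda>l. if l = i then (0, unitv i) else 0" and e = "\<lambda>l. if l = i then - 1 else 1" and c = "\<lambda>_. 0"])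
    fix l show "quasi_inv (negate i) (if l = i then (0, unitv i) else 0) (if l = i then - 1 else 1)
        (thetav 1 (unitv l)) (thetav 1 (unitv l))"
      using thetav_opposite[OF lattice_aut_negate, of 1 i "unitv l" "unitv l"]
        thetav_same[OF lattice_aut_negate, of 1 i "unitv l" "unitv l"]
      by (auto simp: negate_def unitv_def fun_eq_iff)
  next
    fix l j assume "(l, j) \<in> pairs t"
    then show "quasi_inv (negate i) 0 1 (psi l j) (psi l j)"
      using psi_negate[of l j i] by (simp add: pairs_def)
  qed (use i in auto)
  then show "quasi_inv (negate i) (0, unitv i) (- 1) (theta_prod t) (theta_prod t)"
    by (simp only: theta_prod_def)
next
  fix i assume i: "i \<ge> t"
  have "quasi_inv (shear i) 0 1
     ((\<Prod>i<t. thetav 1 (unitv ((\<lambda>x. x) i))) * (\<Prod>(i, j)\<in>pairs t. psi ((\<lambda>x. x) i) ((\<lambda>x. x) j))) (theta_prod t)"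
  proof (rule quasi_inv_theta_prod[OF lattice_aut_shear, where b = "\<lambda>_. 0" and e = "\<lambda>_. 1" and c = "\<lambda>_. 0"])
    fix l assume "l < t"
    then show "quasi_inv (shear i) 0 1 (thetav 1 (unitv l)) (thetav 1 (unitv l))"
      using i by (intro thetav_shear(1)) (auto simp: unitv_def)
  next
    fix l j assume "(l, j) \<in> pairs t"
    then show "quasi_inv (shear i) 0 1 (psi l j) (psi l j)"
      using psi_shear[of l j i] i by (simp add: pairs_def split: if_splits)
  qed auto
  then show "quasi_inv (shear i) 0 1 (theta_prod t) (theta_prod t)"
    by (simp add: theta_prod_def)
next
  fix a b assume ab: "a < t" "b < t" "a \<noteq> b"
  let ?s = "Transposition.transpose a b"
  have "quasi_inv (exchange a b) 0 1
     ((\<Prod>i<t. thetav 1 (unitv (?s i))) * (\<Prod>(i, j)\<in>pairs t. psi (?s i) (?s j))) (theta_prod t)"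
  proof (rule quasi_inv_theta_prod[OF lattice_aut_exchange, where b = "\<lambda>_. 0" and e = "\<lambda>_. 1" and c = "\<lambda>_. 0"])
    fix i show "quasi_inv (exchange a b) 0 1 (thetav 1 (unitv (?s i))) (thetav 1 (unitv i))"
      by (rule thetav_same[OF lattice_aut_exchange]) (auto simp: exchange_def unitv_transpose fun_eq_iff)
  qed (auto intro: psi_exchange)
  moreover have "(\<Prod>i<t. thetav 1 (unitv (?s i))) = (\<Prod>i<t. thetav 1 (unitv i))"
  proof -
    have "?s permutes {..<t}" using ab by (intro permutes_swap_id) auto
    from prod.permute[OF this, of "\<lambda>i. thetav 1 (unitv i)"] show ?thesis by (simp add: o_def)
  qed
  moreover have "(\<Prod>(i, j)\<in>pairs t. psi (?s i) (?s j)) = - (\<Prod>(i, j)\<in>pairs t. psi i j)"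
    by (rule prod_pairs_transpose[OF psi_antisym ab])
  ultimately have "quasi_inv (exchange a b) 0 1 (- theta_prod t) (theta_prod t)"
    by (simp add: theta_prod_def)
  then show "quasi_inv (exchange a b) 0 (- 1) (theta_prod t) (theta_prod t)"
    by (simp add: quasi_inv_def coe_uminus minus_equation_iff)
qed

section \<open>The one-variable theta series and their determinant\<close>

abbreviation phi_exp :: "nat \<Rightarrow> nat \<Rightarrow> int \<Rightarrow> nat" where
  "phi_exp t r \<equiv> theta_wt (4 * t) (2 * t + 2 * r - 1)"

text \<open>The orbit of the monomial x_i^r under the symmetries in one variable: the exponents 2 t
  n + r, and their reflections with sign - 1. From n to n + 1 the shear adds 2 (2 t n + r) + 2 t - 1
  to the power of q, which sums up to 2 t n^2 + (2 r - 1) n. \<open>phi_exp\<close> writes this in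
  the form to which the triple product applies.\<close>

definition phi :: "nat \<Rightarrow> nat \<Rightarrow> nat \<Rightarrow> lp fps" where
  "phi t r i = lsum UNIV (\<lambda>(n, s). phi_exp t r n)
     (\<lambda>(n, s) x. (if s then 2 * int t * n + int r else 1 - (2 * int t * n + int r)) * unitv i x)
     (\<lambda>(n, s). if s then 1 else - 1)"

lemma fin_fibres_phi:
  assumes "1 \<le> r" "r \<le> t"
  shows "fin_fibres (UNIV :: (int \<times> bool) set) (\<lambda>(n, s). phi_exp t r n)"
  unfolding fin_fibres_def
proof
  fix N
  have "finite {n \<in> UNIV. phi_exp t r n = N}"
    using fin_fibres_theta[of "2 * t + 2 * r - 1" "4 * t"] assms by (auto simp: fin_fibres_def)
  then have "finite ({n \<in> UNIV. phi_exp t r n = N} \<times> (UNIV :: bool set))" by simp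
  then show "finite {x \<in> UNIV. (case x of (n, s :: bool) \<Rightarrow> phi_exp t r n) = N}"
    by (rule rev_finite_subset) auto
qed

lemma int_theta_wt_phi:
  assumes "1 \<le> r" "r \<le> t"
  shows "int (phi_exp t r n) = 2 * int t * n * n + (2 * int r - 1) * n"
proof -
  have "int (phi_exp t r n) = int (4 * t) * tri n + int (2 * t + 2 * r - 1) * n"
    using assms by (intro int_theta_wt) auto
  also have "\<dots> = 2 * int t * (2 * tri n) + (2 * int t + 2 * int r - 1) * n"
    using assms by (simp add: of_nat_diff)
  also have "\<dots> = 2 * int t * n * n + (2 * int r - 1) * n"
    unfolding two_tri by (simp add: algebra_simps)
  finally show ?thesis .
qed

lemma quasi_inv_phi:
  assumes "lattice_aut L" and r: "1 \<le> r" "r \<le> t" and bij: "bij h"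
    and e: "\<And>x. snd (h x) = (snd x \<longleftrightarrow> e = 1)" "e = 1 \<or> e = - 1"
    and eq: "\<And>n s. (case h (n, s) of (n', s') \<Rightarrow>
        (2 * int t * n' * n' + (2 * int r - 1) * n',
         \<lambda>x. (if s' then 2 * int t * n' + int r else 1 - (2 * int t * n' + int r)) * unitv i x)) =
       L (2 * int t * n * n + (2 * int r - 1) * n,
         \<lambda>x. (if s then 2 * int t * n + int r else 1 - (2 * int t * n + int r)) * unitv i' x) + b"
  shows "quasi_inv L b e (phi t r i) (phi t r i')"
  unfolding phi_def
proof (rule quasi_inv_lsum[OF assms(1) fin_fibres_phi[OF r] fin_fibres_phi[OF r] bij])
  fix x :: "int \<times> bool"
  obtain n s where x: "x = (n, s)" by force
  show "(int (case h x of (n, s) \<Rightarrow> phi_exp t r n),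
      (case h x of (n, s) \<Rightarrow> \<lambda>x. (if s then 2 * int t * n + int r else 1 - (2 * int t * n + int r)) * unitv i x)) =
     L (int (case x of (n, s) \<Rightarrow> phi_exp t r n),
      (case x of (n, s) \<Rightarrow> \<lambda>x. (if s then 2 * int t * n + int r else 1 - (2 * int t * n + int r)) * unitv i' x)) + b"
  proof -
    obtain n' s' where h: "h (n, s) = (n', s')" by force
    show ?thesis using eq[of n s] by (simp only: x h prod.case int_theta_wt_phi[OF r])
  qed
  show "(case h x of (n, s) \<Rightarrow> if s then 1 else - 1) = e * (case x of (n, s) \<Rightarrow> if s then 1 else - 1)"
    using e(1)[of x] e(2) by (auto simp: x case_prod_unfold)
qed

lemma phi_shear:
  assumes r: "1 \<le> r" "r \<le> t"
  shows "quasi_inv (shear l) (if l = i then (int (2 * t) - 1, \<lambda>j. int (2 * t) * unitv i j) else 0) 1 (phi t r i) (phi t r i)"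
proof (cases "l = i")
  case True
  \<comment> \<open>On the reflected branch the exponent is 1 - (2 t n + r), so raising it by 2 t
    lowers n.\<close>
  have "bij (\<lambda>(n :: int, s). (if s then n + 1 else n - 1, s))"
    by (rule bij_betwI[of _ _ _ "\<lambda>(n, s). (if s then n - 1 else n + 1, s)"]) auto
  then show ?thesis
    by (rule quasi_inv_phi[OF lattice_aut_shear r])
       (auto simp: shear_def unitv_def fun_eq_iff True algebra_simps)
next
  case False
  show ?thesis
    by (rule quasi_inv_phi[OF lattice_aut_shear r bij_id[unfolded id_def]])
       (use False in \<open>auto simp: shear_def unitv_def fun_eq_iff\<close>)
qed

lemma phi_negate:
  assumes r: "1 \<le> r" "r \<le> t"
  shows "quasi_inv (negate l) (if l = i then (0, unitv i) else 0) (if l = i then - 1 else 1) (phi t r i) (phi t r i)"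
proof (cases "l = i")
  case True
  have "bij (\<lambda>(n :: int, s). (n, \<not> s))"
    by (rule bij_betwI[of _ _ _ "\<lambda>(n, s). (n, \<not> s)"]) auto
  then show ?thesis
    by (rule quasi_inv_phi[OF lattice_aut_negate r])
       (auto simp: negate_def unitv_def fun_eq_iff True algebra_simps)
next
  case False
  show ?thesis
    by (rule quasi_inv_phi[OF lattice_aut_negate r bij_id[unfolded id_def]])
       (use False in \<open>auto simp: negate_def unitv_def fun_eq_iff\<close>)
qed

lemma phi_exchange:
  assumes r: "1 \<le> r" "r \<le> t"
  shows "quasi_inv (exchange a b) 0 1 (phi t r (Transposition.transpose a b i)) (phi t r i)"
  by (rule quasi_inv_phi[OF lattice_aut_exchange r bij_id[unfolded id_def]])
     (auto simp: exchange_def unitv_transpose fun_eq_iff)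

definition phi_det :: "nat \<Rightarrow> lp fps" where
  "phi_det t = Determinant.det (mat t t (\<lambda>(i, j). phi t (t - j) i))"

text \<open>Shear and inversion act on a single row of the determinant, and swapping two variables
  swaps two rows.\<close>

lemma weyl_inv_phi_det: "weyl_inv t (phi_det t)"
proof
  fix i assume i: "i < t"
  let ?d = "(int (2 * t) - 1, \<lambda>j. int (2 * t) * unitv i j)"
  have "quasi_inv (shear i) (\<Sum>l=0..<t. if i = l then (int (2 * t) - 1, \<lambda>j. int (2 * t) * unitv l j) else 0) (\<Prod>l=0..<t. 1) (phi_det t) (phi_det t)"
    unfolding phi_det_def by (intro quasi_inv_det lattice_aut_shear phi_shear) auto
  moreover have "(\<Sum>l=0..<t. if i = l then (int (2 * t) - 1, \<lambda>j. int (2 * t) * unitv l j) else 0) = ?d"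
    using i by (subst sum.delta') auto
  ultimately show "quasi_inv (shear i) ?d 1 (phi_det t) (phi_det t)" by (simp only: prod.neutral_const)
  have "quasi_inv (negate i) (\<Sum>l=0..<t. if i = l then (0::int, unitv l) else 0) (\<Prod>l=0..<t. if i = l then - 1 else 1) (phi_det t) (phi_det t)"
    unfolding phi_det_def by (intro quasi_inv_det lattice_aut_negate phi_negate) auto
  moreover have "(\<Sum>l=0..<t. if i = l then (0::int, unitv l) else 0) = (0, unitv i)"
    "(\<Prod>l=0..<t. if i = l then - 1 else 1) = (- 1 :: int)"
    using i by (simp_all add: sum.delta' prod.delta')
  ultimately show "quasi_inv (negate i) (0, unitv i) (- 1) (phi_det t) (phi_det t)" by (simp only:)
next
  fix i assume i: "i \<ge> t"
  have "quasi_inv (shear i) (\<Sum>l=0..<t. 0) (\<Prod>l=0..<t. 1) (phi_det t) (phi_det t)"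
    unfolding phi_det_def
  proof (intro quasi_inv_det lattice_aut_shear)
    fix l j assume "l < t" "j < t"
    then show "quasi_inv (shear i) 0 1 (phi t (t - j) l) (phi t (t - j) l)"
      using phi_shear[of "t - j" t i l] i by auto
  qed
  then show "quasi_inv (shear i) 0 1 (phi_det t) (phi_det t)" by simp
next
  fix a b assume ab: "a < t" "b < t" "a \<noteq> b"
  let ?s = "Transposition.transpose a b"
  let ?A = "mat t t (\<lambda>(i, j). phi t (t - j) i)"
  have "quasi_inv (exchange a b) (\<Sum>l=0..<t. 0) (\<Prod>l=0..<t. 1)
     (Determinant.det (mat t t (\<lambda>(i, j). phi t (t - j) (?s i)))) (phi_det t)"
    unfolding phi_det_def by (intro quasi_inv_det lattice_aut_exchange phi_exchange) auto
  moreover have "mat t t (\<lambda>(i, j). phi t (t - j) (?s i)) = swaprows a b ?A"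
    using ab by (intro eq_matI) (auto simp: Transposition.transpose_def)
  then have "Determinant.det (mat t t (\<lambda>(i, j). phi t (t - j) (?s i))) = - phi_det t"
    using det_swaprows[OF ab(1,2,3), of ?A] by (simp add: phi_det_def)
  ultimately show "quasi_inv (exchange a b) 0 (- 1) (phi_det t) (phi_det t)"
    by (simp add: quasi_inv_def coe_uminus minus_equation_iff)
qed

lemma prod_single:
  "(\<Prod>i\<in>I. Poly_Mapping.single (k i) (a i)) = Poly_Mapping.single (\<Sum>i\<in>I. k i) (\<Prod>i\<in>I. a i)"
  if "finite I" for k :: "'i \<Rightarrow> 'k::comm_monoid_add" and a :: "'i \<Rightarrow> int"
  using that by (induction I rule: finite_induct) (auto simp: mult_single)

lemma sum_fun_apply: "(\<Sum>i\<in>I. f i) x = (\<Sum>i\<in>I. f i x)"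
  by (induction I rule: infinite_finite_induct) (simp_all add: plus_fun_def zero_fun_def)

text \<open>For 1 \<le> r \<le> t, the exponents 2 t n + r and 1 - (2 t n + r) meet {1..t} only at n
  = 0 on the first branch, because {1..t} is a fundamental domain. So at most one term of the
  product reaches \<open>base\<close>.\<close>

lemma coe_prod_phi_base:
  assumes r: "\<And>i. i < t \<Longrightarrow> 1 \<le> r i \<and> r i \<le> t"
  shows "coe (\<Prod>i=0..<t. phi t (r i) i) (int m, weyl_inv.base t) =
    (if m = 0 \<and> (\<forall>i<t. r i = t - i) then 1 else 0)"
proof -
  interpret B: weyl_inv t "phi_det t" by (rule weyl_inv_phi_det)
  define w where "w i = (\<lambda>(n, s :: bool). phi_exp t (r i) n)" for i
  define c where "c i = (\<lambda>(n, s). if s then 2 * int t * n + int (r i) else 1 - (2 * int t * n + int (r i)))" for i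
  define a where "a = (\<lambda>(n :: int, s). if s then 1 else - 1 :: int)"
  have phi: "phi t (r i) i = fsum UNIV (w i) (\<lambda>x. Poly_Mapping.single (\<lambda>j. c i x * unitv i j) (a x))" for i
    unfolding phi_def lsum_def w_def c_def a_def by (intro fsum_cong) auto
  have ff: "fin_fibres UNIV (w i)" if "i \<in> {0..<t}" for i
    using fin_fibres_phi[of "r i" t] r that by (simp add: w_def)
  let ?I = "PiE {0..<t} (\<lambda>_. UNIV :: (int \<times> bool) set)"
  let ?W = "\<lambda>n. \<Sum>i=0..<t. w i (n i)"
  note P = fsum_prod[of "{0..<t}" "\<lambda>_. UNIV" w "\<lambda>i x. Poly_Mapping.single (\<lambda>j. c i x * unitv i j) (a x)", OF _ ff]
  have "(\<Prod>i=0..<t. phi t (r i) i) = lsum ?I ?W (\<lambda>n. \<Sum>i=0..<t. (\<lambda>j. c i (n i) * unitv i j)) (\<lambda>n. \<Prod>i=0..<t. a (n i))"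
    using P by (simp add: phi lsum_def prod_single)
  then have 1: "coe (\<Prod>i=0..<t. phi t (r i) i) (int m, B.base) =
    (\<Sum>n | n \<in> ?I \<and> (int (?W n), \<Sum>i=0..<t. (\<lambda>j. c i (n i) * unitv i j)) = (int m, B.base). \<Prod>i=0..<t. a (n i))"
    using P by (simp add: coe_lsum)
  have key: "(\<Sum>i=0..<t. (\<lambda>j. c i (n i) * unitv i j)) = B.base \<longleftrightarrow> (\<forall>i<t. c i (n i) = int (t - i))" for n
  proof -
    have "(\<Sum>i=0..<t. (\<lambda>j. c i (n i) * unitv i j)) x = (if x < t then c x (n x) else 0)" for x
      by (auto simp: sum_fun_apply unitv_def if_distrib[of "\<lambda>z. _ * z"] sum.delta cong: if_cong)
    then show ?thesis by (auto simp: fun_eq_iff B.base_def)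
  qed
  have c: "c i x = int (t - i) \<longleftrightarrow> x = (0, True) \<and> r i = t - i" if i: "i < t" for i x
  proof -
    obtain n s where x: "x = (n, s)" by force
    note ri = r[OF i]
    have "0 < 2 * int t" using i by simp
    note cancel = iffD1[OF mult_less_cancel_left_pos[OF this]]
    show ?thesis
    proof (cases s)
      case True
      have "n = 0" if "2 * int t * n + int (r i) = int (t - i)"
      proof -
        have "2 * int t * n < 2 * int t * 1" "2 * int t * (- 1) < 2 * int t * n"
          using that ri i by linarith+
        then have "n < 1" "- 1 < n" by (blast intro: cancel)+
        then show ?thesis by simp
      qed
      then show ?thesis using True i by (auto simp: c_def x)
    next
      case False
      have "1 - (2 * int t * n + int (r i)) \<noteq> int (t - i)"
      proof
        assume "1 - (2 * int t * n + int (r i)) = int (t - i)"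
        then have "2 * int t * n < 2 * int t * 0" "2 * int t * (- 1) < 2 * int t * n"
          using ri i by linarith+
        then have "n < 0" "- 1 < n" by (blast intro: cancel)+
        then show False by simp
      qed
      then show ?thesis using False by (simp add: c_def x)
    qed
  qed
  have w0: "w i (0, True) = 0" for i by (simp add: w_def theta_wt_def tri_def)
  have "{n. n \<in> ?I \<and> (int (?W n), \<Sum>i=0..<t. (\<lambda>j. c i (n i) * unitv i j)) = (int m, B.base)} =
     (if m = 0 \<and> (\<forall>i<t. r i = t - i) then {\<lambda>i\<in>{0..<t}. (0, True)} else {})" (is "?L = ?R")
  proof -
    have "n \<in> ?L \<longleftrightarrow> n \<in> ?I \<and> ?W n = m \<and> (\<forall>i<t. n i = (0, True) \<and> r i = t - i)" for n
    proof -
      have "(\<Sum>i=0..<t. (\<lambda>j. c i (n i) * unitv i j)) = B.base \<longleftrightarrow> (\<forall>i<t. n i = (0, True) \<and> r i = t - i)"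
        unfolding key using c by blast
      then show ?thesis by (simp only: mem_Collect_eq prod.inject of_nat_eq_iff)
    qed
    moreover have "n \<in> ?I \<and> ?W n = m \<and> (\<forall>i<t. n i = (0, True) \<and> r i = t - i) \<longleftrightarrow>
      n = (\<lambda>i\<in>{0..<t}. (0, True)) \<and> m = 0 \<and> (\<forall>i<t. r i = t - i)" for n
      using w0 by (auto simp: fun_eq_iff PiE_def extensional_def)
    ultimately show ?thesis by auto
  qed
  then show ?thesis unfolding 1 by (auto simp: a_def)
qed

text \<open>Only the identity permutation matches the parameters t - j of the columns with the
  entries of \<open>base\<close>. This is the normalisation asked for by
  \<open>weyl_inv_unique\<close>.\<close>

lemma coe_phi_det_base: "coe (phi_det t) (int m, weyl_inv.base t) = (if m = 0 then 1 else 0)"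
proof -
  have "coe (phi_det t) (int m, weyl_inv.base t) =
    (\<Sum>p | p permutes {0..<t}. sign p * coe (\<Prod>i=0..<t. phi t (t - p i) i) (int m, weyl_inv.base t))"
    unfolding phi_det_def det_mat_leibniz coe_sum by (simp add: coe_of_int)
  also have "\<dots> = (\<Sum>p | p permutes {0..<t}. if p = id then (if m = 0 then 1 else 0) else 0)"
  proof (rule sum.cong[OF refl])
    fix p assume "p \<in> {p. p permutes {0..<t}}"
    then have p: "p permutes {0..<t}" by simp
    have lt: "p i < t" if "i < t" for i using permutes_in_image[OF p, of i] that by auto
    have "(\<forall>i<t. t - p i = t - i) \<longleftrightarrow> p = id"
    proof
      assume "\<forall>i<t. t - p i = t - i"
      then have "p i = i" for i
        using lt[of i] permutes_not_in[OF p, of i] by (cases "i < t") (auto dest!: spec[of _ i])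
      then show "p = id" by auto
    qed simp
    moreover have "coe (\<Prod>i=0..<t. phi t (t - p i) i) (int m, weyl_inv.base t) =
       (if m = 0 \<and> (\<forall>i<t. t - p i = t - i) then 1 else 0)"
      using lt by (intro coe_prod_phi_base) (metis One_nat_def Suc_leI diff_le_self zero_less_diff)
    ultimately show "sign p * coe (\<Prod>i=0..<t. phi t (t - p i) i) (int m, weyl_inv.base t) =
        (if p = id then (if m = 0 then 1 else 0) else 0)" by auto
  qed
  also have "\<dots> = (if m = 0 then 1 else 0)"
    by (subst sum.delta) (auto simp: finite_permutations permutes_id)
  finally show ?thesis .
qed

theorem theta_prod_eq_scalar_mult_phi_det:
  obtains c where "theta_prod t = scalar c * phi_det t"
  using weyl_inv_unique[OF weyl_inv_theta_prod weyl_inv_phi_det coe_phi_det_base] .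

section \<open>Evaluation\<close>

abbreviation qpoch_pow :: "nat \<Rightarrow> 'a::field \<Rightarrow> 'a fps" where
  "qpoch_pow r z \<equiv> qpoch_inf (fps_X ^ r * fps_const z) (fps_X ^ r)"

abbreviation qpoch_quad :: "'a::field \<Rightarrow> 'a \<Rightarrow> 'a fps" where
  "qpoch_quad a b \<equiv> qpoch_pow 2 (a * b) * qpoch_pow 2 (a * inverse b) *
     qpoch_pow 2 (inverse a * b) * qpoch_pow 2 (inverse a * inverse b)"

section \<open>Evaluation homomorphisms into power series over a field\<close>

definition lp_eval :: "nat \<Rightarrow> (nat \<Rightarrow> 'a::field) \<Rightarrow> lp \<Rightarrow> 'a" where
  "lp_eval t y f = (\<Sum>k\<in>Poly_Mapping.keys f. of_int (Poly_Mapping.lookup f k) * (\<Prod>i<t. y i powi k i))"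

definition lpf_eval :: "nat \<Rightarrow> (nat \<Rightarrow> 'a::field) \<Rightarrow> lp fps \<Rightarrow> 'a fps" where
  "lpf_eval t y F = Abs_fps (\<lambda>n. lp_eval t y (F $ n))"

definition int_fps :: "int fps \<Rightarrow> 'a::comm_ring_1 fps" where
  "int_fps F = Abs_fps (\<lambda>n. of_int (F $ n))"

interpretation int_fps: comm_ring_hom "int_fps :: int fps \<Rightarrow> 'a::comm_ring_1 fps"
  by unfold_locales (auto simp: int_fps_def fps_eq_iff fps_mult_nth)

lemma int_fps_eq_iff: "(int_fps F :: 'a::{comm_ring_1,ring_char_0} fps) = int_fps G \<longleftrightarrow> F = G"
  by (auto simp: int_fps_def fps_eq_iff)

lemma powi_add_fun: "(\<Prod>i<t. y i powi (k + l) i) = (\<Prod>i<t. y i powi k i) * (\<Prod>i<t. y i powi l i)"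
  if "\<And>i. i < t \<Longrightarrow> y i \<noteq> 0" for y :: "nat \<Rightarrow> 'a::field"
proof -
  have "(\<Prod>i<t. y i powi (k + l) i) = (\<Prod>i<t. y i powi k i * y i powi l i)"
    by (rule prod.cong) (auto simp: power_int_add that)
  then show ?thesis by (simp add: prod.distrib)
qed

lemma lp_eval_superset:
  assumes "finite S" "Poly_Mapping.keys f \<subseteq> S"
  shows "lp_eval t y f = (\<Sum>k\<in>S. of_int (Poly_Mapping.lookup f k) * (\<Prod>i<t. y i powi k i))"
  unfolding lp_eval_def using assms by (intro sum.mono_neutral_left) (auto simp: in_keys_iff)

lemma lp_eval_diff: "lp_eval t y (f - g) = lp_eval t y f - lp_eval t y g"
  using keys_diff[of f g]
  by (simp add: lp_eval_superset[of "Poly_Mapping.keys f \<union> Poly_Mapping.keys g"] lookup_minus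
      left_diff_distrib sum_subtractf)

lemma lp_eval_0 [simp]: "lp_eval t y 0 = 0" by (simp add: lp_eval_def)

lemma lp_eval_add: "lp_eval t y (f + g) = lp_eval t y f + lp_eval t y g"
  using lp_eval_diff[of t y f "0 - g"] lp_eval_diff[of t y 0 g] by simp

lemma lp_eval_single: "lp_eval t y (Poly_Mapping.single k a) = of_int a * (\<Prod>i<t. y i powi k i)"
  by (cases "a = 0") (auto simp: lp_eval_def)

lemma lp_eval_sum: "lp_eval t y (\<Sum>i\<in>I. f i) = (\<Sum>i\<in>I. lp_eval t y (f i))"
  by (induction I rule: infinite_finite_induct) (auto simp: lp_eval_add)

text \<open>Bilinearity reduces the claim to monomials, where it is additivity of exponents; these
  may be negative, hence the nonzero values.\<close>

lemma lp_eval_mult: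
  assumes "\<And>i. i < t \<Longrightarrow> y i \<noteq> (0 :: 'a::field)"
  shows "lp_eval t y (f * g) = lp_eval t y f * lp_eval t y g"
proof (induction f rule: frag_induction[OF subset_UNIV])
  case (2 k)
  show ?case
  proof (induction g rule: frag_induction[OF subset_UNIV])
    case (2 l)
    show ?case
      using assms powi_add_fun[of t y k l] by (simp add: mult_single lp_eval_single)
  qed (auto simp: right_diff_distrib lp_eval_diff)
qed (auto simp: left_diff_distrib lp_eval_diff)

lemma lp_eval_1 [simp]: "lp_eval t y 1 = 1"
  using lp_eval_single[of t y 0 1] by (simp add: single_one)

lemma comm_ring_hom_lpf_eval:
  assumes "\<And>i. i < t \<Longrightarrow> y i \<noteq> (0 :: 'a::field)"
  shows "comm_ring_hom (lpf_eval t y)"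
  using assms
  by unfold_locales (auto simp: lpf_eval_def fps_eq_iff fps_mult_nth lp_eval_add lp_eval_sum lp_eval_mult)

lemma lpf_eval_lsum:
  "lpf_eval t y (lsum I w k a) = fsum I w (\<lambda>i. of_int (a i) * (\<Prod>j<t. y j powi k i j))"
  by (rule fps_ext) (simp add: lpf_eval_def lsum_def fsum_nth lp_eval_sum lp_eval_single)

lemma lpf_eval_scalar: "lpf_eval t y (scalar c) = int_fps c"
  by (rule fps_ext) (simp add: lpf_eval_def scalar_def int_fps_def lp_eval_single)

lemma det_mat_swap: "Determinant.det (mat n n (\<lambda>(i, j). f i j)) = Determinant.det (mat n n (\<lambda>(i, j). f j i))"
  for f :: "nat \<Rightarrow> nat \<Rightarrow> 'a::comm_ring_1"
proof -
  have "Determinant.det (mat n n (\<lambda>(i, j). f i j)) = Determinant.det (transpose_mat (mat n n (\<lambda>(i, j). f i j)))"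
    by (rule det_transpose[of _ n, symmetric]) simp
  also have "transpose_mat (mat n n (\<lambda>(i, j). f i j)) = mat n n (\<lambda>(i, j). f j i)"
    by (rule eq_matI) auto
  finally show ?thesis .
qed

lemma det_mat_leibniz':
  fixes f :: "nat \<Rightarrow> nat \<Rightarrow> 'a::comm_ring_1"
  shows "Determinant.det (mat n n (\<lambda>(i, j). f i j)) =
    (\<Sum>p | p permutes {0..<n}. of_int (sign p) * (\<Prod>j=0..<n. f (p j) j))"
  by (subst det_mat_swap) (rule det_mat_leibniz)

text \<open>Multilinearity in the columns: the weight depends on the column only, so one summation
  index per column can be pulled out of the determinant.\<close>

lemma det_fsum:
  fixes a :: "nat \<Rightarrow> nat \<Rightarrow> 'i \<Rightarrow> 'a::comm_ring_1"
  assumes "\<And>j. j < t \<Longrightarrow> fin_fibres UNIV (w j)"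
  shows "Determinant.det (mat t t (\<lambda>(i, j). fsum UNIV (w j) (a i j))) =
    fsum (PiE {0..<t} (\<lambda>_. UNIV)) (\<lambda>n. \<Sum>j=0..<t. w j (n j))
      (\<lambda>n. Determinant.det (mat t t (\<lambda>(i, j). a i j (n j))))"
proof (rule fps_ext)
  fix N
  have "(\<Prod>j=0..<t. fsum UNIV (w j) (a (p j) j)) =
     fsum (PiE {0..<t} (\<lambda>_. UNIV)) (\<lambda>n. \<Sum>j=0..<t. w j (n j)) (\<lambda>n. \<Prod>j=0..<t. a (p j) j (n j))" for p
    using fsum_prod[of "{0..<t}" "\<lambda>_. UNIV" w "\<lambda>j. a (p j) j"] assms by simp
  moreover have "(of_int c * F) $ N = of_int c * F $ N" for c and F :: "'a fps"
    by (simp add: fps_of_int[symmetric])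
  ultimately have "Determinant.det (mat t t (\<lambda>(i, j). fsum UNIV (w j) (a i j))) $ N =
     (\<Sum>p | p permutes {0..<t}. \<Sum>n | n \<in> PiE {0..<t} (\<lambda>_. UNIV) \<and> (\<Sum>j=0..<t. w j (n j)) = N.
        of_int (sign p) * (\<Prod>j=0..<t. a (p j) j (n j)))"
    by (simp add: det_mat_leibniz' fps_sum_nth fsum_nth sum_distrib_left)
  also have "\<dots> = (\<Sum>n | n \<in> PiE {0..<t} (\<lambda>_. UNIV) \<and> (\<Sum>j=0..<t. w j (n j)) = N.
      Determinant.det (mat t t (\<lambda>(i, j). a i j (n j))))"
    by (subst sum.swap) (simp only: det_mat_leibniz')
  finally show "Determinant.det (mat t t (\<lambda>(i, j). fsum UNIV (w j) (a i j))) $ N =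
    fsum (PiE {0..<t} (\<lambda>_. UNIV)) (\<lambda>n. \<Sum>j=0..<t. w j (n j))
      (\<lambda>n. Determinant.det (mat t t (\<lambda>(i, j). a i j (n j)))) $ N"
    by (simp add: fsum_nth)
qed

section \<open>Both sides of the theta identity, evaluated\<close>

abbreviation int_vecs :: "nat \<Rightarrow> (nat \<Rightarrow> int) set" where
  "int_vecs t \<equiv> PiE {0..<t} (\<lambda>_. UNIV)"

definition phi_wt :: "nat \<Rightarrow> (nat \<Rightarrow> int) \<Rightarrow> nat" where
  "phi_wt t n = (\<Sum>j=0..<t. phi_exp t (t - j) (n j))"

text \<open>The denominator of type B in product form, up to sign and a monomial; the factors
  \<open>inverse (y i)\<close> come from \<open>psi\<close>.\<close>

definition weyl_num :: "nat \<Rightarrow> (nat \<Rightarrow> 'a::field) \<Rightarrow> 'a" where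
  "weyl_num t y = (\<Prod>i<t. 1 - y i) * (\<Prod>(i, j)\<in>pairs t. inverse (y i) * (1 - y i * y j) * (1 - y i * inverse (y j)))"

definition prod_side :: "nat \<Rightarrow> (nat \<Rightarrow> 'a::field) \<Rightarrow> 'a fps" where
  "prod_side t y = (\<Prod>i<t. qpoch_inf (fps_X * fps_const (y i)) fps_X * qpoch_inf (fps_X * fps_const (inverse (y i))) fps_X) *
     (\<Prod>(i, j)\<in>pairs t. qpoch_quad (y i) (y j))"

lemma altsign_powi: "of_int (altsign n) * z powi n = (- z) powi n" for z :: "'a::field"
  by (auto simp: altsign_def power_int_minus_left)

lemma fsum_altsign_eq_qpoch:
  fixes z :: "'a::field"
  assumes "z \<noteq> 0" "r > 0"
  shows "fsum UNIV (theta_wt r 0) (\<lambda>n. of_int (altsign n) * z powi n) =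
    fps_const (1 - z) * (qpoch_inf (fps_X ^ r * fps_const z) (fps_X ^ r) *
    qpoch_inf (fps_X ^ r * fps_const (inverse z)) (fps_X ^ r)) * qpoch_inf (fps_X ^ r) (fps_X ^ r)"
proof -
  have "fsum UNIV (theta_wt r 0) (\<lambda>n. of_int (altsign n) * z powi n) = fsum UNIV (theta_wt r 0) (\<lambda>n. (- z) powi n)"
    by (simp only: altsign_powi)
  also have "\<dots> = (1 + fps_const (- z)) *
     qpoch_inf (fps_const z * fps_X ^ r) (fps_X ^ r) *
     qpoch_inf (fps_const (inverse z) * fps_X ^ r) (fps_X ^ r) * qpoch_inf (fps_X ^ r) (fps_X ^ r)"
    using jacobi_triple_product[of "- z" 0 r] assms
    by (simp flip: fps_const_neg)
  also have "1 + fps_const (- z) = fps_const (1 - z)"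
    by (simp flip: fps_const_neg fps_const_sub)
  finally show ?thesis by (simp only: mult_ac)
qed

lemma prod_unitv:
  assumes y: "\<And>i. i < t \<Longrightarrow> y i \<noteq> (0 :: 'a::field)" and i: "i < t" and j: "j < t"
  shows "(\<Prod>l<t. y l powi (n * unitv i l)) = y i powi n"
    "(\<Prod>l<t. y l powi (n * (unitv i + unitv j) l)) = (y i * y j) powi n"
    "(\<Prod>l<t. y l powi (n * (unitv i - unitv j) l)) = (y i * inverse (y j)) powi n"
    "(\<Prod>l<t. y l powi ((- unitv i) l)) = inverse (y i)"
proof -
  have u: "(\<Prod>l<t. y l powi (n * unitv i l)) = y i powi n" if i: "i < t" for n i
  proof -
    have "(\<Prod>l<t. y l powi (n * unitv i l)) = (\<Prod>l<t. if l = i then y i powi n else 1)"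
      by (rule prod.cong) (auto simp: unitv_def)
    then show ?thesis using i by simp
  qed
  show "(\<Prod>l<t. y l powi (n * unitv i l)) = y i powi n" by (rule u[OF i])
  have "(\<Prod>l<t. y l powi (n * (unitv i + unitv j) l)) = (\<Prod>l<t. y l powi (n * unitv i l) * y l powi (n * unitv j l))"
    by (rule prod.cong) (auto simp: power_int_add y ring_distribs)
  then show "(\<Prod>l<t. y l powi (n * (unitv i + unitv j) l)) = (y i * y j) powi n"
    using i j by (simp add: prod.distrib u power_int_mult_distrib)
  have "(\<Prod>l<t. y l powi (n * (unitv i - unitv j) l)) = (\<Prod>l<t. y l powi (n * unitv i l) * y l powi (- n * unitv j l))"
    by (rule prod.cong) (auto simp: power_int_add[symmetric] y ring_distribs)
  then show "(\<Prod>l<t. y l powi (n * (unitv i - unitv j) l)) = (y i * inverse (y j)) powi n"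
    using i j by (simp only: prod.distrib u power_int_mult_distrib power_int_minus power_int_inverse)
  show "(\<Prod>l<t. y l powi ((- unitv i) l)) = inverse (y i)"
    using u[OF i, of "- 1"] by (simp add: power_int_minus)
qed

lemma lpf_eval_phi:
  assumes y: "\<And>i. i < t \<Longrightarrow> y i \<noteq> (0 :: 'a::field)" and i: "i < t" and r: "1 \<le> r" "r \<le> t"
  shows "lpf_eval t y (phi t r i) = fsum UNIV (phi_exp t r)
    (\<lambda>n. y i powi (2 * int t * n + int r) - y i powi (1 - (2 * int t * n + int r)))"
proof (rule fps_ext)
  fix N
  let ?w = "phi_exp t r"
  let ?e = "\<lambda>n s. if s then 2 * int t * n + int r else 1 - (2 * int t * n + int r)"
  have "{x \<in> UNIV. (case x of (n, s :: bool) \<Rightarrow> ?w n) = N} = {n. ?w n = N} \<times> UNIV" by auto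
  then have "lpf_eval t y (phi t r i) $ N =
      (\<Sum>x\<in>{n. ?w n = N} \<times> (UNIV :: bool set). case x of (n, s) \<Rightarrow> (if s then 1 else - 1) * y i powi ?e n s)"
    unfolding phi_def lpf_eval_lsum fsum_nth
    by (intro sum.cong) (auto simp: prod_unitv(1)[OF y i i] case_prod_unfold)
  also have "\<dots> = (\<Sum>n | ?w n = N. \<Sum>s\<in>UNIV. (if s then 1 else - 1) * y i powi ?e n s)"
    by (rule sum.cartesian_product[symmetric])
  also have "\<dots> = (\<Sum>n | ?w n = N. y i powi (2 * int t * n + int r) - y i powi (1 - (2 * int t * n + int r)))"
    by (simp add: UNIV_bool)
  finally show "lpf_eval t y (phi t r i) $ N = fsum UNIV ?w
      (\<lambda>n. y i powi (2 * int t * n + int r) - y i powi (1 - (2 * int t * n + int r))) $ N"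
    by (simp add: fsum_nth)
qed

lemma fin_fibres_phi_wt: "j < t \<Longrightarrow> fin_fibres UNIV (phi_exp t (t - j))"
  by (rule fin_fibres_theta) auto

text \<open>Column j, counted from 0, receives the exponents 2 t n_j + t - j and their reflections;
  this is \<open>so_det\<close> with 2 t n_j in the role of the j-th part. Indices move by one
  because \<open>so_det\<close> counts variables and parts from 1.\<close>

lemma lpf_eval_phi_det:
  assumes x: "\<And>i. i < t \<Longrightarrow> x (Suc i) \<noteq> (0 :: 'a::field)"
  shows "lpf_eval t (\<lambda>i. x (Suc i)) (phi_det t) =
    fsum (int_vecs t) (phi_wt t) (\<lambda>n. so_det t (\<lambda>j. int (2 * t) * n (j - 1)) x)"
proof -
  interpret h: comm_ring_hom "lpf_eval t (\<lambda>i. x (Suc i))"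
    using x by (intro comm_ring_hom_lpf_eval)
  let ?a = "\<lambda>i j n. x (Suc i) powi (2 * int t * n + int (t - j)) - x (Suc i) powi (1 - (2 * int t * n + int (t - j)))"
  have "lpf_eval t (\<lambda>i. x (Suc i)) (phi_det t) =
    Determinant.det (map_mat (lpf_eval t (\<lambda>i. x (Suc i))) (mat t t (\<lambda>(i, j). phi t (t - j) i)))"
    by (simp add: phi_det_def h.hom_det)
  also have "map_mat (lpf_eval t (\<lambda>i. x (Suc i))) (mat t t (\<lambda>(i, j). phi t (t - j) i)) =
    mat t t (\<lambda>(i, j). fsum UNIV (phi_exp t (t - j)) (?a i j))"
    using x by (intro eq_matI) (auto simp: lpf_eval_phi)
  also have "Determinant.det \<dots> = fsum (int_vecs t) (phi_wt t)
      (\<lambda>n. Determinant.det (mat t t (\<lambda>(i, j). ?a i j (n j))))"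
    unfolding phi_wt_def[abs_def] by (rule det_fsum) (rule fin_fibres_phi_wt)
  also have "\<dots> = fsum (int_vecs t) (phi_wt t) (\<lambda>n. so_det t (\<lambda>j. int (2 * t) * n (j - 1)) x)"
  proof (rule fsum_cong[OF refl])
    fix n :: "nat \<Rightarrow> int"
    show "Determinant.det (mat t t (\<lambda>(i, j). ?a i j (n j))) = so_det t (\<lambda>j. int (2 * t) * n (j - 1)) x"
      unfolding so_det_def
      by (intro arg_cong[of _ _ Determinant.det] eq_matI) (auto simp: of_nat_diff algebra_simps)
  qed
  finally show ?thesis .
qed

text \<open>One coordinate z has weight z (2 (t z + t - j) - 1), and the second factor is odd. So
  the part of degree 0 in q comes from the zero vector alone.\<close>

lemma phi_wt_eq_0_iff:
  assumes "n \<in> int_vecs t"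
  shows "phi_wt t n = 0 \<longleftrightarrow> n = (\<lambda>j\<in>{0..<t}. 0)"
proof -
  have "phi_exp t (t - j) z = 0 \<longleftrightarrow> z = 0" if j: "j < t" for j z
  proof -
    have "int (phi_exp t (t - j) z) = 2 * int t * z * z + (2 * int (t - j) - 1) * z"
      using j by (intro int_theta_wt_phi) auto
    also have "\<dots> = z * (2 * (int t * z + int (t - j)) - 1)" by (simp add: algebra_simps)
    finally have "phi_exp t (t - j) z = 0 \<longleftrightarrow> z = 0 \<or> 2 * (int t * z + int (t - j)) = 1"
      by (metis diff_eq_eq mult_eq_0_iff of_nat_0 of_nat_eq_iff add_0)
    moreover have "2 * (int t * z + int (t - j)) \<noteq> 1" by presburger
    ultimately show ?thesis by metis
  qed
  then show ?thesis using assms by (auto simp: phi_wt_def fun_eq_iff PiE_def extensional_def)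
qed

lemma lpf_eval_phi_det_nth_0:
  assumes x: "\<And>i. i < t \<Longrightarrow> x (Suc i) \<noteq> (0 :: 'a::field)"
  shows "lpf_eval t (\<lambda>i. x (Suc i)) (phi_det t) $ 0 = so_det t (\<lambda>_. 0) x"
proof -
  have "{n. n \<in> int_vecs t \<and> phi_wt t n = 0} = {\<lambda>j\<in>{0..<t}. 0}"
    using phi_wt_eq_0_iff by auto
  moreover have "so_det t (\<lambda>j. int (2 * t) * (\<lambda>j\<in>{0..<t}. 0) (j - 1)) x = so_det t (\<lambda>_. 0) x"
    unfolding so_det_def by (intro arg_cong[of _ _ Determinant.det] eq_matI) auto
  ultimately show ?thesis by (simp add: lpf_eval_phi_det[of t x, OF x] fsum_nth)
qed

lemma lpf_eval_theta_prod:
  assumes y: "\<And>i. i < t \<Longrightarrow> y i \<noteq> (0 :: 'a::field)"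
  shows "lpf_eval t y (theta_prod t) = fps_const (weyl_num t y) * prod_side t y *
    qpoch_inf fps_X fps_X ^ t * qpoch_inf (fps_X\<^sup>2) (fps_X\<^sup>2) ^ (2 * card (pairs t))"
proof -
  let ?Q = "qpoch_inf fps_X fps_X :: 'a fps" and ?T = "qpoch_inf (fps_X\<^sup>2) (fps_X\<^sup>2) :: 'a fps"
  interpret h: comm_ring_hom "lpf_eval t y"
    using y by (intro comm_ring_hom_lpf_eval)
  have th1: "lpf_eval t y (thetav 1 (unitv i)) = fps_const (1 - y i) *
      (qpoch_inf (fps_X * fps_const (y i)) fps_X * qpoch_inf (fps_X * fps_const (inverse (y i))) fps_X) * ?Q"
    if i: "i < t" for i
    using fsum_altsign_eq_qpoch[of "y i" 1] y[OF i] i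
    by (simp add: thetav_def lpf_eval_lsum prod_unitv(1)[OF y i i])
  have ps: "lpf_eval t y (psi i j) = fps_const (inverse (y i) * (1 - y i * y j) * (1 - y i * inverse (y j))) *
      qpoch_quad (y i) (y j) * ?T\<^sup>2"
    if ij: "(i, j) \<in> pairs t" for i j
  proof -
    have i: "i < t" and j: "j < t" using ij by (auto simp: pairs_def)
    note nz = y[OF i] y[OF j]
    have m: "lpf_eval t y (monov (- unitv i)) = fps_const (inverse (y i))"
    proof (rule fps_ext)
      fix N :: nat
      have "{ia. ia \<in> {()} \<and> 0 = N} = (if N = 0 then {()} else {})" by auto
      then show "lpf_eval t y (monov (- unitv i)) $ N = fps_const (inverse (y i)) $ N"
        unfolding monov_def lpf_eval_lsum fsum_nth using prod_unitv(4)[OF y i i] by simp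
    qed
    have p: "lpf_eval t y (thetav 2 (unitv i + unitv j)) = fps_const (1 - y i * y j) *
        (qpoch_pow 2 (y i * y j) *
         qpoch_pow 2 (inverse (y i) * inverse (y j))) * ?T"
    proof -
      have "lpf_eval t y (thetav 2 (unitv i + unitv j)) =
          fsum UNIV (theta_wt 2 0) (\<lambda>n. of_int (altsign n) * (y i * y j) powi n)"
        unfolding thetav_def lpf_eval_lsum
        by (intro fsum_cong refl arg_cong2[where f = "(*)"] prod_unitv(2)[OF y i j])
      then show ?thesis
        using fsum_altsign_eq_qpoch[of "y i * y j" 2] nz by (simp add: mult.commute)
    qed
    have d: "lpf_eval t y (thetav 2 (unitv i - unitv j)) = fps_const (1 - y i * inverse (y j)) *
        (qpoch_pow 2 (y i * inverse (y j)) *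
         qpoch_pow 2 (inverse (y i) * y j)) * ?T"
    proof -
      have "lpf_eval t y (thetav 2 (unitv i - unitv j)) =
          fsum UNIV (theta_wt 2 0) (\<lambda>n. of_int (altsign n) * (y i * inverse (y j)) powi n)"
        unfolding thetav_def lpf_eval_lsum
        by (intro fsum_cong refl arg_cong2[where f = "(*)"] prod_unitv(3)[OF y i j])
      then show ?thesis
        using fsum_altsign_eq_qpoch[of "y i * inverse (y j)" 2] nz by (simp add: mult.commute)
    qed
    show ?thesis
      unfolding psi_def h.hom_mult m p d fps_const_mult[symmetric] power2_eq_square[of ?T]
      by (simp only: mult_ac)
  qed
  have const_prod: "fps_const (\<Prod>i\<in>I. f i) = (\<Prod>i\<in>I. fps_const (f i))" for I and f :: "'i \<Rightarrow> 'a"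
    by (induction I rule: infinite_finite_induct) (auto simp flip: fps_const_mult)
  have "lpf_eval t y (theta_prod t) =
      (\<Prod>i<t. lpf_eval t y (thetav 1 (unitv i))) * (\<Prod>p\<in>pairs t. lpf_eval t y (psi (fst p) (snd p)))"
    by (simp add: theta_prod_def h.hom_mult h.hom_prod case_prod_unfold)
  also have "(\<Prod>i<t. lpf_eval t y (thetav 1 (unitv i))) = fps_const (\<Prod>i<t. 1 - y i) *
      (\<Prod>i<t. qpoch_inf (fps_X * fps_const (y i)) fps_X * qpoch_inf (fps_X * fps_const (inverse (y i))) fps_X) * ?Q ^ t"
  proof -
    have "(\<Prod>i<t. lpf_eval t y (thetav 1 (unitv i))) = (\<Prod>i<t. fps_const (1 - y i) *
      (qpoch_inf (fps_X * fps_const (y i)) fps_X * qpoch_inf (fps_X * fps_const (inverse (y i))) fps_X) * ?Q)"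
      by (rule prod.cong) (simp_all only: th1 lessThan_iff)
    then show ?thesis by (simp only: prod.distrib const_prod prod_constant card_lessThan)
  qed
  also have "(\<Prod>p\<in>pairs t. lpf_eval t y (psi (fst p) (snd p))) =
      (\<Prod>p\<in>pairs t. fps_const (case p of (i, j) \<Rightarrow> inverse (y i) * (1 - y i * y j) * (1 - y i * inverse (y j))) *
      (case p of (i, j) \<Rightarrow> qpoch_quad (y i) (y j)) * ?T\<^sup>2)"
    by (rule prod.cong) (auto simp: ps)
  also have "\<dots> = fps_const (\<Prod>p\<in>pairs t. case p of (i, j) \<Rightarrow> inverse (y i) * (1 - y i * y j) * (1 - y i * inverse (y j))) *
     (\<Prod>p\<in>pairs t. case p of (i, j) \<Rightarrow> qpoch_quad (y i) (y j)) * ?T ^ (2 * card (pairs t))"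
    unfolding prod.distrib const_prod prod_constant power_mult ..
  finally show ?thesis
    unfolding weyl_num_def prod_side_def fps_const_mult[symmetric] by (simp only: mult_ac)
qed

lemma fps_prod_nth_0: "(\<Prod>i\<in>I. f i) $ 0 = (\<Prod>i\<in>I. f i $ 0)" for f :: "'i \<Rightarrow> 'a::comm_ring_1 fps"
  by (induction I rule: infinite_finite_induct) auto

lemma prod_side_nth_0: "prod_side t y $ 0 = 1"
proof -
  have "qpoch_inf (fps_X * fps_const z) fps_X $ 0 = (1 :: 'a)"
    "qpoch_pow 2 z $ 0 = (1 :: 'a)" for z
    by (rule qpoch_nth_0; simp)+
  then show ?thesis
    unfolding prod_side_def by (simp add: fps_prod_nth_0 case_prod_unfold)
qed

lemma theta_identity_up_to_scalar:
  fixes x :: "nat \<Rightarrow> 'a::field"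
  assumes c: "theta_prod t = scalar c * phi_det t" and x: "\<And>i. i < t \<Longrightarrow> x (Suc i) \<noteq> 0"
  shows "fps_const (weyl_num t (\<lambda>i. x (Suc i))) * prod_side t (\<lambda>i. x (Suc i)) *
      qpoch_inf fps_X fps_X ^ t * qpoch_inf (fps_X\<^sup>2) (fps_X\<^sup>2) ^ (2 * card (pairs t)) =
    int_fps c * fsum (int_vecs t) (phi_wt t) (\<lambda>n. so_det t (\<lambda>j. int (2 * t) * n (j - 1)) x)"
proof -
  interpret h: comm_ring_hom "lpf_eval t (\<lambda>i. x (Suc i))"
    using x by (intro comm_ring_hom_lpf_eval)
  have "lpf_eval t (\<lambda>i. x (Suc i)) (theta_prod t) =
      int_fps c * lpf_eval t (\<lambda>i. x (Suc i)) (phi_det t)"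
    by (simp only: c h.hom_mult lpf_eval_scalar)
  then show ?thesis
    using lpf_eval_theta_prod[of t "\<lambda>i. x (Suc i)", OF x] lpf_eval_phi_det[of t x, OF x] by simp
qed

section \<open>Specialisation at roots of unity\<close>

text \<open>The monic polynomial with roots \<open>w ^ u * z\<close> and X^n - z^n differ by a
  polynomial of degree below n with n distinct roots; evaluate at 1. An integral domain is the right
  generality because z will be a power of \<open>fps_X\<close>.\<close>

lemma prod_one_minus_root_of_unity:
  fixes z :: "'a::idom"
  assumes w: "w ^ n = 1" "\<And>i j. i < n \<Longrightarrow> j < n \<Longrightarrow> w ^ i = w ^ j \<Longrightarrow> i = j" and "n > 0"
  shows "(\<Prod>u<n. 1 - w ^ u * z) = 1 - z ^ n"
proof (cases "z = 0")
  case False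
  define L where "L = (\<Prod>u<n. [:- (w ^ u * z), 1:])"
  define D where "D = L - (monom 1 n - [:z ^ n:])"
  have "degree L = n" by (simp add: L_def degree_prod_eq_sum_degree)
  moreover have "lead_coeff L = 1" unfolding L_def lead_coeff_prod by simp
  ultimately have L: "degree L = n" "lead_coeff L = 1" by blast+
  have "degree D \<le> n"
    unfolding D_def using L by (intro degree_diff_le) (auto simp: degree_monom_eq)
  moreover have "coeff D n = 0"
    using L assms(3) by (simp add: D_def coeff_pCons split: nat.splits)
  ultimately have deg: "D \<noteq> 0 \<Longrightarrow> degree D < n"
    by (metis leading_coeff_0_iff le_neq_implies_less)
  have "D = 0"
  proof (rule ccontr)
    assume "D \<noteq> 0"
    let ?R = "(\<lambda>u. w ^ u * z) ` {..<n}"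
    have "poly L (w ^ u * z) = 0" if "u < n" for u
      unfolding L_def poly_prod using that by (intro prod_zero) auto
    moreover have "(w ^ u * z) ^ n = z ^ n" for u
      using w(1) by (simp add: power_mult_distrib) (metis power_mult mult.commute power_one)
    ultimately have "?R \<subseteq> {x. poly D x = 0}" by (auto simp: D_def poly_monom)
    then have "card ?R \<le> card {x. poly D x = 0}"
      by (intro card_mono poly_roots_finite[OF \<open>D \<noteq> 0\<close>])
    also have "\<dots> \<le> degree D" by (rule card_poly_roots_bound[OF \<open>D \<noteq> 0\<close>])
    also have "card ?R = n"
      using w(2) False by (subst card_image) (auto simp: inj_on_def)
    finally show False using deg[OF \<open>D \<noteq> 0\<close>] by simp
  qed
  then have "poly L 1 = 1 - z ^ n" by (simp add: D_def poly_monom)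
  then show ?thesis by (simp add: L_def poly_prod)
qed (use assms in simp)

lemma prod_qpoch_root_of_unity:
  fixes w :: "'a::field"
  assumes w: "w ^ n = 1" "\<And>i j. i < n \<Longrightarrow> j < n \<Longrightarrow> w ^ i = w ^ j \<Longrightarrow> i = j" and "n > 0" and "r > 0"
  shows "(\<Prod>u<n. qpoch_inf (fps_X ^ r * fps_const (w ^ u)) (fps_X ^ r)) = qpoch_inf (fps_X ^ (r * n)) (fps_X ^ (r * n))"
proof -
  have fin: "(\<Prod>u<n. \<Prod>j<N. 1 - fps_X ^ r * fps_const (w ^ u) * (fps_X ^ r) ^ j) =
      (\<Prod>j<N. 1 - fps_X ^ (r * n) * (fps_X ^ (r * n)) ^ j)" for N
  proof -
    have "(\<Prod>u<n. 1 - fps_X ^ r * fps_const (w ^ u) * (fps_X ^ r) ^ j) =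
        1 - fps_X ^ (r * n) * (fps_X ^ (r * n)) ^ j" for j
    proof -
      have w': "i = j" if "i < n" "j < n" "fps_const w ^ i = fps_const w ^ j" for i j
        using w(2)[OF that(1,2)] arg_cong[OF that(3), of "\<lambda>F. F $ 0"] by (simp add: fps_const_power)
      have 1: "(\<Prod>u<n. 1 - fps_const w ^ u * fps_X ^ (r * Suc j)) = 1 - (fps_X ^ (r * Suc j)) ^ n"
        by (rule prod_one_minus_root_of_unity[OF _ w' assms(3)]) (simp add: fps_const_power w(1))
      have 2: "fps_X ^ r * fps_const (w ^ u) * (fps_X ^ r) ^ j = fps_const w ^ u * fps_X ^ (r * Suc j)" for u
        by (simp add: fps_const_power power_mult[symmetric] power_add mult_ac)
      have 3: "(fps_X ^ (r * Suc j)) ^ n = (fps_X ^ (r * n) * (fps_X ^ (r * n)) ^ j :: 'a fps)"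
        by (simp add: power_mult[symmetric] power_add[symmetric] algebra_simps)
      show ?thesis unfolding 2 1 3 ..
    qed
    then show ?thesis by (subst prod.swap) simp
  qed
  have "(\<lambda>N. \<Prod>u<n. \<Prod>j<N. 1 - fps_X ^ r * fps_const (w ^ u) * (fps_X ^ r) ^ j) \<longlonglongrightarrow>
     (\<Prod>u<n. qpoch_inf (fps_X ^ r * fps_const (w ^ u)) (fps_X ^ r))"
    using assms(4) by (intro tendsto_fps_prod tendsto_qpoch) auto
  then show ?thesis
    unfolding fin using assms by (intro qpoch_eqI[symmetric]) auto
qed

section \<open>Products of periodic functions\<close>

lemma prod_periodic_window:
  fixes f :: "int \<Rightarrow> 'a::comm_monoid_mult"
  assumes per: "\<And>k. f (k + int n) = f k"
  shows "(\<Prod>i<n. f (a + int i)) = (\<Prod>i<n. f (int i))"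
proof -
  have step: "(\<Prod>i<n. f (a + 1 + int i)) = (\<Prod>i<n. f (a + int i))" for a
  proof (cases n)
    case (Suc m)
    have "(\<Prod>i<n. f (a + int i)) = f a * (\<Prod>i<m. f (a + 1 + int i))"
      unfolding Suc prod.lessThan_Suc_shift by (simp add: algebra_simps)
    moreover have "(\<Prod>i<n. f (a + 1 + int i)) = (\<Prod>i<m. f (a + 1 + int i)) * f (a + int n)"
      unfolding Suc prod.lessThan_Suc by (simp add: algebra_simps)
    ultimately show ?thesis using per[of a] by (simp add: mult.commute)
  qed simp
  have up: "(\<Prod>i<n. f (int b + int i)) = (\<Prod>i<n. f (int i))" for b
  proof (induction b)
    case (Suc b)
    then show ?case using step[of "int b"] by (simp add: add.commute)
  qed simp
  have down: "(\<Prod>i<n. f (- int b + int i)) = (\<Prod>i<n. f (int i))" for b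
  proof (induction b)
    case (Suc b)
    then show ?case using step[of "- int (Suc b)"] by simp
  qed simp
  show ?thesis using up[of "nat a"] down[of "nat (- a)"] by (cases "a \<ge> 0") auto
qed

lemma prod_lessThan_double:
  fixes f :: "nat \<Rightarrow> 'a::comm_monoid_mult"
  shows "(\<Prod>i<2*t. f i) = (\<Prod>i<t. f i) * (\<Prod>i<t. f (t + i))"
proof -
  have "(\<Prod>i<t + t. f i) = (\<Prod>i<t. f i) * (\<Prod>i<t. f (i + t))"
    by (simp add: lessThan_atLeast0 prod.atLeastLessThan_concat[of 0 t "t + t", symmetric]
        prod.shift_bounds_nat_ivl[of _ 0 t t, simplified])
  then show ?thesis by (simp add: mult_2 add.commute)
qed

text \<open>The window from a - t to a + t meets every residue class modulo 2 t once, except that of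
  a + t, which it meets at both ends.\<close>

lemma prod_periodic_symmetric:
  fixes f :: "int \<Rightarrow> 'a::comm_monoid_mult"
  assumes per: "\<And>k. f (k + 2 * int t) = f k"
  shows "(\<Prod>l<t. f (a + int (Suc l)) * f (a - int (Suc l))) * f a = (\<Prod>u<2*t. f (int u)) * f (a + int t)"
proof -
  have 0: "(\<Prod>l<t. f (a - int (Suc l))) = (\<Prod>l<t. f (a - int t + int l))"
    by (subst prod.nat_diff_reindex[symmetric]) (auto intro!: prod.cong simp: algebra_simps of_nat_diff)
  have 1: "f a * (\<Prod>l<t. f (a + int (Suc l))) = (\<Prod>l<t. f (a + int l)) * f (a + int t)"
    using prod.lessThan_Suc_shift[of "\<lambda>l. f (a + int l)" t] prod.lessThan_Suc[of "\<lambda>l. f (a + int l)" t] by simp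
  have 2: "(\<Prod>l<t. f (a - int t + int l)) * (\<Prod>l<t. f (a + int l)) = (\<Prod>u<2*t. f (a - int t + int u))"
    by (simp add: prod_lessThan_double)
  have 3: "(\<Prod>u<2*t. f (a - int t + int u)) = (\<Prod>u<2*t. f (int u))"
    by (rule prod_periodic_window) (use per in simp)
  have "(\<Prod>l<t. f (a + int (Suc l)) * f (a - int (Suc l))) * f a =
      (\<Prod>l<t. f (a - int (Suc l))) * (f a * (\<Prod>l<t. f (a + int (Suc l))))"
    unfolding prod.distrib by (simp only: mult_ac)
  also have "\<dots> = (\<Prod>u<2*t. f (int u)) * f (a + int t)"
    unfolding 0 1 mult.assoc[symmetric] 2 3 ..
  finally show ?thesis .
qed

lemma qpoch_step:
  fixes a p :: "'a::field fps"
  assumes "a $ 0 = 0" "p $ 0 = 0"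
  shows "qpoch_inf a p = (1 - a) * qpoch_inf (a * p) p"
proof -
  have "(\<lambda>N. (1 - a) * (\<Prod>j<N. 1 - a * p * p ^ j)) \<longlonglongrightarrow> (1 - a) * qpoch_inf (a * p) p"
    using assms by (intro tendsto_fps_mult tendsto_const tendsto_qpoch) auto
  moreover have "(1 - a) * (\<Prod>j<N. 1 - a * p * p ^ j) = (\<Prod>j<Suc N. 1 - a * p ^ j)" for N
    by (subst prod.lessThan_Suc_shift) (simp add: mult.assoc)
  ultimately have "(\<lambda>N. \<Prod>j<Suc N. 1 - a * p ^ j) \<longlonglongrightarrow> (1 - a) * qpoch_inf (a * p) p"
    by simp
  then have "(\<lambda>N. \<Prod>j<N. 1 - a * p ^ j) \<longlonglongrightarrow> (1 - a) * qpoch_inf (a * p) p"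
    by (rule LIMSEQ_imp_Suc)
  then show ?thesis using assms by (rule qpoch_eqI[rotated 2])
qed

text \<open>At x = 1 the triple product turns series j into factors with exponents 4 t - 2 j - 1 and
  2 j + 1 in base q^(4t). For j < t these run through all odd numbers below 4 t, and
  \<open>qpoch_split\<close> reassembles them into one product in base q^2.\<close>

lemma prod_theta_constants:
  assumes "t > 0"
  shows "(\<Prod>j<t. fsum UNIV (phi_exp t (t - j)) (\<lambda>_. 1)) =
    qpoch_inf (fps_X ^ (4 * t)) (fps_X ^ (4 * t)) ^ t * (qpoch_inf (- fps_X) (fps_X\<^sup>2) :: 'a::field fps)"
proof -
  let ?p = "fps_X ^ (4 * t) :: 'a fps"
  let ?F = "\<lambda>i. qpoch_inf (- (fps_X ^ (2 * i + 1))) ?p"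
  have one: "fsum UNIV (phi_exp t (t - j)) (\<lambda>_. 1) = ?F (t + (t - Suc j)) * ?F j * qpoch_inf ?p ?p"
    if j: "j < t" for j
  proof -
    let ?s = "2 * t + 2 * (t - j) - 1"
    have e: "?s = 2 * (t + (t - Suc j)) + 1" "4 * t - ?s = 2 * j + 1" using j by auto
    have "fsum UNIV (theta_wt (4 * t) ?s) (\<lambda>_. 1) =
      (1 + fps_X ^ ?s) * qpoch_inf (- (fps_X ^ ?s * ?p)) ?p * qpoch_inf (- (fps_X ^ (4 * t - ?s))) ?p * qpoch_inf ?p ?p"
    proof -
      have "?s < 4 * t" using j by auto
      from jacobi_triple_product[of "1 :: 'a", OF one_neq_zero this] show ?thesis
        by (simp only: fps_const_1_eq_1 mult_1 power_add power_int_1_left inverse_1 mult_minus1)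
    qed
    also have "(1 + fps_X ^ ?s) * qpoch_inf (- (fps_X ^ ?s * ?p)) ?p = qpoch_inf (- (fps_X ^ ?s)) ?p"
      using qpoch_step[of "- (fps_X ^ ?s)" ?p] j by simp
    finally show ?thesis unfolding e(2) unfolding e(1) .
  qed
  have "(\<Prod>j<t. fsum UNIV (phi_exp t (t - j)) (\<lambda>_. 1)) =
     (\<Prod>j<t. ?F (t + (t - Suc j)) * ?F j * qpoch_inf ?p ?p)"
    by (rule prod.cong[OF refl], rule one) simp
  also have "\<dots> = (\<Prod>j<t. ?F (t + j)) * (\<Prod>j<t. ?F j) * qpoch_inf ?p ?p ^ t"
    unfolding prod.distrib prod.nat_diff_reindex[of "\<lambda>j. ?F (t + j)" t] by simp
  also have "(\<Prod>j<t. ?F (t + j)) * (\<Prod>j<t. ?F j) = (\<Prod>i<2*t. ?F i)"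
    unfolding prod_lessThan_double by (rule mult.commute)
  also have "(\<Prod>i<2*t. ?F i) = (\<Prod>i<2*t. qpoch_inf (- fps_X * (fps_X\<^sup>2) ^ i) ((fps_X\<^sup>2) ^ (2 * t)))"
    by (intro prod.cong refl) (simp add: power_mult[symmetric])
  also have "\<dots> = qpoch_inf (- fps_X) (fps_X\<^sup>2)"
    using assms by (intro qpoch_split[symmetric]) auto
  finally show ?thesis by (simp add: mult.commute)
qed

lemma fps_eq_of_square_eq:
  fixes F G :: "'a::{idom,ring_char_0} fps"
  assumes "F\<^sup>2 = G\<^sup>2" "F $ 0 = 1" "G $ 0 = 1"
  shows "F = G"
proof -
  have "F = G \<or> F = - G" using assms(1) by (simp add: power2_eq_iff)
  moreover have "F \<noteq> - G"
  proof
    assume "F = - G"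
    then have "F $ 0 = - (G $ 0)" by simp
    then show False using assms by (simp add: eq_neg_iff_add_eq_0)
  qed
  ultimately show ?thesis by blast
qed

text \<open>The product over pairs is a square root of a full double product, up to its diagonal. The latter
  factors because all factors are periodic in the exponent of \<open>w\<close>. The constant terms fix the sign of
  the root.\<close>

lemma prod_side_root_of_unity:
  fixes w :: "'a::field_char_0"
  assumes w: "w ^ (2 * t) = 1" "\<And>i j. i < 2 * t \<Longrightarrow> j < 2 * t \<Longrightarrow> w ^ i = w ^ j \<Longrightarrow> i = j" and t: "t > 0"
  shows "prod_side t (\<lambda>i. w ^ Suc i) * qpoch_inf fps_X fps_X * qpoch_inf (fps_X\<^sup>2) (fps_X\<^sup>2) ^ (t - 1) =
    qpoch_inf (fps_X ^ (4 * t)) (fps_X ^ (4 * t)) ^ t * qpoch_inf (- fps_X) (fps_X\<^sup>2)"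
proof -
  have w0: "w \<noteq> 0" using w(1) t by (metis mult_pos_pos zero_less_numeral zero_neq_one zero_power)
  define E where "E r k = qpoch_inf (fps_X ^ r * fps_const (w powi k)) (fps_X ^ r)" for r :: nat and k :: int
  have E0: "E r k $ 0 = 1" if "r > 0" for r k unfolding E_def using that by (intro qpoch_nth_0) auto
  have Enz: "E r k \<noteq> 0" if "r > 0" for r k using E0[OF that, of k] by auto
  have per: "E r (k + 2 * int t) = E r k" for r k
  proof -
    have "w powi (k + 2 * int t) = w powi k * w ^ (2 * t)"
      using power_int_add[of w k "int (2 * t)"] power_int_of_nat[of w "2 * t"] w0 by simp
    then show ?thesis by (simp add: E_def w(1))
  qed
  have full: "(\<Prod>u<2*t. E r (int u)) = qpoch_inf (fps_X ^ (r * (2 * t))) (fps_X ^ (r * (2 * t)))" if "r > 0" for r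
    unfolding E_def power_int_of_nat by (rule prod_qpoch_root_of_unity) (use w t that in auto)
  define S where "S = (qpoch_inf (fps_X ^ (2 * t)) (fps_X ^ (2 * t)) :: 'a fps)"
  define P where "P = (qpoch_inf (fps_X ^ (4 * t)) (fps_X ^ (4 * t)) :: 'a fps)"
  have full1: "(\<Prod>u<2*t. E 1 (int u)) = S" using full[of 1] by (simp add: S_def)
  have full2: "(\<Prod>u<2*t. E 2 (int u)) = P" using full[of 2] by (simp add: P_def)
  have P0: "P $ 0 = 1" and S0: "S $ 0 = 1" unfolding P_def S_def using t by (auto intro!: qpoch_nth_0)
  have Pnz: "P \<noteq> 0" and Snz: "S \<noteq> 0" using P0 S0 by auto
  have wt: "w ^ t = - 1"
  proof -
    have "(w ^ t)\<^sup>2 = 1" using w(1) by (simp add: power_mult[symmetric] mult.commute)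
    moreover have "w ^ t \<noteq> 1" using w(2)[of t 0] t by auto
    ultimately show ?thesis by (simp add: power2_eq_1_iff)
  qed
  have Er0: "E r 0 = qpoch_inf (fps_X ^ r) (fps_X ^ r)" for r by (simp add: E_def)
  have Ert: "E r (int t) = qpoch_inf (- (fps_X ^ r)) (fps_X ^ r)" for r
    unfolding E_def power_int_of_nat wt by (simp flip: fps_const_neg)
  let ?k = "\<lambda>i. int (Suc i)"
  define R1 where "R1 = (\<Prod>i<t. E 1 (?k i) * E 1 (- ?k i))"
  have R1: "R1 * E 1 0 = S * E 1 (int t)"
    using prod_periodic_symmetric[of "E 1" t 0] per full1 by (simp add: R1_def)
  define G where "G i j = E 2 (?k i + ?k j) * E 2 (?k i - ?k j) * E 2 (- ?k i + ?k j) * E 2 (- ?k i - ?k j)" for i j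
  define R2 where "R2 = (\<Prod>(i, j)\<in>pairs t. G i j)"
  have inv: "inverse (w ^ Suc i) = w powi (- ?k i)" for i by (simp only: power_int_minus power_int_of_nat)
  have pow: "w ^ Suc i = w powi (?k i)" for i by (simp only: power_int_of_nat)
  have mul: "w powi a * w powi b = w powi (a + b)" for a b using w0 by (simp add: power_int_add)
  have mul4: "w ^ Suc i * w ^ Suc j = w powi (?k i + ?k j)"
    "w ^ Suc i * inverse (w ^ Suc j) = w powi (?k i - ?k j)"
    "inverse (w ^ Suc i) * w ^ Suc j = w powi (- ?k i + ?k j)"
    "inverse (w ^ Suc i) * inverse (w ^ Suc j) = w powi (- ?k i - ?k j)" for i j
    unfolding inv unfolding pow mul by (rule refl, simp_all)
  have ps: "prod_side t (\<lambda>i. w ^ Suc i) = R1 * R2"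
    unfolding prod_side_def mul4 unfolding inv unfolding pow R1_def R2_def G_def E_def power_one_right ..
  have A: "(\<Prod>j<t. E 2 (a + ?k j) * E 2 (a - ?k j)) * E 2 a = P * E 2 (a + int t)" for a
    using prod_periodic_symmetric[of "E 2" t a] per full2 by simp
  \<comment> \<open>Row i of G runs over \<open>E 2 (a \<plusminus> ?k j)\<close> for a =
    \<open>?k i\<close> and for a = \<open>- ?k i\<close>. Evaluating it by periodicity also takes
    the middle factor \<open>E 2 a\<close>; \<open>?M\<close> collects these factors.\<close>
  let ?M = "\<Prod>i<t. E 2 (?k i) * E 2 (- ?k i)"
  have M: "?M * E 2 0 = P * E 2 (int t)" using A[of 0] by simp
  have M': "(\<Prod>i<t. E 2 (?k i + int t) * E 2 (- ?k i + int t)) * E 2 (int t) = P * E 2 0"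
  proof -
    have 1: "E 2 (int t - ?k i) = E 2 (- ?k i + int t)" "E 2 (int t + ?k i) = E 2 (?k i + int t)" for i
      by (simp_all add: algebra_simps)
    have "int t + int t = 0 + 2 * int t" by simp
    then have 2: "E 2 (int t + int t) = E 2 0" by (simp only: per)
    show ?thesis using A[of "int t"] unfolding 1 2 .
  qed
  have "(\<Prod>i<t. \<Prod>j<t. G i j) * ?M = (\<Prod>i<t. (\<Prod>j<t. G i j) * (E 2 (?k i) * E 2 (- ?k i)))"
    by (simp only: prod.distrib)
  also have "\<dots> = (\<Prod>i<t. P * P * (E 2 (?k i + int t) * E 2 (- ?k i + int t)))"
  proof (rule prod.cong[OF refl])
    fix i
    have "(\<Prod>j<t. G i j) * (E 2 (?k i) * E 2 (- ?k i)) =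
      ((\<Prod>j<t. E 2 (?k i + ?k j) * E 2 (?k i - ?k j)) * E 2 (?k i)) *
      ((\<Prod>j<t. E 2 (- ?k i + ?k j) * E 2 (- ?k i - ?k j)) * E 2 (- ?k i))"
      unfolding G_def prod.distrib by (simp only: mult_ac)
    then show "(\<Prod>j<t. G i j) * (E 2 (?k i) * E 2 (- ?k i)) = P * P * (E 2 (?k i + int t) * E 2 (- ?k i + int t))"
      unfolding A by (simp only: mult_ac)
  qed
  also have "\<dots> = (P ^ t)\<^sup>2 * (\<Prod>i<t. E 2 (?k i + int t) * E 2 (- ?k i + int t))"
    by (simp add: prod.distrib power2_eq_square power_mult_distrib)
  finally have GM: "(\<Prod>i<t. \<Prod>j<t. G i j) * ?M = (P ^ t)\<^sup>2 * (\<Prod>i<t. E 2 (?k i + int t) * E 2 (- ?k i + int t))" .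
  \<comment> \<open>The auxiliary \<open>?M\<close> and its translate by t are now eliminated
    through their own evaluations \<open>M\<close> and \<open>M'\<close>.\<close>
  have "(\<Prod>i<t. \<Prod>j<t. G i j) * (E 2 (int t))\<^sup>2 * P = (\<Prod>i<t. \<Prod>j<t. G i j) * ?M * E 2 0 * E 2 (int t)"
  proof -
    have "(\<Prod>i<t. \<Prod>j<t. G i j) * (E 2 (int t))\<^sup>2 * P = (\<Prod>i<t. \<Prod>j<t. G i j) * (P * E 2 (int t)) * E 2 (int t)"
      by (simp only: power2_eq_square mult_ac)
    then show ?thesis unfolding M[symmetric] by (simp only: mult_ac)
  qed
  also have "\<dots> = (P ^ t)\<^sup>2 * E 2 0 * ((\<Prod>i<t. E 2 (?k i + int t) * E 2 (- ?k i + int t)) * E 2 (int t))"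
    unfolding GM by (simp only: mult_ac)
  also have "\<dots> = (P ^ t)\<^sup>2 * (E 2 0)\<^sup>2 * P"
    unfolding M' by (simp only: power2_eq_square mult_ac)
  finally have GG: "(\<Prod>i<t. \<Prod>j<t. G i j) * (E 2 (int t))\<^sup>2 = (P ^ t)\<^sup>2 * (E 2 0)\<^sup>2" using Pnz by simp
  \<comment> \<open>The diagonal entries of G involve even exponents of w only, and w^2 is a
    primitive t-th root of unity.\<close>
  have even1: "(\<Prod>i<t. E 2 (2 * (a + int i))) = S" for a
  proof -
    have w2: "(w\<^sup>2) ^ t = 1" "i = j" if "i < t" "j < t" "(w\<^sup>2) ^ i = (w\<^sup>2) ^ j" for i j
      using w(1) w(2)[of "2 * i" "2 * j"] that by (auto simp: power_mult)
    have "(\<Prod>i<t. E 2 (2 * (a + int i))) = (\<Prod>i<t. E 2 (2 * int i))"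
    proof -
      have "2 * (k + int t) = 2 * k + 2 * int t" for k by simp
      then show ?thesis
        using prod_periodic_window[of "\<lambda>k. E 2 (2 * k)" t a] by (simp only: per)
    qed
    also have "\<dots> = (\<Prod>i<t. qpoch_pow 2 ((w\<^sup>2) ^ i))"
    proof -
      have "w powi (2 * int i) = (w\<^sup>2) ^ i" for i
        using power_int_of_nat[of w "2 * i"] by (simp add: power_mult)
      then show ?thesis by (simp add: E_def)
    qed
    also have "\<dots> = S"
      unfolding S_def by (rule prod_qpoch_root_of_unity) (use w2 w(1) t in \<open>auto simp: power_mult\<close>)
    finally show ?thesis .
  qed
  have "(\<Prod>i<t. G i i) = S\<^sup>2 * (E 2 0) ^ (2 * t)"
  proof -
    have "(\<Prod>i<t. E 2 (?k i + ?k i)) = S" using even1[of 1] by (simp add: algebra_simps)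
    moreover have "(\<Prod>i<t. E 2 (- ?k i - ?k i)) = S"
    proof -
      have "(\<Prod>i<t. E 2 (- ?k i - ?k i)) = (\<Prod>i<t. E 2 (2 * (- int t + int i)))"
        by (subst prod.nat_diff_reindex[symmetric]) (auto intro!: prod.cong simp: algebra_simps of_nat_diff)
      then show ?thesis by (simp only: even1)
    qed
    ultimately show ?thesis
      unfolding G_def prod.distrib by (simp add: power2_eq_square power_even_eq power_mult_distrib)
  qed
  moreover have "(\<Prod>i<t. \<Prod>j<t. G i j) = R2\<^sup>2 * (\<Prod>i<t. G i i)"
  proof -
    have "G j i = G i j" for i j by (simp add: G_def algebra_simps)
    then show ?thesis unfolding R2_def prod.square_split by (simp add: power2_eq_square prod.distrib case_prod_unfold)
  qed
  ultimately have "R2\<^sup>2 * (S\<^sup>2 * (E 2 0) ^ (2 * t)) * (E 2 (int t))\<^sup>2 = (P ^ t)\<^sup>2 * (E 2 0)\<^sup>2"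
    using GG by simp
  moreover have "(E 2 0) ^ (2 * t) = ((E 2 0) ^ (t - 1))\<^sup>2 * (E 2 0)\<^sup>2"
  proof -
    have "2 * t = (t - 1) * 2 + 2" using t by simp
    then show ?thesis by (metis power_add power_mult)
  qed
  ultimately have "(R2 * S * E 2 0 ^ (t - 1) * E 2 (int t))\<^sup>2 * (E 2 0)\<^sup>2 = (P ^ t)\<^sup>2 * (E 2 0)\<^sup>2"
    by (simp add: power_mult_distrib mult_ac)
  then have sq: "(R2 * S * E 2 0 ^ (t - 1) * E 2 (int t))\<^sup>2 = (P ^ t)\<^sup>2"
    using Enz[of 2 0] by simp
  have R20: "R2 $ 0 = 1" by (simp add: R2_def G_def case_prod_unfold E0 fps_prod_nth_0)
  have R2: "R2 * S * E 2 0 ^ (t - 1) * E 2 (int t) = P ^ t"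
    by (rule fps_eq_of_square_eq[OF sq]) (simp_all add: fps_power_zeroth E0 P0 S0 R20)
  \<comment> \<open>Odd and even powers of q in (- q; q) are separated; the even part (- q^2; q^2)
    is \<open>E 2 (int t)\<close>.\<close>
  have X: "E 1 (int t) = qpoch_inf (- fps_X) (fps_X\<^sup>2) * E 2 (int t)"
  proof -
    have "qpoch_inf (- fps_X) fps_X = (\<Prod>i<2. qpoch_inf (- fps_X * fps_X ^ i) (fps_X\<^sup>2) :: 'a fps)"
      by (rule qpoch_split) auto
    then show ?thesis by (simp add: Ert numeral_2_eq_2)
  qed
  have "(R1 * R2 * E 1 0 * E 2 0 ^ (t - 1)) * (S * E 2 (int t)) =
      (R1 * E 1 0) * (R2 * S * E 2 0 ^ (t - 1) * E 2 (int t))" by (simp only: mult_ac)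
  also have "\<dots> = (P ^ t * qpoch_inf (- fps_X) (fps_X\<^sup>2)) * (S * E 2 (int t))"
    unfolding R1 R2 X by (simp only: mult_ac)
  finally have "R1 * R2 * E 1 0 * E 2 0 ^ (t - 1) = P ^ t * qpoch_inf (- fps_X) (fps_X\<^sup>2)"
    using Snz Enz[of 2 "int t"] by simp
  then show ?thesis unfolding ps P_def Er0 by simp
qed

section \<open>The denominator identity\<close>

lemma qpoch_nth:
  fixes a p :: "'a::field fps"
  assumes "a $ 0 = 0" "p $ 0 = 0"
  shows "qpoch_inf a p $ n = (\<Prod>j<n. 1 - a * p ^ j) $ n"
proof -
  have "\<forall>\<^sub>F N in sequentially. (\<Prod>j<N. 1 - a * p ^ j) $ n = qpoch_inf a p $ n"
    using tendsto_qpoch[OF assms] by (auto simp: tendsto_fps_iff)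
  then obtain N where "\<And>M. M \<ge> N \<Longrightarrow> (\<Prod>j<M. 1 - a * p ^ j) $ n = qpoch_inf a p $ n"
    by (auto simp: eventually_sequentially)
  from this[of "max N n"] show ?thesis
    using partial_qpoch_nth[OF assms, of n "max N n"] by simp
qed

text \<open>The Euler product (q^r; q^r) with integer coefficients. As \<open>qpoch_inf\<close>
  lives over a field, coefficient n is read off the n-th partial product, where it already has its
  final value.\<close>

definition euler_fps :: "nat \<Rightarrow> int fps" where
  "euler_fps r = Abs_fps (\<lambda>n. (\<Prod>j<n. 1 - fps_X ^ r * (fps_X ^ r) ^ j) $ n)"

lemma int_fps_euler_fps:
  assumes "r > 0"
  shows "int_fps (euler_fps r) = (qpoch_inf (fps_X ^ r) (fps_X ^ r) :: 'a::field fps)"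
proof (rule fps_ext)
  fix n
  have X: "int_fps fps_X = (fps_X :: 'a fps)"
    by (rule fps_ext) (simp add: int_fps_def)
  have "int_fps (euler_fps r) $ n = (int_fps (\<Prod>j<n. 1 - fps_X ^ r * (fps_X ^ r) ^ j) :: 'a fps) $ n"
    by (simp add: int_fps_def euler_fps_def)
  also have "int_fps (\<Prod>j<n. 1 - fps_X ^ r * (fps_X ^ r) ^ j) = (\<Prod>j<n. 1 - fps_X ^ r * (fps_X ^ r) ^ j :: 'a fps)"
    by (simp add: int_fps.hom_prod int_fps.hom_minus int_fps.hom_mult int_fps.hom_power X)
  also have "\<dots> $ n = qpoch_inf (fps_X ^ r) (fps_X ^ r) $ n"
    using assms by (subst qpoch_nth) auto
  finally show "int_fps (euler_fps r) $ n = (qpoch_inf (fps_X ^ r) (fps_X ^ r) :: 'a fps) $ n" .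
qed

lemma int_fps_nth [simp]: "int_fps F $ n = of_int (F $ n)"
  by (simp add: int_fps_def)

lemma int_fps_const: "int_fps (fps_const c) = fps_const (of_int c)"
  by (rule fps_ext) (simp add: int_fps_def)

lemma fsum_const_mult: "fsum I w (\<lambda>i. c * a i) = fps_const c * fsum I w a"
  by (rule fps_ext) (simp add: fsum_nth sum_distrib_left)

text \<open>The part of degree 0 in q: the denominator formula of type B, up to the integer
  \<open>c $ 0\<close>.\<close>

lemma theta_identity_nth_0:
  fixes x :: "nat \<Rightarrow> 'a::field"
  assumes c: "theta_prod t = scalar c * phi_det t" and x: "\<And>i. i < t \<Longrightarrow> x (Suc i) \<noteq> 0"
  shows "weyl_num t (\<lambda>i. x (Suc i)) = of_int (c $ 0) * so_det t (\<lambda>_. 0) x"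
proof -
  have q: "qpoch_inf fps_X fps_X $ 0 = (1 :: 'a)" "qpoch_inf (fps_X\<^sup>2) (fps_X\<^sup>2) $ 0 = (1 :: 'a)"
    by (rule qpoch_nth_0; simp)+
  have "fps_const (weyl_num t (\<lambda>i. x (Suc i))) * prod_side t (\<lambda>i. x (Suc i)) *
      qpoch_inf fps_X fps_X ^ t * qpoch_inf (fps_X\<^sup>2) (fps_X\<^sup>2) ^ (2 * card (pairs t)) =
    int_fps c * lpf_eval t (\<lambda>i. x (Suc i)) (phi_det t)"
    using theta_identity_up_to_scalar[of t c x, OF c x] lpf_eval_phi_det[of t x, OF x] by simp
  from arg_cong[OF this, of "\<lambda>F. F $ 0"] show ?thesis
    by (simp add: prod_side_nth_0 q fps_power_zeroth lpf_eval_phi_det_nth_0[of t x, OF x])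
qed

lemma weyl_num_nonzero:
  assumes "\<And>i. i < t \<Longrightarrow> y i \<noteq> 0" "\<And>i. i < t \<Longrightarrow> y i \<noteq> 1"
    "\<And>i j. i < j \<Longrightarrow> j < t \<Longrightarrow> y i * y j \<noteq> 1" "\<And>i j. i < j \<Longrightarrow> j < t \<Longrightarrow> y i \<noteq> y j"
  shows "weyl_num t y \<noteq> (0 :: 'a::field)"
proof -
  have "1 - y i * inverse (y j) \<noteq> 0" if "(i, j) \<in> pairs t" for i j
    using assms(1)[of j] assms(4)[of i j] that by (auto simp: pairs_def field_simps)
  moreover have "1 - y i * y j \<noteq> 0" "inverse (y i) \<noteq> 0" if "(i, j) \<in> pairs t" for i j
    using assms(3)[of i j] assms(1)[of i] that by (auto simp: pairs_def)
  ultimately show ?thesis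
    using assms(2) by (auto simp: weyl_num_def)
qed

text \<open>Modulo 2 t no exponent depends on n.\<close>

lemma so_det_root_of_unity:
  fixes x :: "nat \<Rightarrow> 'a::field"
  assumes "\<And>i. i < t \<Longrightarrow> x (Suc i) ^ (2 * t) = 1" "t > 0"
  shows "so_det t (\<lambda>j. int (2 * t) * n (j - 1)) x = so_det t (\<lambda>_. 0) x"
proof -
  have x0: "x (Suc i) \<noteq> 0" if "i < t" for i
    using assms(1)[OF that] assms(2) by (metis mult_pos_pos zero_less_numeral zero_neq_one zero_power)
  have p: "x (Suc i) powi (int (2 * t) * m) = 1" if "i < t" for i m
    using assms(1)[OF that] by (simp only: power_int_mult power_int_of_nat power_int_1_left)
  have a: "x (Suc i) powi (int (2 * t) * m + b) = x (Suc i) powi b" if "i < t" for i m b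
    using p[OF that, of m] x0[OF that] by (simp add: power_int_add)
  have "x (Suc i) powi (int (2 * t) * m + int t - int j + 1) - x (Suc i) powi (- (int (2 * t) * m + int t - int j)) =
        x (Suc i) powi (0 + int t - int j + 1) - x (Suc i) powi (- (0 + int t - int j))" if "i < t" for i j m
    using a[OF that, of m "int t - int j + 1"] a[OF that, of "- m" "- (int t - int j)"]
    by (simp add: algebra_simps)
  then show ?thesis
    unfolding so_det_def Let_def by (intro arg_cong[of _ _ Determinant.det] cong_mat refl)
      (simp only: prod.case Suc_eq_plus1[symmetric])
qed

lemma le_two_card_pairs: "t - 1 \<le> 2 * card (pairs t)"
proof (cases "t = 0")
  case False
  have "card {p \<in> pairs t. 0 = fst p \<or> 0 = snd p} \<le> card (pairs t)"
    by (rule card_mono) auto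
  then show ?thesis using card_pairs_containing[of 0 t] False by simp
qed simp

text \<open>Over the complex numbers the sum of determinants becomes a constant times the product of
  theta constants, which \<open>prod_side_root_of_unity\<close> also extracts from the product side.
  As c has integer coefficients, this comparison determines it up to \<open>c $ 0\<close>. By
  \<open>le_two_card_pairs\<close> the subtraction in the exponent is not truncated.\<close>

lemma scalar_determined:
  assumes c: "theta_prod t = scalar c * phi_det t" and t: "t > 0"
  shows "c = fps_const (c $ 0) * euler_fps 1 ^ (t - 1) * euler_fps 2 ^ (2 * card (pairs t) - (t - 1))"
    and "c $ 0 \<noteq> 0"
proof -
  define w where "w = cis (pi / real t)"
  have wp: "w ^ n = cis (real n * (pi / real t))" for n by (simp add: w_def Complex.DeMoivre)
  have w1: "w ^ (2 * t) = 1" using t by (simp add: wp)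
  have wn: "w ^ n \<noteq> 1" if "0 < n" "n < 2 * t" for n
  proof
    assume "w ^ n = 1"
    then have "cos (real n * (pi / real t)) = 1" by (simp add: wp complex_eq_iff)
    then obtain m :: int where m: "real n * (pi / real t) = of_int m * 2 * pi"
      by (auto simp: cos_one_2pi_int)
    then have "real n = of_int m * 2 * real t" using t by (simp add: field_simps)
    then have "of_int (int n) = (of_int (m * (2 * int t)) :: real)" by simp
    then have n: "int n = m * (2 * int t)" by (simp only: of_int_eq_iff)
    have "0 < m"
    proof (rule ccontr)
      assume "\<not> 0 < m"
      then have "m * (2 * int t) \<le> 0" by (intro mult_nonpos_nonneg) auto
      then show False using n that by linarith
    qed
    then have "1 * (2 * int t) \<le> m * (2 * int t)" by (intro mult_right_mono) auto
    then show False using n that by linarith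
  qed
  have w0: "w \<noteq> 0" by (simp add: w_def)
  have w2: "i = j" if "i < 2 * t" "j < 2 * t" "w ^ i = w ^ j" for i j
  proof (rule ccontr)
    assume "i \<noteq> j"
    have *: False if "i < j" "j < 2 * t" "w ^ i = w ^ j" for i j
    proof -
      have "i + (j - i) = j" using that(1) by simp
      then have "w ^ j = w ^ i * w ^ (j - i)" by (metis power_add)
      then have "w ^ (j - i) = 1" using that(3) w0 by simp
      then show False using wn[of "j - i"] that by auto
    qed
    show False using *[of i j] *[of j i] that \<open>i \<noteq> j\<close> by (cases "i < j") auto
  qed
  define x where "x i = w ^ i" for i
  have x0: "x (Suc i) \<noteq> 0" for i using w0 by (simp add: x_def)
  let ?Q = "qpoch_inf fps_X fps_X :: complex fps" and ?T = "qpoch_inf (fps_X\<^sup>2) (fps_X\<^sup>2) :: complex fps"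
  let ?D = "so_det t (\<lambda>_. 0) x" and ?W = "weyl_num t (\<lambda>i. x (Suc i))" and ?R = "prod_side t (\<lambda>i. x (Suc i))"
  have W: "?W = of_int (c $ 0) * ?D"
    by (rule theta_identity_nth_0[of t c x, OF c x0])
  \<comment> \<open>Only w, ..., w^t are used, so the exponents i + j with i < j stay below 2 t and
    no product of two of these points is 1.\<close>
  have "?W \<noteq> 0"
  proof (rule weyl_num_nonzero)
    fix i j :: nat
    show "x (Suc i) \<noteq> 0" by (rule x0)
    show "x (Suc i) \<noteq> 1" if "i < t" using wn[of "Suc i"] that by (simp add: x_def)
    show "x (Suc i) * x (Suc j) \<noteq> 1" if "i < j" "j < t"
      using wn[of "Suc i + Suc j"] that unfolding x_def power_add[symmetric] by simp
    show "x (Suc i) \<noteq> x (Suc j)" if "i < j" "j < t"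
      using w2[of "Suc i" "Suc j"] that by (auto simp: x_def)
  qed
  \<comment> \<open>The product form does not vanish at this point, hence neither
    \<open>c $ 0\<close> nor the determinant does.\<close>
  then have D: "?D \<noteq> 0" and c0: "c $ 0 \<noteq> 0" using W by auto
  show "c $ 0 \<noteq> 0" by (rule c0)
  define A where "A = (\<Prod>j<t. fsum UNIV (phi_exp t (t - j)) (\<lambda>_. 1 :: complex))"
  have RA: "?R * ?Q * ?T ^ (t - 1) = A"
    unfolding x_def A_def prod_theta_constants[OF t] by (rule prod_side_root_of_unity[OF w1 w2 t])
  have "fsum (int_vecs t) (phi_wt t) (\<lambda>n. so_det t (\<lambda>j. int (2 * t) * n (j - 1)) x) =
     fsum (int_vecs t) (phi_wt t) (\<lambda>n. ?D * 1)"
  proof (rule fsum_cong[OF refl])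
    fix n :: "nat \<Rightarrow> int"
    have "x (Suc i) ^ (2 * t) = 1" for i
    proof -
      have "x (Suc i) ^ (2 * t) = (w ^ (2 * t)) ^ Suc i"
        unfolding x_def power_mult[symmetric] by (simp only: mult.commute)
      then show ?thesis by (simp add: w1)
    qed
    then show "so_det t (\<lambda>j. int (2 * t) * n (j - 1)) x = ?D * 1"
      using so_det_root_of_unity[of t x n] t by simp
  qed
  also have "\<dots> = fps_const ?D * fsum (int_vecs t) (phi_wt t) (\<lambda>n. 1)"
    by (rule fsum_const_mult)
  also have "fsum (int_vecs t) (phi_wt t) (\<lambda>n. 1) = A"
  proof -
    have ff: "fin_fibres UNIV (phi_exp t (t - j))" if "j \<in> {0..<t}" for j
      using fin_fibres_phi_wt that by simp
    show ?thesis
      unfolding A_def lessThan_atLeast0 phi_wt_def[abs_def]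
      using conjunct2[OF fsum_prod[of "{0..<t}" "\<lambda>_. UNIV" _ "\<lambda>_ _. 1 :: complex", OF _ ff]] by simp
  qed
  finally have Phi: "fsum (int_vecs t) (phi_wt t) (\<lambda>n. so_det t (\<lambda>j. int (2 * t) * n (j - 1)) x) =
     fps_const ?D * A" .
  have Rnz: "?R \<noteq> 0" using prod_side_nth_0[of t "\<lambda>i. x (Suc i)"] by auto
  have Qnz: "?Q \<noteq> 0" "?T \<noteq> 0" by (rule qpoch_nonzero; simp)+
  have e1: "?Q ^ t = ?Q ^ (t - 1) * ?Q" using t by (metis Suc_diff_1 power_Suc2)
  have e2: "?T ^ (2 * card (pairs t)) = ?T ^ (2 * card (pairs t) - (t - 1)) * ?T ^ (t - 1)"
    using le_two_card_pairs[of t] by (simp add: power_add[symmetric])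
  have "fps_const ?W * ?R * ?Q ^ t * ?T ^ (2 * card (pairs t)) = int_fps c * (fps_const ?D * A)"
    using theta_identity_up_to_scalar[of t c x, OF c x0] unfolding Phi .
  then have "fps_const ?D * A * (fps_const (of_int (c $ 0)) * ?Q ^ (t - 1) * ?T ^ (2 * card (pairs t) - (t - 1))) =
      fps_const ?D * A * int_fps c"
    unfolding W e1 e2 fps_const_mult[symmetric] RA[symmetric] by (simp only: mult_ac)
  moreover have "fps_const ?D * A \<noteq> 0" using D Rnz Qnz unfolding RA[symmetric] by simp
  ultimately have "int_fps c = fps_const (of_int (c $ 0)) * ?Q ^ (t - 1) * ?T ^ (2 * card (pairs t) - (t - 1))"
    by simp
  also have "\<dots> = int_fps (fps_const (c $ 0) * euler_fps 1 ^ (t - 1) * euler_fps 2 ^ (2 * card (pairs t) - (t - 1)))"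
    using int_fps_euler_fps[of 1, where 'a = complex] int_fps_euler_fps[of 2, where 'a = complex]
    by (simp add: int_fps.hom_mult int_fps.hom_power int_fps_const)
  finally show "c = fps_const (c $ 0) * euler_fps 1 ^ (t - 1) * euler_fps 2 ^ (2 * card (pairs t) - (t - 1))"
    by (simp only: int_fps_eq_iff)
qed

text \<open>Both sides carry the same multiple of c, which cancels: \<open>char\<close> keeps
  \<open>c $ 0\<close> nonzero in the field. The part of degree 0 in q replaces the product form of
  the denominator by the determinant \<open>so_det t (\<lambda>_. 0) x\<close>.\<close>

theorem denominator_identity:
  fixes x :: "nat \<Rightarrow> 'a::field"
  assumes t: "t > 0" and x: "\<And>i. i < t \<Longrightarrow> x (Suc i) \<noteq> 0"
    and char: "\<And>c. of_int c = (0 :: 'a) \<Longrightarrow> c = 0"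
    and W: "weyl_num t (\<lambda>i. x (Suc i)) \<noteq> 0"
  shows "so_det t (\<lambda>_. 0) x \<noteq> 0"
    and "fps_const (so_det t (\<lambda>_. 0) x) * (qpoch_inf fps_X fps_X * qpoch_inf (fps_X\<^sup>2) (fps_X\<^sup>2) ^ (t - 1) *
        prod_side t (\<lambda>i. x (Suc i))) =
      fsum (int_vecs t) (phi_wt t) (\<lambda>n. so_det t (\<lambda>j. int (2 * t) * n (j - 1)) x)"
proof -
  obtain c where c: "theta_prod t = scalar c * phi_det t" by (rule theta_prod_eq_scalar_mult_phi_det)
  let ?Q = "qpoch_inf fps_X fps_X :: 'a fps" and ?T = "qpoch_inf (fps_X\<^sup>2) (fps_X\<^sup>2) :: 'a fps"
  let ?D = "so_det t (\<lambda>_. 0) x" and ?R = "prod_side t (\<lambda>i. x (Suc i))" and ?m = "2 * card (pairs t) - (t - 1)"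
  let ?F = "fsum (int_vecs t) (phi_wt t) (\<lambda>n. so_det t (\<lambda>j. int (2 * t) * n (j - 1)) x)"
  have Wc: "weyl_num t (\<lambda>i. x (Suc i)) = of_int (c $ 0) * ?D"
    by (rule theta_identity_nth_0[of t c x, OF c x])
  then show "?D \<noteq> 0" using W by auto
  have "int_fps c = fps_const (of_int (c $ 0)) * ?Q ^ (t - 1) * ?T ^ ?m"
    using int_fps_euler_fps[of 1, where 'a = 'a] int_fps_euler_fps[of 2, where 'a = 'a]
    by (subst scalar_determined(1)[OF c t]) (simp add: int_fps.hom_mult int_fps.hom_power int_fps_const)
  moreover have e1: "?Q ^ t = ?Q ^ (t - 1) * ?Q" using t by (metis Suc_diff_1 power_Suc2)
  moreover have e2: "?T ^ (2 * card (pairs t)) = ?T ^ ?m * ?T ^ (t - 1)"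
    using le_two_card_pairs[of t] by (simp add: power_add[symmetric])
  ultimately have "(fps_const (of_int (c $ 0)) * ?Q ^ (t - 1) * ?T ^ ?m) * (fps_const ?D * (?Q * ?T ^ (t - 1) * ?R)) =
      (fps_const (of_int (c $ 0)) * ?Q ^ (t - 1) * ?T ^ ?m) * ?F"
    using theta_identity_up_to_scalar[of t c x, OF c x] unfolding Wc fps_const_mult[symmetric]
    by (simp only: mult_ac)
  moreover have "fps_const (of_int (c $ 0)) * ?Q ^ (t - 1) * ?T ^ ?m \<noteq> 0"
  proof -
    have "of_int (c $ 0) \<noteq> (0 :: 'a)" using char[of "c $ 0"] scalar_determined(2)[OF c t] by auto
    moreover have "?Q \<noteq> 0" "?T \<noteq> 0" by (rule qpoch_nonzero; simp)+
    ultimately show ?thesis by simp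
  qed
  ultimately show "fps_const ?D * (?Q * ?T ^ (t - 1) * ?R) = ?F"
    by (metis mult_left_cancel)
qed

section \<open>Independence of the variables in the field of fractions\<close>

lemma X_nonzero: "X i \<noteq> 0"
  unfolding X_def by (simp add: Zero_fract_def eq_fract)

lemma X_generic:
  "X i \<noteq> 1" "X i * X j \<noteq> 1" "i \<noteq> j \<Longrightarrow> X i \<noteq> X j"
proof -
  have key: "Poly_Mapping.single (k :: nat \<Rightarrow>\<^sub>0 int) (1 :: int) = Poly_Mapping.single l 1 \<longleftrightarrow> k = l" for k l
    by (metis keys_single one_neq_zero singleton_inject)
  have i: "Poly_Mapping.lookup (Poly_Mapping.single i (1 :: int)) i = 1" for i :: nat by simp
  show "X i \<noteq> 1"
    unfolding X_def One_fract_def using key[of "Poly_Mapping.single i 1" 0] i[of i]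
    by (auto simp: eq_fract single_one)
  show "X i * X j \<noteq> 1"
  proof
    assume "X i * X j = 1"
    then have "Poly_Mapping.single i (1 :: int) + Poly_Mapping.single j 1 = 0"
      unfolding X_def One_fract_def
      using key[of "Poly_Mapping.single i 1 + Poly_Mapping.single j 1" 0]
      by (simp add: eq_fract single_one mult_single)
    then have "Poly_Mapping.lookup (Poly_Mapping.single i (1 :: int) + Poly_Mapping.single j 1) i = 0" by simp
    then show False by (simp add: lookup_add lookup_single when_def split: if_splits)
  qed
  show "X i \<noteq> X j" if "i \<noteq> j"
  proof
    assume "X i = X j"
    then have "Poly_Mapping.single i (1 :: int) = Poly_Mapping.single j 1"
      unfolding X_def using key[of "Poly_Mapping.single i 1" "Poly_Mapping.single j 1"] by (simp add: eq_fract)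
    then show False using that by (metis keys_single one_neq_zero singleton_inject)
  qed
qed

lemma of_int_laurent_fract_eq_0: "of_int c = (0 :: laurent fract) \<Longrightarrow> c = 0"
proof -
  have n: "(of_nat n :: laurent) = Poly_Mapping.single 0 (int n)" for n
  proof (induction n)
    case (Suc n)
    have "(of_nat (Suc n) :: laurent) = Poly_Mapping.single 0 1 + Poly_Mapping.single 0 (int n)"
      using Suc by simp
    also have "\<dots> = Poly_Mapping.single 0 (int (Suc n))"
      by (simp only: single_add[symmetric] of_nat_Suc)
    finally show ?case .
  qed simp
  have "of_nat n = (0 :: laurent fract) \<Longrightarrow> n = 0" for n
  proof -
    assume "of_nat n = (0 :: laurent fract)"
    then have "(of_nat n :: laurent) = 0"
      unfolding of_nat_fract Zero_fract_def by (simp add: eq_fract)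
    then show "n = 0" unfolding n by (metis lookup_single_eq lookup_zero of_nat_eq_0_iff)
  qed
  then show "of_int c = (0 :: laurent fract) \<Longrightarrow> c = 0"
    by (cases c rule: int_cases2) simp_all
qed

section \<open>Beads of self-conjugate partitions\<close>

definition bead :: "nat list \<Rightarrow> nat \<Rightarrow> int" where "bead l i = int (part l i) - int i"

definition bead_set :: "nat list \<Rightarrow> int set" where "bead_set l = bead l ` {1..}"

lemma nat_eq_of_le_iff: "(\<And>j :: nat. 1 \<le> j \<Longrightarrow> j \<le> a \<longleftrightarrow> j \<le> b) \<Longrightarrow> a = b"
proof (rule antisym)
  assume *: "\<And>j :: nat. 1 \<le> j \<Longrightarrow> j \<le> a \<longleftrightarrow> j \<le> b"
  show "a \<le> b" using *[of a] by (cases "a = 0") auto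
  show "b \<le> a" using *[of b] by (cases "b = 0") auto
qed

definition col_length :: "nat list \<Rightarrow> nat \<Rightarrow> nat" where "col_length l j = card {i. (i, j) \<in> diagram l}"

context
  fixes l :: "nat list"
  assumes l: "is_partition l"
begin

lemma part_antimono: "1 \<le> i \<Longrightarrow> i \<le> j \<Longrightarrow> part l j \<le> part l i"
  using l unfolding is_partition_def part_def
  by (cases "i = j") (auto simp: sorted_wrt_iff_nth_less)

lemma part_eq_0_iff: "1 \<le> i \<Longrightarrow> part l i = 0 \<longleftrightarrow> length l < i"
  using l unfolding is_partition_def part_def by (auto simp: in_set_conv_nth)

lemma mem_diagram: "(i, j) \<in> diagram l \<longleftrightarrow> 1 \<le> i \<and> 1 \<le> j \<and> j \<le> part l i"
  using part_eq_0_iff[of i] by (auto simp: diagram_def)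

lemma bead_less: "1 \<le> i \<Longrightarrow> i < j \<Longrightarrow> bead l j < bead l i"
  using part_antimono[of i j] by (simp add: bead_def)

lemma bead_less_iff: "1 \<le> i \<Longrightarrow> 1 \<le> j \<Longrightarrow> bead l j < bead l i \<longleftrightarrow> i < j"
  using bead_less[of i j] bead_less[of j i] by (cases i j rule: linorder_cases) auto

lemma inj_on_bead: "inj_on (bead l) {1..}"
  by (rule inj_onI) (metis atLeast_iff bead_less_iff less_irrefl linorder_cases)

lemma finite_diagram: "finite (diagram l)"
proof (rule finite_subset)
  show "diagram l \<subseteq> {1..length l} \<times> {1..part l 1}"
  proof
    fix x assume "x \<in> diagram l"
    moreover obtain i j where "x = (i, j)" by force
    ultimately show "x \<in> {1..length l} \<times> {1..part l 1}"
      using part_antimono[of 1 i] by (auto simp: diagram_def)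
  qed
qed simp

lemma column_eq:
  assumes "1 \<le> j"
  shows "{i. (i, j) \<in> diagram l} = {1..col_length l j}"
proof -
  let ?S = "{i. (i, j) \<in> diagram l}"
  have "?S \<subseteq> {1..length l}" by (auto simp: diagram_def)
  then have fin: "finite ?S" by (rule finite_subset) simp
  have down: "i \<in> ?S" if "k \<in> ?S" "1 \<le> i" "i \<le> k" for i k
    using that part_antimono[of i k] by (auto simp: mem_diagram)
  show ?thesis
  proof (cases "?S = {}")
    case False
    define m where "m = Max ?S"
    have m: "m \<in> ?S" "\<And>i. i \<in> ?S \<Longrightarrow> i \<le> m"
      using Max_in[OF fin False] Max_ge[OF fin] by (auto simp: m_def)
    have "?S = {1..m}"
    proof (intro equalityI subsetI)
      fix i assume "i \<in> ?S"
      then show "i \<in> {1..m}" using m(2) by (simp add: diagram_def)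
    next
      fix i assume "i \<in> {1..m}"
      then show "i \<in> ?S" using down[OF m(1)] by simp
    qed
    then show ?thesis by (simp add: col_length_def)
  next
    case True
    then show ?thesis by (simp add: col_length_def)
  qed
qed

lemma le_col_length_iff: "1 \<le> i \<Longrightarrow> 1 \<le> j \<Longrightarrow> i \<le> col_length l j \<longleftrightarrow> j \<le> part l i"
  using column_eq[of j] by (auto simp: mem_diagram set_eq_iff)

lemma part_1: "part l 1 \<le> j \<Longrightarrow> col_length l (Suc j) = 0"
  using le_col_length_iff[of 1 "Suc j"] by auto

lemma conjugate_eq_iff: "conjugate l = l \<longleftrightarrow> (\<forall>j\<ge>1. col_length l j = part l j)"
proof
  assume eq: "conjugate l = l"
  then have len: "length l = part l 1"
    unfolding conjugate_def by (metis One_nat_def diff_Suc_1 length_map length_upt)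
  show "\<forall>j\<ge>1. col_length l j = part l j"
  proof (intro allI impI)
    fix j :: nat assume j: "1 \<le> j"
    show "col_length l j = part l j"
    proof (cases "j \<le> length l")
      case True
      have "conjugate l ! (j - 1) = col_length l j"
      proof -
        have "[1..<Suc (part l 1)] ! (j - 1) = j" using True j len by (subst nth_upt) auto
        then show ?thesis
          unfolding conjugate_def using True j len by (subst nth_map) (auto simp: col_length_def)
      qed
      then show ?thesis using eq True j by (simp add: part_def)
    next
      case False
      then have "col_length l j = 0" "part l j = 0"
        using part_1[of "j - 1"] part_eq_0_iff[OF j] len j by auto
      then show ?thesis by simp
    qed
  qed
next
  assume eq: "\<forall>j\<ge>1. col_length l j = part l j"
  have "j \<le> length l \<longleftrightarrow> j \<le> part l 1" if "1 \<le> j" for j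
  proof -
    have "col_length l j = part l j" using eq that by blast
    moreover have "part l j = 0 \<longleftrightarrow> length l < j" by (rule part_eq_0_iff[OF that])
    moreover have "1 \<le> col_length l j \<longleftrightarrow> j \<le> part l 1" by (rule le_col_length_iff[OF order_refl that])
    ultimately show ?thesis by linarith
  qed
  then have len: "length l = part l 1" by (rule nat_eq_of_le_iff)
  show "conjugate l = l"
  proof (rule nth_equalityI)
    show lenc: "length (conjugate l) = length l" unfolding conjugate_def len by simp
    fix i assume "i < length (conjugate l)"
    then have i: "i < length l" unfolding lenc .
    have "[1..<Suc (part l 1)] ! i = Suc i" using i len by (subst nth_upt) auto
    then have "conjugate l ! i = col_length l (Suc i)"
      unfolding conjugate_def using i len by (subst nth_map) (auto simp: col_length_def)
    also have "\<dots> = part l (Suc i)" using eq by simp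
    also have "\<dots> = l ! i" using i by (simp add: part_def)
    finally show "conjugate l ! i = l ! i" .
  qed
qed

text \<open>The vertical steps of the border carry the indices of the beads, and the horizontal step
  below column j carries j - 1 - \<open>col_length l j\<close>; together they use every integer
  once.\<close>

lemma not_bead_iff: "k \<notin> bead_set l \<longleftrightarrow> (\<exists>j\<ge>1. k = int j - 1 - int (col_length l j))"
proof
  assume k: "k \<notin> bead_set l"
  \<comment> \<open>Row i will be the first whose bead lies to the left of k. The gap k then belongs
    to column j = k + i, which has exactly i - 1 boxes.\<close>
  define P where "P i \<longleftrightarrow> i \<ge> 1 \<and> bead l i < k" for i
  have "P (length l + nat \<bar>k\<bar> + 1)" by (auto simp: P_def bead_def part_def)
  then have ex: "\<exists>i. P i" ..
  define i where "i = (LEAST i. P i)"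
  have i: "1 \<le> i" "bead l i < k" using LeastI_ex[OF ex] by (auto simp: i_def P_def)
  have prev: "k < bead l (i - 1)" if "i \<noteq> 1"
  proof -
    have "\<not> P (i - 1)" using i(1) unfolding i_def by (intro not_less_Least) (auto simp: i_def[symmetric])
    then have "k \<le> bead l (i - 1)" using that i by (auto simp: P_def)
    moreover have "bead l (i - 1) \<in> bead_set l" using that i by (auto simp: bead_set_def)
    ultimately show ?thesis using k by (metis order_less_le)
  qed
  define j where "j = nat (k + int i)"
  have "k + int i > int (part l i)" using i by (simp add: bead_def)
  then have j: "1 \<le> j" "int j = k + int i" "part l i < j" by (auto simp: j_def)
  have "col_length l j = i - 1"
  proof (rule antisym)
    have "\<not> i \<le> col_length l j" using le_col_length_iff[OF i(1) j(1)] j(3) by simp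
    then show "col_length l j \<le> i - 1" by simp
    show "i - 1 \<le> col_length l j"
    proof (cases "i = 1")
      case False
      then have "1 \<le> i - 1" using i by simp
      moreover have "j \<le> part l (i - 1)" using prev[OF False] i j by (simp add: bead_def of_nat_diff)
      ultimately show ?thesis using le_col_length_iff[of "i - 1" j] j by simp
    qed simp
  qed
  then have "k = int j - 1 - int (col_length l j)" using i j by (simp add: of_nat_diff)
  then show "\<exists>j\<ge>1. k = int j - 1 - int (col_length l j)" using j by blast
next
  assume "\<exists>j\<ge>1. k = int j - 1 - int (col_length l j)"
  then obtain j where j: "1 \<le> j" "k = int j - 1 - int (col_length l j)" by blast
  have "bead l i \<noteq> k" if i: "1 \<le> i" for i
    using le_col_length_iff[OF i j(1)] j(2) by (cases "i \<le> col_length l j") (auto simp: bead_def)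
  then show "k \<notin> bead_set l" by (auto simp: bead_set_def)
qed

end

lemma strict_mono_range_unique:
  fixes f g :: "nat \<Rightarrow> int"
  assumes "strict_mono f" "strict_mono g" "range f = range g"
  shows "f = g"
proof
  fix n show "f n = g n"
  proof (induction n rule: less_induct)
    case (less n)
    have *: "b n \<le> a n" if a: "strict_mono a" and b: "strict_mono b" and r: "range a = range b" and e: "\<And>k. k < n \<Longrightarrow> a k = b k"
      for a b :: "nat \<Rightarrow> int"
    proof -
      obtain m where m: "a n = b m" using r by (metis rangeE rangeI)
      have "n \<le> m"
      proof (rule ccontr)
        assume "\<not> n \<le> m"
        then have "a m = a n" using e[of m] m by simp
        then show False using a \<open>\<not> n \<le> m\<close> by (simp add: strict_mono_eq)
      qed
      then show ?thesis using m b by (simp add: strict_mono_less_eq)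
    qed
    show ?case using *[OF assms] *[OF assms(2,1) assms(3)[symmetric]] less by (simp add: antisym)
  qed
qed

lemma strict_mono_beads: "is_partition l \<Longrightarrow> strict_mono (\<lambda>n. - bead l (Suc n))"
  by (rule strict_monoI) (simp add: bead_less)

lemma range_Suc_eq: "range (\<lambda>n. f (Suc n)) = f ` {1..}"
proof -
  have "{1..} = range Suc" by (auto simp: image_iff Suc_le_eq gr0_conv_Suc)
  then show ?thesis by (simp only: image_image)
qed

lemma bead_set_inj:
  assumes "is_partition l" "is_partition l'" "bead_set l = bead_set l'"
  shows "l = l'"
proof -
  have "range (\<lambda>n. - bead l (Suc n)) = uminus ` bead_set l" for l
    unfolding bead_set_def range_Suc_eq[of "\<lambda>n. - bead l n"] image_image ..
  then have "(\<lambda>n. - bead l (Suc n)) = (\<lambda>n. - bead l' (Suc n))"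
    using assms by (intro strict_mono_range_unique strict_mono_beads) auto
  then have p: "part l i = part l' i" if "1 \<le> i" for i
    using that by (cases i) (auto simp: bead_def fun_eq_iff)
  have "i \<le> length l \<longleftrightarrow> i \<le> length l'" if "1 \<le> i" for i
    using part_eq_0_iff[OF assms(1) that] part_eq_0_iff[OF assms(2) that] p[OF that] by auto
  then have len: "length l = length l'" by (rule nat_eq_of_le_iff)
  show ?thesis
  proof (rule nth_equalityI[OF len])
    fix i assume "i < length l"
    then show "l ! i = l' ! i" using p[of "Suc i"] len by (simp add: part_def)
  qed
qed

text \<open>By \<open>not_bead_iff\<close> the gaps of l are the images under
  \<open>k \<mapsto> - 1 - k\<close> of the beads of its conjugate. Conversely, increasing
  enumerations with the same range agree, which recovers the parts from the sets.\<close>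

lemma self_conjugate_iff_bead_set:
  assumes l: "is_partition l"
  shows "conjugate l = l \<longleftrightarrow> (\<forall>k. k \<in> bead_set l \<longleftrightarrow> - 1 - k \<notin> bead_set l)"
proof
  assume "conjugate l = l"
  then have eq: "col_length l j = part l j" if "j \<ge> 1" for j using conjugate_eq_iff[OF l] that by blast
  have "k \<notin> bead_set l \<longleftrightarrow> - 1 - k \<in> bead_set l" for k
    unfolding not_bead_iff[OF l] using eq by (auto simp: bead_set_def bead_def image_iff)
  then show "\<forall>k. k \<in> bead_set l \<longleftrightarrow> - 1 - k \<notin> bead_set l" by blast
next
  assume sym: "\<forall>k. k \<in> bead_set l \<longleftrightarrow> - 1 - k \<notin> bead_set l"
  let ?c = "\<lambda>j. int j - 1 - int (col_length l j)"
  have mono: "strict_mono (\<lambda>n. ?c (Suc n))"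
  proof (rule strict_monoI)
    fix m n :: nat assume "m < n"
    then have "col_length l (Suc n) \<le> col_length l (Suc m)"
      using le_col_length_iff[OF l, of "col_length l (Suc n)" "Suc n"]
        le_col_length_iff[OF l, of "col_length l (Suc n)" "Suc m"]
      by (cases "col_length l (Suc n) = 0") auto
    then show "?c (Suc m) < ?c (Suc n)" using \<open>m < n\<close> by simp
  qed
  have mono': "strict_mono (\<lambda>n. - 1 - bead l (Suc n))"
    by (rule strict_monoI) (simp add: bead_less[OF l])
  have "range (\<lambda>n. - 1 - bead l (Suc n)) = range (\<lambda>n. ?c (Suc n))"
  proof -
    have "k \<in> (\<lambda>i. - 1 - bead l i) ` {1..} \<longleftrightarrow> k \<in> ?c ` {1..}" for k
    proof -
      have "k \<in> (\<lambda>i. - 1 - bead l i) ` {1..} \<longleftrightarrow> - 1 - k \<in> bead_set l"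
      proof -
        have "k = - 1 - b \<longleftrightarrow> - 1 - k = b" for b by auto
        then show ?thesis by (simp add: bead_set_def image_iff)
      qed
      also have "\<dots> \<longleftrightarrow> k \<notin> bead_set l" using sym by blast
      also have "\<dots> \<longleftrightarrow> k \<in> ?c ` {1..}" unfolding not_bead_iff[OF l] by auto
      finally show ?thesis .
    qed
    then show ?thesis unfolding range_Suc_eq[of "\<lambda>i. - 1 - bead l i"] range_Suc_eq[of ?c] by blast
  qed
  from strict_mono_range_unique[OF mono' mono this]
  have "- 1 - bead l (Suc n) = ?c (Suc n)" for n by meson
  then have "col_length l j = part l j" if "j \<ge> 1" for j
    using that by (cases j) (auto simp: bead_def)
  then show "conjugate l = l" using conjugate_eq_iff[OF l] by blast
qed

section \<open>Hooks of self-conjugate partitions in terms of beads\<close>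

context
  fixes l :: "nat list"
  assumes l: "is_partition l" and sc: "conjugate l = l"
begin

lemma le_part_sym: "1 \<le> i \<Longrightarrow> 1 \<le> j \<Longrightarrow> i \<le> part l j \<longleftrightarrow> j \<le> part l i"
  using le_col_length_iff[OF l, of i j] conjugate_eq_iff[OF l] sc by simp

text \<open>The sum of the beads is (\<open>part l i\<close> - j) + (\<open>part l j\<close> - i),
  and by symmetry of the diagram both summands are nonnegative or both are negative.\<close>

lemma mem_diagram_bead: "1 \<le> i \<Longrightarrow> 1 \<le> j \<Longrightarrow> (i, j) \<in> diagram l \<longleftrightarrow> 0 \<le> bead l i + bead l j"
  using le_part_sym[of i j] by (auto simp: mem_diagram[OF l] bead_def)

lemma hook_length_bead:
  assumes "(i, j) \<in> diagram l"
  shows "int (hook_length l (i, j)) = bead l i + bead l j + 1"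
proof -
  have ij: "1 \<le> i" "1 \<le> j" "j \<le> part l i" using assms by (auto simp: mem_diagram[OF l])
  then have ji: "i \<le> part l j" using le_part_sym by blast
  have "(a, b) \<in> hook l (i, j) \<longleftrightarrow> (a = i \<and> j \<le> b \<and> b \<le> part l i) \<or> (b = j \<and> i < a \<and> a \<le> part l j)" for a b
  proof -
    have 1: "1 \<le> a \<Longrightarrow> j \<le> part l a \<longleftrightarrow> a \<le> part l j" using le_part_sym[of a j] ij by blast
    show ?thesis
      unfolding hook_def mem_Collect_eq prod.case mem_diagram[OF l] fst_conv snd_conv
      using ij ji 1 by (cases "a = i"; cases "b = j") auto
  qed
  then have "hook l (i, j) = Pair i ` {j..part l i} \<union> (\<lambda>i'. (i', j)) ` {Suc i..part l j}"
    by (auto simp: image_iff Suc_le_eq)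
  moreover have "card (Pair i ` {j..part l i} \<union> (\<lambda>i'. (i', j)) ` {Suc i..part l j}) =
     card (Pair i ` {j..part l i}) + card ((\<lambda>i'. (i', j)) ` {Suc i..part l j})"
    by (rule card_Un_disjoint) auto
  ultimately have "hook_length l (i, j) = (Suc (part l i) - j) + (part l j - i)"
    by (simp add: hook_length_def card_image inj_on_def)
  then show ?thesis using ij ji by (simp add: bead_def of_nat_diff)
qed

lemma bead_set_sym: "k \<in> bead_set l \<longleftrightarrow> - 1 - k \<notin> bead_set l"
  using self_conjugate_iff_bead_set[OF l] sc by blast

text \<open>A hook of length g n amounts to beads u and w with u + w + 1 = g n. By self-conjugacy w
  is a bead iff - 1 - w = u - g n is a gap, so excluding such hooks means that beads can be lowered
  by g.\<close>

lemma is_core_iff: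
  assumes "g > 0"
  shows "is_core g l \<longleftrightarrow> (\<forall>k\<in>bead_set l. k - int g \<in> bead_set l)"
proof
  assume core: "is_core g l"
  show "\<forall>k\<in>bead_set l. k - int g \<in> bead_set l"
  proof
    fix k assume k: "k \<in> bead_set l"
    show "k - int g \<in> bead_set l"
    proof (rule ccontr)
      assume "k - int g \<notin> bead_set l"
      then have "- 1 - (k - int g) \<in> bead_set l" using bead_set_sym by blast
      then obtain i j where ij: "1 \<le> i" "1 \<le> j" "k = bead l i" "- 1 - (k - int g) = bead l j"
        using k by (auto simp: bead_set_def)
      then have "bead l i + bead l j + 1 = int g" by simp
      then have "(i, j) \<in> diagram l" "hook_length l (i, j) = g"
        using mem_diagram_bead[OF ij(1,2)] hook_length_bead[of i j] assms by auto
      then show False using core by (auto simp: is_core_def)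
    qed
  qed
next
  assume sub: "\<forall>k\<in>bead_set l. k - int g \<in> bead_set l"
  have mult: "k - int g * int n \<in> bead_set l" if "k \<in> bead_set l" for k n
  proof (induction n)
    case (Suc n)
    then show ?case using sub[rule_format, OF Suc] by (simp add: algebra_simps)
  qed (use that in simp)
  show "is_core g l"
    unfolding is_core_def
  proof
    fix s assume s: "s \<in> diagram l"
    obtain i j where sij: "s = (i, j)" by force
    have ij: "1 \<le> i" "1 \<le> j" using s by (auto simp: sij mem_diagram[OF l])
    show "\<not> g dvd hook_length l s"
    proof
      assume "g dvd hook_length l s"
      then obtain n where "hook_length l (i, j) = g * n" by (auto simp: sij)
      then have "bead l i - int g * int n = - 1 - bead l j"
        using hook_length_bead[of i j] s by (simp add: sij)
      moreover have "bead l i \<in> bead_set l" "bead l j \<in> bead_set l" using ij by (auto simp: bead_set_def)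
      ultimately show False using mult[of "bead l i" n] bead_set_sym[of "bead l j"] by simp
    qed
  qed
qed

lemma card_main_diagonal: "card (main_diagonal l) = card {k \<in> bead_set l. 0 \<le> k}"
proof -
  have "bij_betw (\<lambda>(i, j). bead l i) (main_diagonal l) {k \<in> bead_set l. 0 \<le> k}"
  proof (rule bij_betw_imageI)
    show "inj_on (\<lambda>(i, j). bead l i) (main_diagonal l)"
      using inj_on_bead[OF l] by (auto simp: main_diagonal_def inj_on_def mem_diagram[OF l])
    have "x \<in> (\<lambda>(i, j). bead l i) ` main_diagonal l" if x: "x \<in> bead_set l" "0 \<le> x" for x
    proof -
      obtain i where "1 \<le> i" "x = bead l i" using x(1) unfolding bead_set_def by auto
      then have "(i, i) \<in> main_diagonal l" using mem_diagram_bead[of i i] x(2) by (simp add: main_diagonal_def)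
      then show ?thesis using \<open>x = bead l i\<close> by force
    qed
    moreover have "x \<in> {k \<in> bead_set l. 0 \<le> k}" if x: "x \<in> (\<lambda>(i, j). bead l i) ` main_diagonal l" for x
    proof -
      obtain i where i: "(i, i) \<in> diagram l" "x = bead l i" using x by (auto simp: main_diagonal_def)
      then have "1 \<le> i" by (simp add: mem_diagram[OF l])
      then show ?thesis using i mem_diagram_bead[of i i] by (auto simp: bead_set_def)
    qed
    ultimately show "(\<lambda>(i, j). bead l i) ` main_diagonal l = {k \<in> bead_set l. 0 \<le> k}" by blast
  qed
  then show ?thesis by (rule bij_betw_same_card)
qed

text \<open>Each box lies in the hook of exactly one diagonal box, and the hook at (i, i) has 2 *
  \<open>bead l i\<close> + 1 boxes.\<close>

lemma int_sum_list: "int (sum_list l) = (\<Sum>k | k \<in> bead_set l \<and> 0 \<le> k. 2 * k + 1)"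
proof -
  have "diagram l = (SIGMA i:{1..length l}. {1..part l i})" by (auto simp: diagram_def)
  then have "card (diagram l) = (\<Sum>i=1..length l. part l i)" by simp
  also have "\<dots> = (\<Sum>i=0..<length l. part l (Suc i))"
    by (rule sum.reindex_bij_witness[of _ Suc "\<lambda>i. i - 1"]) auto
  also have "\<dots> = sum_list l" by (simp add: part_def sum_list_sum_nth)
  finally have 1: "sum_list l = card (diagram l)" by simp
  have D: "diagram l = (\<Union>p\<in>main_diagonal l. hook l p)"
  proof -
    have "x \<in> (\<Union>p\<in>main_diagonal l. hook l p)" if x: "x \<in> diagram l" for x
    proof -
      obtain a b where ab: "x = (a, b)" by force
      have pos: "1 \<le> a" "1 \<le> b" "b \<le> part l a" using x by (auto simp: ab mem_diagram[OF l])
      show ?thesis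
      proof (cases "a \<le> b")
        case True
        then have "(a, a) \<in> main_diagonal l" using pos by (auto simp: main_diagonal_def mem_diagram[OF l])
        moreover have "x \<in> hook l (a, a)" using x True by (auto simp: ab hook_def)
        ultimately show ?thesis by blast
      next
        case False
        have "a \<le> part l b" using pos le_part_sym by blast
        then have "(b, b) \<in> main_diagonal l" using pos False by (auto simp: main_diagonal_def mem_diagram[OF l])
        moreover have "x \<in> hook l (b, b)" using x False by (auto simp: ab hook_def)
        ultimately show ?thesis by blast
      qed
    qed
    then show ?thesis by (auto simp: hook_def)
  qed
  have fin: "finite (main_diagonal l)"
    by (rule finite_subset[OF _ finite_diagram[OF l]]) (auto simp: main_diagonal_def)
  have "card (diagram l) = (\<Sum>p\<in>main_diagonal l. card (hook l p))"
  proof (subst D, rule card_UN_disjoint[OF fin])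
    show "\<forall>i\<in>main_diagonal l. finite (hook l i)"
      using finite_diagram[OF l] by (auto simp: hook_def intro: finite_subset)
    show "\<forall>i\<in>main_diagonal l. \<forall>j\<in>main_diagonal l. i \<noteq> j \<longrightarrow> hook l i \<inter> hook l j = {}"
      by (auto simp: main_diagonal_def hook_def)
  qed
  then have "int (sum_list l) = (\<Sum>p\<in>main_diagonal l. 2 * bead l (fst p) + 1)"
    unfolding 1 of_nat_sum[symmetric]
    by (simp, intro sum.cong refl) (auto simp: main_diagonal_def hook_length_bead[unfolded hook_length_def])
  also have "\<dots> = (\<Sum>k | k \<in> bead_set l \<and> 0 \<le> k. 2 * k + 1)"
  proof (rule sum.reindex_bij_witness[of _ "\<lambda>k. (inv_into {1..} (bead l) k, inv_into {1..} (bead l) k)" "\<lambda>p. bead l (fst p)"])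
    fix p assume p: "p \<in> main_diagonal l"
    then obtain i where i: "p = (i, i)" "(i, i) \<in> diagram l" by (auto simp: main_diagonal_def)
    then have "1 \<le> i" by (simp add: mem_diagram[OF l])
    then show "(inv_into {1..} (bead l) (bead l (fst p)), inv_into {1..} (bead l) (bead l (fst p))) = p"
      "bead l (fst p) \<in> {k. k \<in> bead_set l \<and> 0 \<le> k}"
      using i inj_on_bead[OF l] mem_diagram_bead[of i i] by (auto simp: bead_set_def)
  next
    fix k assume "k \<in> {k. k \<in> bead_set l \<and> 0 \<le> k}"
    then have k: "k \<in> bead l ` {1..}" "0 \<le> k" by (auto simp: bead_set_def)
    let ?i = "inv_into {1..} (bead l) k"
    have i: "1 \<le> ?i" "bead l ?i = k" using inv_into_into[OF k(1)] f_inv_into_f[OF k(1)] by auto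
    show "bead l (fst (?i, ?i)) = k" using i by simp
    show "(?i, ?i) \<in> main_diagonal l"
      using mem_diagram_bead[OF i(1) i(1)] i(2) k(2) by (simp add: main_diagonal_def)
  qed simp
  finally show ?thesis .
qed

text \<open>Diagonal boxes are counted twice on the left and drop out of the parity. The boxes
  strictly above the diagonal are pairs of distinct beads, and u + w + 1 < g reads u + w \<le> g -
  2.\<close>

lemma H_less_plus_parity:
  "(- 1 :: 'a::comm_ring_1) ^ (card (H_less_plus g l) + card (H_less_plus g l \<inter> main_diagonal l)) =
   (- 1) ^ card {(u, w). u \<in> bead_set l \<and> w \<in> bead_set l \<and> w < u \<and> 0 \<le> u + w \<and> u + w \<le> int g - 2}"
proof -
  let ?H = "H_less_plus g l" and ?D = "main_diagonal l"
  let ?N = "{(u, w). u \<in> bead_set l \<and> w \<in> bead_set l \<and> w < u \<and> 0 \<le> u + w \<and> u + w \<le> int g - 2}"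
  have fin: "finite ?H"
    by (rule finite_subset[OF _ finite_diagram[OF l]]) (auto simp: H_less_plus_def)
  have "card ?H = card (?H \<inter> ?D) + card (?H - ?D)"
    using card_Un_disjoint[of "?H \<inter> ?D" "?H - ?D"] fin by (simp add: Int_Diff_Un Int_Diff_disjoint)
  moreover have "bij_betw (\<lambda>(i, j). (bead l i, bead l j)) (?H - ?D) ?N"
  proof (rule bij_betw_imageI)
    have HD: "(i, j) \<in> ?H - ?D \<longleftrightarrow> 1 \<le> i \<and> i < j \<and> 0 \<le> bead l i + bead l j \<and> bead l i + bead l j \<le> int g - 2" for i j
    proof -
      have "(i, j) \<in> ?H - ?D \<longleftrightarrow> (i, j) \<in> diagram l \<and> i < j \<and> int (hook_length l (i, j)) < int g"
        by (auto simp: H_less_plus_def main_diagonal_def eps_def)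
      also have "\<dots> \<longleftrightarrow> 1 \<le> i \<and> i < j \<and> 0 \<le> bead l i + bead l j \<and> bead l i + bead l j \<le> int g - 2"
        using mem_diagram_bead[of i j] hook_length_bead[of i j] by (auto simp: mem_diagram[OF l])
      finally show ?thesis .
    qed
    show "inj_on (\<lambda>(i, j). (bead l i, bead l j)) (?H - ?D)"
    proof (rule inj_onI)
      fix x y assume x: "x \<in> ?H - ?D" and y: "y \<in> ?H - ?D"
        and eq: "(case x of (i, j) \<Rightarrow> (bead l i, bead l j)) = (case y of (i, j) \<Rightarrow> (bead l i, bead l j))"
      obtain i j i' j' where xy: "x = (i, j)" "y = (i', j')" by force
      have "1 \<le> i" "1 \<le> j" "1 \<le> i'" "1 \<le> j'" using x y HD by (auto simp only: xy)
      then show "x = y" using eq inj_on_bead[OF l] by (auto simp: xy inj_on_def)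
    qed
    show "(\<lambda>(i, j). (bead l i, bead l j)) ` (?H - ?D) = ?N"
    proof (intro equalityI subsetI)
      fix z assume "z \<in> (\<lambda>(i, j). (bead l i, bead l j)) ` (?H - ?D)"
      then obtain i j where ij: "(i, j) \<in> ?H - ?D" "z = (bead l i, bead l j)" by auto
      then show "z \<in> ?N" using bead_less[OF l, of i j] by (auto simp only: HD) (auto simp: bead_set_def)
    next
      fix z assume z: "z \<in> ?N"
      then obtain i j where ij: "z = (bead l i, bead l j)" "1 \<le> i" "1 \<le> j" by (auto simp: bead_set_def)
      then have "i < j" using z bead_less_iff[OF l, of i j] by simp
      then have "(i, j) \<in> ?H - ?D" using z ij by (simp only: HD) simp
      then show "z \<in> (\<lambda>(i, j). (bead l i, bead l j)) ` (?H - ?D)" using ij by force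
    qed
  qed
  then have "card (?H - ?D) = card ?N" by (rule bij_betw_same_card)
  ultimately have "card ?H + card (?H \<inter> ?D) = 2 * card (?H \<inter> ?D) + card ?N" by simp
  then show ?thesis by (simp only: power_add power_mult) simp
qed

end

section \<open>Parametrisation of self-conjugate cores\<close>

lemma int_sorted_wrt_gr_nth:
  fixes xs :: "int list"
  assumes "sorted_wrt (>) xs" "i \<le> j" "j < length xs"
  shows "xs ! j + int (j - i) \<le> xs ! i"
  using assms(2,3)
proof (induction j rule: dec_induct)
  case (step j)
  then have "xs ! Suc j < xs ! j" using assms(1) by (auto simp: sorted_wrt_iff_nth_less)
  then show ?case using step by (simp add: Suc_diff_le)
qed simp

text \<open>The symmetry splits the window from - M to M - 1 evenly, so it contains exactly M
  elements of B. The i-th largest of them is therefore at least - i, and adding i gives a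
  nonnegative part.\<close>

lemma ex_partition_bead_set:
  assumes sym: "\<And>k. k \<in> B \<longleftrightarrow> - 1 - k \<notin> B" and M: "\<And>k. k < - int M \<Longrightarrow> k \<in> B"
  obtains l where "is_partition l" "bead_set l = B"
proof -
  define S where "S = B \<inter> {- int M..<int M}"
  have up: "k \<notin> B" if "k \<ge> int M" for k using sym[of k] M[of "- 1 - k"] that by auto
  have finS: "finite S" by (simp add: S_def)
  have "bij_betw (\<lambda>k. - 1 - k) S ({- int M..<int M} - S)"
  proof (rule bij_betwI[of _ _ _ "\<lambda>k. - 1 - k"])
    show "(\<lambda>k. - 1 - k) \<in> S \<rightarrow> {- int M..<int M} - S"
    proof
      fix k assume "k \<in> S"
      then show "- 1 - k \<in> {- int M..<int M} - S" using sym[of k] by (simp add: S_def)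
    qed
    show "(\<lambda>k. - 1 - k) \<in> {- int M..<int M} - S \<rightarrow> S"
    proof
      fix k assume "k \<in> {- int M..<int M} - S"
      then have "k \<notin> B" "- int M \<le> k" "k < int M" by (auto simp: S_def)
      then show "- 1 - k \<in> S" using sym[of k] by (auto simp: S_def)
    qed
  qed simp_all
  then have "card S = card ({- int M..<int M} - S)" by (rule bij_betw_same_card)
  also have "\<dots> = card {- int M..<int M} - card S" using finS by (intro card_Diff_subset) (auto simp: S_def)
  finally have cS: "card S = M"
    using card_mono[of "{- int M..<int M}" S] by (simp add: S_def)
  define xs where "xs = rev (sorted_list_of_set S)"
  have xs: "set xs = S" "length xs = M" "distinct xs" using finS cS by (simp_all add: xs_def)
  have dec: "sorted_wrt (>) xs"
    unfolding xs_def sorted_wrt_rev using strict_sorted_list_of_set[of S] by (simp add: sorted_wrt_iff_nth_less)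
  \<comment> \<open>The M - i distinct elements from position i on all lie between - M and
    \<open>xs ! i\<close>.\<close>
  have low: "- 1 - int i \<le> xs ! i" if i: "i < M" for i
  proof -
    have "(!) xs ` {i..<M} \<subseteq> {- int M..xs ! i}"
    proof
      fix k assume "k \<in> (!) xs ` {i..<M}"
      then obtain j where j: "i \<le> j" "j < M" "k = xs ! j" by auto
      then have "k \<in> S" using xs by (metis nth_mem)
      then show "k \<in> {- int M..xs ! i}"
        using int_sorted_wrt_gr_nth[OF dec j(1)] j xs by (auto simp: S_def)
    qed
    then have "card ((!) xs ` {i..<M}) \<le> card {- int M..xs ! i}" by (rule card_mono[rotated]) simp
    moreover have "card ((!) xs ` {i..<M}) = M - i"
      using xs by (subst card_image) (auto intro: inj_on_nth)
    moreover have "card {- int M..xs ! i} = nat (xs ! i + int M + 1)" by (simp add: algebra_simps)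
    ultimately show ?thesis using i by linarith
  qed
  define p where "p i = nat (xs ! i + int i + 1)" for i
  have pdec: "p j \<le> p i" if "i \<le> j" "j < M" for i j
    using int_sorted_wrt_gr_nth[OF dec that(1)] that xs(2) unfolding p_def by (intro nat_mono) (simp add: of_nat_diff)
  \<comment> \<open>Parts equal to 0 are dropped; they sit at the end because p is weakly
    decreasing.\<close>
  define l where "l = takeWhile (\<lambda>x. x > 0) (map p [0..<M])"
  have ll: "length l \<le> M" unfolding l_def using length_takeWhile_le[of _ "map p [0..<M]"] by simp
  have lnth: "l ! i = p i" if "i < length l" for i
    using that ll unfolding l_def by (simp add: takeWhile_nth)
  have lpos: "p i = 0" if "length l \<le> i" "i < M" for i
  proof -
    have "length l < M" using that by simp
    then have "\<not> 0 < map p [0..<M] ! length l"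
      unfolding l_def by (intro nth_length_takeWhile) (simp add: l_def[symmetric])
    then have "p (length l) = 0" using \<open>length l < M\<close> by simp
    then show ?thesis using pdec[OF that] by simp
  qed
  have part: "part l i = (if i \<le> M then p (i - 1) else 0)" if "1 \<le> i" for i
    using that lnth[of "i - 1"] lpos[of "i - 1"] ll by (auto simp: part_def)
  have ip: "is_partition l"
    unfolding is_partition_def
  proof
    show "sorted_wrt (\<ge>) l" using ll pdec by (auto simp: sorted_wrt_iff_nth_less lnth)
    show "0 \<notin> set l" unfolding l_def by (auto dest: set_takeWhileD)
  qed
  have bead: "bead l i = (if i \<le> M then xs ! (i - 1) else - int i)" if "1 \<le> i" for i
  proof (cases "i \<le> M")
    case True
    then have "i - 1 < M" using that by linarith
    from low[OF this] show ?thesis using True that by (simp add: bead_def part p_def of_nat_diff)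
  qed (use that in \<open>simp add: bead_def part\<close>)
  have "bead_set l = B"
  proof (intro equalityI subsetI)
    fix k assume "k \<in> bead_set l"
    then obtain i where i: "1 \<le> i" "k = bead l i" by (auto simp: bead_set_def)
    show "k \<in> B"
    proof (cases "i \<le> M")
      case True
      then have "i - 1 < length xs" "k = xs ! (i - 1)" using i bead[OF i(1)] xs(2) by auto
      then have "k \<in> S" using xs(1) nth_mem by blast
      then show ?thesis by (simp add: S_def)
    next
      case False
      then show ?thesis using i bead[OF i(1)] by (intro M) auto
    qed
  next
    fix k assume k: "k \<in> B"
    then have "k < int M" by (rule_tac ccontr) (use up[of k] in auto)
    show "k \<in> bead_set l"
    proof (cases "k < - int M")
      case True
      then have "k = bead l (nat (- k))" "1 \<le> nat (- k)" using bead[of "nat (- k)"] by auto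
      then show ?thesis by (auto simp: bead_set_def)
    next
      case False
      then have "k \<in> set xs" using k \<open>k < int M\<close> xs by (auto simp: S_def)
      then obtain i where "i < M" "xs ! i = k" using xs by (auto simp: in_set_conv_nth)
      then have "k = bead l (Suc i)" using bead[of "Suc i"] by simp
      then show ?thesis by (auto simp: bead_set_def)
    qed
  qed
  then show ?thesis using that ip by blast
qed

text \<open>The beads of a \<open>2t\<close>-core in each residue class modulo \<open>2t\<close> are all those below a level.
  Self-conjugacy makes the levels of the classes \<open>j\<close> and \<open>2t - 1 - j\<close> opposite.\<close>

definition level :: "nat \<Rightarrow> (nat \<Rightarrow> int) \<Rightarrow> nat \<Rightarrow> int" where
  "level t n i = (if i < t then - n i else n (2 * t - 1 - i))"

definition core_beads :: "nat \<Rightarrow> (nat \<Rightarrow> int) \<Rightarrow> int set" where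
  "core_beads t n = {k. k div (2 * int t) < level t n (nat (k mod (2 * int t)))}"

lemma mem_core_beads:
  assumes "i < 2 * t"
  shows "a * (2 * int t) + int i \<in> core_beads t n \<longleftrightarrow> a < level t n i"
proof -
  have "(a * (2 * int t) + int i) div (2 * int t) = a" "(a * (2 * int t) + int i) mod (2 * int t) = int i"
    using assms by simp_all
  then show ?thesis by (simp add: core_beads_def)
qed

lemma int_div_mod_cases:
  assumes "t > 0"
  obtains a i where "k = a * (2 * int t) + int i" "i < 2 * t"
proof
  have "int (nat (k mod (2 * int t))) = k mod (2 * int t)" using assms by simp
  then show "k = k div (2 * int t) * (2 * int t) + int (nat (k mod (2 * int t)))"
    by (simp only: div_mult_mod_eq)
  have "k mod (2 * int t) < 2 * int t" using assms by simp
  then show "nat (k mod (2 * int t)) < 2 * t" using assms by (simp add: nat_less_iff)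
qed

lemma level_mirror: "i < 2 * t \<Longrightarrow> level t n (2 * t - 1 - i) = - level t n i"
  by (auto simp: level_def)

lemma core_beads_sym:
  assumes "t > 0"
  shows "k \<in> core_beads t n \<longleftrightarrow> - 1 - k \<notin> core_beads t n"
proof -
  obtain a i where k: "k = a * (2 * int t) + int i" "i < 2 * t" using int_div_mod_cases[OF assms] by blast
  have k': "- 1 - k = (- 1 - a) * (2 * int t) + int (2 * t - 1 - i)"
    using k by (simp add: of_nat_diff algebra_simps)
  have i': "2 * t - 1 - i < 2 * t" using assms by simp
  have "k \<in> core_beads t n \<longleftrightarrow> a < level t n i"
    unfolding k(1) by (rule mem_core_beads[OF k(2)])
  moreover have "- 1 - k \<in> core_beads t n \<longleftrightarrow> - 1 - a < - level t n i"
    unfolding k' mem_core_beads[OF i'] level_mirror[OF k(2)] ..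
  ultimately show ?thesis by auto
qed

lemma core_beads_shift:
  assumes "t > 0" "k \<in> core_beads t n"
  shows "k - int (2 * t) \<in> core_beads t n"
proof -
  obtain a i where k: "k = a * (2 * int t) + int i" "i < 2 * t" using int_div_mod_cases[OF assms(1)] by blast
  have "k - int (2 * t) = (a - 1) * (2 * int t) + int i" using k by (simp add: algebra_simps)
  moreover have "a < level t n i" using assms(2) mem_core_beads[OF k(2)] k(1) by simp
  then have "(a - 1) * (2 * int t) + int i \<in> core_beads t n" using mem_core_beads[OF k(2)] by simp
  ultimately show ?thesis by (simp only:)
qed

lemma core_beads_low:
  assumes "t > 0"
  obtains M where "\<And>k. k < - int M \<Longrightarrow> k \<in> core_beads t n"
proof -
  define A where "A = Min (level t n ` {..<2 * t})"
  have A: "A \<le> level t n i" if "i < 2 * t" for i using that by (simp add: A_def)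
  define M where "M = nat (- (A * (2 * int t)))"
  have "k \<in> core_beads t n" if k: "k < - int M" for k
  proof -
    obtain a i where ai: "k = a * (2 * int t) + int i" "i < 2 * t" using int_div_mod_cases[OF assms] by blast
    have "a * (2 * int t) < A * (2 * int t)" using k ai(1) unfolding M_def by linarith
    then have "a < A" using assms by (simp add: mult_less_cancel_right)
    then have "a < level t n i" using A[OF ai(2)] by linarith
    then show ?thesis using mem_core_beads[OF ai(2)] ai(1) by simp
  qed
  then show ?thesis using that by blast
qed

lemma int_lower_set_cases:
  fixes A :: "int set"
  assumes down: "\<And>a. a \<in> A \<Longrightarrow> a - 1 \<in> A" and ex: "a0 \<in> A" and up: "\<And>a. a \<in> A \<Longrightarrow> a < u"
  obtains m where "A = {a. a < m}"
proof -
  define F where "F = A \<inter> {a0..u}"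
  have F: "finite F" "F \<noteq> {}" using ex up[OF ex] by (auto simp: F_def)
  have "a \<in> A" if "a \<le> Max F" for a
    using that
  proof (induction a rule: int_le_induct)
    case base
    then show ?case using Max_in[OF F] by (simp add: F_def)
  qed (rule down)
  moreover have "a \<le> Max F" if "a \<in> A" for a
  proof (cases "a0 \<le> a")
    case True
    then have "a \<in> F" using that up[OF that] by (simp add: F_def)
    then show ?thesis using F by simp
  next
    case False
    then show ?thesis using Max_in[OF F] by (simp add: F_def)
  qed
  ultimately have "A = {a. a < Max F + 1}" by auto
  then show ?thesis using that by blast
qed

text \<open>Closure under subtraction of 2 t makes B, in each residue class, a lower set and hence a
  half-line with bound \<open>m i\<close>. The symmetry gives opposite bounds in mirrored classes,
  so t of them are free.\<close>

lemma ex_core_beads: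
  assumes t: "t > 0" and sym: "\<And>k. k \<in> B \<longleftrightarrow> - 1 - k \<notin> B"
    and shift: "\<And>k. k \<in> B \<Longrightarrow> k - int (2 * t) \<in> B" and M: "\<And>k. k < - int M \<Longrightarrow> k \<in> B"
  obtains n where "n \<in> int_vecs t" "B = core_beads t n"
proof -
  have up: "k < int M" if "k \<in> B" for k using sym[of k] M[of "- 1 - k"] that by force
  have "\<exists>m. \<forall>a. a * (2 * int t) + int i \<in> B \<longleftrightarrow> a < m" if i: "i < 2 * t" for i
  proof -
    let ?A = "{a. a * (2 * int t) + int i \<in> B}"
    obtain m where "?A = {a. a < m}"
    proof (rule int_lower_set_cases[of ?A "- int M - 2" "int M"])
      fix a assume a: "a \<in> ?A"
      then show "a - 1 \<in> ?A" using shift[of "a * (2 * int t) + int i"] by (simp add: algebra_simps)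
      show "a < int M"
      proof (rule ccontr)
        assume "\<not> a < int M"
        then have "int M * 1 \<le> a * (2 * int t)" using t by (intro mult_mono) auto
        then show False using a up[of "a * (2 * int t) + int i"] by simp
      qed
    next
      \<comment> \<open>The multiplier - M - 2, one less than - M - 1, leaves room for the offset i
        < 2 t.\<close>
      have "(int M + 1) * 1 \<le> (int M + 1) * (2 * int t)" using t by (intro mult_left_mono) auto
      then have "(- int M - 2) * (2 * int t) + int i < - int M" using i by (simp add: algebra_simps)
      then show "- int M - 2 \<in> ?A" using M by simp
    qed
    then show ?thesis by auto
  qed
  then obtain m where m: "a * (2 * int t) + int i \<in> B \<longleftrightarrow> a < m i" if "i < 2 * t" for i a by metis
  have mirror: "m (2 * t - 1 - i) = - m i" if i: "i < 2 * t" for i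
  proof -
    have i': "2 * t - 1 - i < 2 * t" using i by simp
    have "a < m i \<longleftrightarrow> \<not> (- 1 - a < m (2 * t - 1 - i))" for a
    proof -
      have "- 1 - (a * (2 * int t) + int i) = (- 1 - a) * (2 * int t) + int (2 * t - 1 - i)"
        using i by (simp add: of_nat_diff algebra_simps)
      then show ?thesis using sym[of "a * (2 * int t) + int i"] m[OF i, of a] m[OF i', of "- 1 - a"] by simp
    qed
    from this[of "m i"] this[of "m i - 1"] show ?thesis by linarith
  qed
  define n where "n = (\<lambda>j\<in>{0..<t}. m (2 * t - 1 - j))"
  have lev: "level t n i = m i" if "i < 2 * t" for i
  proof (cases "i < t")
    case True
    then show ?thesis using mirror[OF that] by (simp add: level_def n_def)
  next
    case False
    then have "2 * t - 1 - i < t" "2 * t - 1 - (2 * t - 1 - i) = i" using that by auto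
    then show ?thesis using False by (simp add: level_def n_def)
  qed
  have "k \<in> B \<longleftrightarrow> k \<in> core_beads t n" for k
  proof -
    obtain a i where k: "k = a * (2 * int t) + int i" "i < 2 * t" using int_div_mod_cases[OF t] by blast
    then show ?thesis using m[OF k(2)] mem_core_beads[OF k(2)] lev by simp
  qed
  moreover have "n \<in> int_vecs t" by (simp add: n_def)
  ultimately show ?thesis using that by blast
qed

lemma core_beads_inj:
  assumes "n \<in> int_vecs t" "n' \<in> int_vecs t" "core_beads t n = core_beads t n'"
  shows "n = n'"
proof (rule PiE_ext[OF assms(1,2)])
  fix j assume "j \<in> {0..<t}"
  then have j: "j < t" "j < 2 * t" by auto
  have "a < - n j \<longleftrightarrow> a < - n' j" for a
    using mem_core_beads[OF j(2), of a n] mem_core_beads[OF j(2), of a n'] assms(3) j by (simp add: level_def)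
  from this[of "- n j"] this[of "- n' j"] show "n j = n' j" by linarith
qed

text \<open>For \<open>t > 0\<close> such a partition exists, and it is unique by \<open>bead_set_inj\<close>.\<close>

definition core_partition :: "nat \<Rightarrow> (nat \<Rightarrow> int) \<Rightarrow> nat list" where
  "core_partition t n = (SOME l. is_partition l \<and> bead_set l = core_beads t n)"

lemma core_partition:
  assumes "t > 0"
  shows "is_partition (core_partition t n)" "bead_set (core_partition t n) = core_beads t n"
    "core_partition t n \<in> SC_cores (2 * t)"
proof -
  obtain M where M: "\<And>k. k < - int M \<Longrightarrow> k \<in> core_beads t n" using core_beads_low[OF assms] by blast
  obtain l where "is_partition l" "bead_set l = core_beads t n"
    using ex_partition_bead_set[of "core_beads t n" M, OF core_beads_sym[OF assms] M] by blast
  then have "\<exists>l. is_partition l \<and> bead_set l = core_beads t n" by blast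
  from someI_ex[OF this] show l: "is_partition (core_partition t n)" "bead_set (core_partition t n) = core_beads t n"
    by (auto simp: core_partition_def)
  have sc: "conjugate (core_partition t n) = core_partition t n"
    unfolding self_conjugate_iff_bead_set[OF l(1)] l(2) using core_beads_sym[OF assms] by blast
  have "is_core (2 * t) (core_partition t n)"
    using is_core_iff[OF l(1) sc, of "2 * t"] core_beads_shift[OF assms] assms l(2) by simp
  then show "core_partition t n \<in> SC_cores (2 * t)" using l sc by (simp add: SC_cores_def)
qed

lemma bij_betw_core_partition:
  assumes t: "t > 0"
  shows "bij_betw (core_partition t) (int_vecs t) (SC_cores (2 * t))"
proof (rule bij_betw_imageI)
  show "inj_on (core_partition t) (int_vecs t)"
    using core_partition(2)[OF t] core_beads_inj by (intro inj_onI) metis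
  show "core_partition t ` (int_vecs t) = SC_cores (2 * t)"
  proof (intro equalityI subsetI)
    fix l assume "l \<in> SC_cores (2 * t)"
    then have l: "is_partition l" "conjugate l = l" "is_core (2 * t) l" by (auto simp: SC_cores_def)
    have low: "k \<in> bead_set l" if "k < - int (length l)" for k
    proof -
      have "bead l (nat (- k)) = k" "1 \<le> nat (- k)" using that by (auto simp: bead_def part_def)
      then show ?thesis unfolding bead_set_def by (metis atLeast_iff image_eqI)
    qed
    obtain n where n: "n \<in> int_vecs t" "bead_set l = core_beads t n"
    proof (rule ex_core_beads[OF t bead_set_sym[OF l(1,2)] _ low])
      fix k assume "k \<in> bead_set l"
      then show "k - int (2 * t) \<in> bead_set l"
        using is_core_iff[OF l(1,2), of "2 * t"] l(3) t by simp
    qed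
    then have "l = core_partition t n"
      using core_partition(1,2)[OF t, of n] l(1) by (intro bead_set_inj) auto
    then show "l \<in> core_partition t ` (int_vecs t)" using n by blast
  qed (use core_partition(3)[OF t] in auto)
qed

section \<open>The size and the sign of a core\<close>

lemma sum_mirror: "(\<Sum>i<2*t. f i) = (\<Sum>j<t. f j + f (2 * t - 1 - j))" for f :: "nat \<Rightarrow> 'a::comm_monoid_add"
proof -
  have "{..<2*t} = {..<t} \<union> {t..<2*t}" by auto
  then have "(\<Sum>i<2*t. f i) = (\<Sum>i<t. f i) + (\<Sum>i\<in>{t..<2*t}. f i)"
    by (simp add: sum.union_disjoint ivl_disj_int)
  also have "(\<Sum>i\<in>{t..<2*t}. f i) = (\<Sum>j<t. f (2 * t - 1 - j))"
    by (rule sum.reindex_bij_witness[of _ "\<lambda>j. 2 * t - 1 - j" "\<lambda>i. 2 * t - 1 - i"]) auto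
  finally show ?thesis by (simp add: sum.distrib)
qed

lemma nonneg_core_beads:
  assumes "t > 0"
  shows "{k \<in> core_beads t n. 0 \<le> k} = (\<Union>i<2*t. (\<lambda>a. a * (2 * int t) + int i) ` {0..<level t n i})"
proof (intro equalityI subsetI)
  fix k assume k: "k \<in> {k \<in> core_beads t n. 0 \<le> k}"
  obtain a i where ai: "k = a * (2 * int t) + int i" "i < 2 * t" using int_div_mod_cases[OF assms] by blast
  have "0 \<le> a"
  proof (rule ccontr)
    assume "\<not> 0 \<le> a"
    then have "a * (2 * int t) \<le> (- 1) * (2 * int t)" by (intro mult_right_mono) auto
    then show False using k ai by auto
  qed
  moreover have "a < level t n i" using k ai mem_core_beads[OF ai(2), of a n] by auto
  ultimately have "k \<in> (\<lambda>a. a * (2 * int t) + int i) ` {0..<level t n i}"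
    using ai(1) \<open>0 \<le> a\<close> by (intro image_eqI[of k _ a]) auto
  then show "k \<in> (\<Union>i<2*t. (\<lambda>a. a * (2 * int t) + int i) ` {0..<level t n i})"
    using ai(2) by blast
qed (auto simp: mem_core_beads)

lemma sum_nonneg_core_beads:
  fixes f :: "int \<Rightarrow> 'a::comm_monoid_add"
  assumes "t > 0"
  shows "(\<Sum>k | k \<in> core_beads t n \<and> 0 \<le> k. f k) = (\<Sum>i<2*t. \<Sum>a\<in>{0..<level t n i}. f (a * (2 * int t) + int i))"
proof -
  have disj: "a = b \<and> i = j" if "a * (2 * int t) + int i = b * (2 * int t) + int j" "i < 2 * t" "j < 2 * t" for a b i j
  proof -
    have "a = (a * (2 * int t) + int i) div (2 * int t)" "i = nat ((a * (2 * int t) + int i) mod (2 * int t))"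
      "b = (b * (2 * int t) + int j) div (2 * int t)" "j = nat ((b * (2 * int t) + int j) mod (2 * int t))"
      using that(2,3) by simp_all
    then show ?thesis using that(1) by metis
  qed
  have "(\<Sum>k | k \<in> core_beads t n \<and> 0 \<le> k. f k) =
      (\<Sum>i<2*t. \<Sum>k\<in>(\<lambda>a. a * (2 * int t) + int i) ` {0..<level t n i}. f k)"
    unfolding nonneg_core_beads[OF assms]
    by (rule sum.UNION_disjoint) (auto dest!: disj)
  also have "\<dots> = (\<Sum>i<2*t. \<Sum>a\<in>{0..<level t n i}. f (a * (2 * int t) + int i))"
  proof (rule sum.cong[OF refl])
    fix i
    show "(\<Sum>k\<in>(\<lambda>a. a * (2 * int t) + int i) ` {0..<level t n i}. f k) =
        (\<Sum>a\<in>{0..<level t n i}. f (a * (2 * int t) + int i))"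
      using assms by (subst sum.reindex) (auto simp: inj_on_def)
  qed
  finally show ?thesis .
qed

lemma sum_arith_progression:
  "(\<Sum>a\<in>{0..<m}. 2 * (a * g + i) + 1) = (if m > 0 then g * m * m + (2 * i + 1 - g) * m else 0)" for m g i :: int
proof -
  have "(\<Sum>a\<in>{0..<int k}. 2 * (a * g + i) + 1) = g * int k * int k + (2 * i + 1 - g) * int k" for k
  proof (induction k)
    case (Suc k)
    have "{0..<int (Suc k)} = insert (int k) {0..<int k}" by auto
    then show ?case using Suc by (simp add: algebra_simps)
  qed simp
  from this[of "nat m"] show ?thesis by (cases "m > 0") auto
qed

text \<open>Of the opposite levels - n_j and n_j in the classes j and 2 t - 1 - j at most one is
  positive and contributes beads. In both cases the arithmetic progression sums to 2 t n_j^2 + (2 (t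
  - j) - 1) n_j, the weight of column j.\<close>

lemma sum_list_core_partition:
  assumes t: "t > 0"
  shows "sum_list (core_partition t n) = phi_wt t n"
proof -
  let ?l = "core_partition t n"
  have l: "is_partition ?l" "conjugate ?l = ?l" using core_partition[OF t] by (auto simp: SC_cores_def)
  have "int (sum_list ?l) = (\<Sum>i<2*t. \<Sum>a\<in>{0..<level t n i}. 2 * (a * (2 * int t) + int i) + 1)"
    unfolding int_sum_list[OF l] core_partition(2)[OF t] by (rule sum_nonneg_core_beads[OF t])
  also have "\<dots> = (\<Sum>j<t. int (phi_exp t (t - j) (n j)))"
    unfolding sum_mirror sum_arith_progression
  proof (rule sum.cong[OF refl])
    fix j assume "j \<in> {..<t}"
    then have j: "j < t" by simp
    have lv: "level t n j = - n j" "level t n (2 * t - 1 - j) = n j" using j by (auto simp: level_def)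
    have m: "int (2 * t - 1 - j) = 2 * int t - 1 - int j" using j by (simp add: of_nat_diff)
    have "int (phi_exp t (t - j) (n j)) = 2 * int t * n j * n j + (2 * int (t - j) - 1) * n j"
      using j by (intro int_theta_wt_phi) auto
    also have "int (t - j) = int t - int j" using j by simp
    finally show "(if level t n j > 0 then 2 * int t * level t n j * level t n j + (2 * int j + 1 - 2 * int t) * level t n j else 0) +
      (if level t n (2 * t - 1 - j) > 0 then 2 * int t * level t n (2 * t - 1 - j) * level t n (2 * t - 1 - j) +
         (2 * int (2 * t - 1 - j) + 1 - 2 * int t) * level t n (2 * t - 1 - j) else 0) =
      int (phi_exp t (t - j) (n j))"
      unfolding lv m by (auto simp: algebra_simps)
  qed
  also have "\<dots> = int (phi_wt t n)" by (simp add: phi_wt_def lessThan_atLeast0)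
  finally show ?thesis by (simp only: of_nat_eq_iff)
qed

text \<open>An asymmetric relation that is total off the diagonal picks one orientation of each
  unordered pair, so the count does not depend on the choice of relation.\<close>

lemma card_tournament:
  assumes sym: "\<And>u w. S u w \<Longrightarrow> S w u"
    and R: "\<And>u w. R u w \<Longrightarrow> \<not> R w u" "\<And>u w. u \<noteq> w \<Longrightarrow> R u w \<or> R w u"
    and R': "\<And>u w. R' u w \<Longrightarrow> \<not> R' w u" "\<And>u w. u \<noteq> w \<Longrightarrow> R' u w \<or> R' w u"
  shows "card {(u, w). S u w \<and> R u w} = card {(u, w). S u w \<and> R' u w}"
proof (rule bij_betw_same_card, rule bij_betw_byWitness)
  let ?f = "\<lambda>R (u, w). if R u w then (u, w) else (w, u)"
  show "\<forall>a\<in>{(u, w). S u w \<and> R u w}. ?f R (?f R' a) = a" "\<forall>a\<in>{(u, w). S u w \<and> R' u w}. ?f R' (?f R a) = a"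
    using R(1) R'(1) by auto
  show "?f R' ` {(u, w). S u w \<and> R u w} \<subseteq> {(u, w). S u w \<and> R' u w}"
    "?f R ` {(u, w). S u w \<and> R' u w} \<subseteq> {(u, w). S u w \<and> R u w}"
    using R R' sym by (auto split: if_splits) metis+
qed

text \<open>For distinct classes i and j, the number of pairs a < \<open>level t n i\<close>, b <
  \<open>level t n j\<close> with a + b = d, where d is - 1 if 2 t \<le> i + j and 0 otherwise.
  Mirrored classes give nothing because u + w + 1 is a multiple of 2 t there.\<close>

definition pair_count :: "nat \<Rightarrow> (nat \<Rightarrow> int) \<Rightarrow> nat \<times> nat \<Rightarrow> nat" where
  "pair_count t n = (\<lambda>(i, j). if i + j = 2 * t - 1 then 0
     else nat (level t n i + level t n j + (if 2 * t \<le> i + j then 0 else - 1)))"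

text \<open>In a self-conjugate partition the box in row \<open>i\<close> and column \<open>j\<close> has hook length \<open>u + w + 1\<close>, where \<open>u\<close> and
  \<open>w\<close> are the \<open>i\<close>-th and \<open>j\<close>-th beads.\<close>

definition hook_pair :: "nat \<Rightarrow> (nat \<Rightarrow> int) \<Rightarrow> int \<Rightarrow> int \<Rightarrow> bool" where
  "hook_pair t n u w \<longleftrightarrow> u \<in> core_beads t n \<and> w \<in> core_beads t n \<and> 0 \<le> u + w \<and> u + w \<le> int (2 * t) - 2"

lemma hook_pair_iff:
  assumes "i < 2 * t" "j < 2 * t"
  shows "hook_pair t n (a * (2 * int t) + int i) (b * (2 * int t) + int j) \<longleftrightarrow>
    a < level t n i \<and> b < level t n j \<and> i + j \<noteq> 2 * t - 1 \<and> a + b = (if 2 * t \<le> i + j then - 1 else 0)"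
proof -
  define s where "s = a + b"
  have "a * (2 * int t) + int i + (b * (2 * int t) + int j) = s * (2 * int t) + int (i + j)"
    by (simp add: s_def algebra_simps)
  moreover have "0 \<le> s * (2 * int t) + int (i + j) \<and> s * (2 * int t) + int (i + j) \<le> int (2 * t) - 2 \<longleftrightarrow>
    i + j \<noteq> 2 * t - 1 \<and> s = (if 2 * t \<le> i + j then - 1 else 0)"
  proof -
    consider "s \<le> - 2" | "s = - 1" | "s = 0" | "1 \<le> s" by linarith
    then show ?thesis
    proof cases
      case 1
      then have "s * (2 * int t) \<le> (- 2) * (2 * int t)" by (intro mult_right_mono) auto
      then show ?thesis using assms 1 by auto
    next
      case 4
      then have "1 * (2 * int t) \<le> s * (2 * int t)" by (intro mult_right_mono) auto
      then have "\<not> s * (2 * int t) + int (i + j) \<le> int (2 * t) - 2" by linarith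
      then show ?thesis using 4 by auto
    qed (use assms in auto)
  qed
  ultimately show ?thesis
    unfolding hook_pair_def mem_core_beads[OF assms(1)] mem_core_beads[OF assms(2)] s_def by auto
qed

text \<open>The order w < u is exchanged for the order by residues, with ties broken inside a class,
  so that pairs can be counted class by class.\<close>

lemma card_hook_pairs:
  assumes t: "t > 0"
  shows "card {(u, w). hook_pair t n u w \<and> w < u} =
    (\<Sum>p\<in>pairs (2 * t). pair_count t n p) + (\<Sum>i<2*t. nat (level t n i + (if t \<le> i then 0 else - 1)))"
proof -
  let ?g = "2 * int t"
  let ?R = "\<lambda>u w. u mod ?g < w mod ?g \<or> (u mod ?g = w mod ?g \<and> u < w)"
  define N where "N = (\<lambda>(i, j). {(u, w). hook_pair t n u w \<and> u mod ?g = int i \<and> w mod ?g = int j \<and> (i = j \<longrightarrow> u < w)})"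
  have modrep: "u = u div ?g * ?g + int i" if "u mod ?g = int i" for u i
    using that div_mult_mod_eq[of u ?g] by simp
  have cN: "finite (N (i, j)) \<and> card (N (i, j)) = pair_count t n (i, j)" if ij: "i < j" "j < 2 * t" for i j
  proof (cases "i + j = 2 * t - 1")
    case True
    have "N (i, j) = {}"
    proof -
      have "\<not> hook_pair t n u w" if "u mod ?g = int i" "w mod ?g = int j" for u w
        using modrep[OF that(1)] modrep[OF that(2)] hook_pair_iff[of i t j n "u div ?g" "w div ?g"] ij True by simp
      then show ?thesis by (auto simp: N_def)
    qed
    then show ?thesis using True by (simp add: pair_count_def)
  next
    case False
    define d where "d = (if 2 * t \<le> i + j then - 1 else 0 :: int)"
    let ?f = "\<lambda>a. (a * ?g + int i, (d - a) * ?g + int j)"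
    have "N (i, j) = ?f ` {d - level t n j<..<level t n i}"
    proof (intro equalityI subsetI)
      fix x assume "x \<in> N (i, j)"
      then obtain u w where x: "x = (u, w)" "hook_pair t n u w" "u mod ?g = int i" "w mod ?g = int j"
        by (auto simp: N_def)
      define a b where "a = u div ?g" and "b = w div ?g"
      have uw: "u = a * ?g + int i" "w = b * ?g + int j" using modrep x by (auto simp: a_def b_def)
      have "a < level t n i" "b < level t n j" "a + b = d"
        using x(2) hook_pair_iff[of i t j n a b] ij unfolding uw d_def by auto
      then show "x \<in> ?f ` {d - level t n j<..<level t n i}"
        unfolding x(1) uw by (intro image_eqI[of _ _ a]) auto
    next
      fix x assume "x \<in> ?f ` {d - level t n j<..<level t n i}"
      then obtain a where a: "d - level t n j < a" "a < level t n i" "x = ?f a" by auto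
      have "hook_pair t n (a * ?g + int i) ((d - a) * ?g + int j)"
        using hook_pair_iff[of i t j n a "d - a"] ij a False by (simp add: d_def)
      then show "x \<in> N (i, j)" using a(3) ij by (simp add: N_def)
    qed
    moreover have "inj_on ?f {d - level t n j<..<level t n i}" using t by (auto simp: inj_on_def)
    moreover have "level t n i - (d - level t n j) - 1 = level t n i + level t n j + (if 2 * t \<le> i + j then 0 else - 1)"
      by (simp add: d_def)
    ultimately show ?thesis using False by (simp add: card_image pair_count_def)
  qed
  have cN': "finite (N (i, i)) \<and> card (N (i, i)) = nat (level t n i + (if t \<le> i then 0 else - 1))" if i: "i < 2 * t" for i
  proof -
    define d where "d = (if 2 * t \<le> i + i then - 1 else 0 :: int)"
    \<comment> \<open>The least value of the larger quotient b: with a + b = d, the condition a < b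
      says \<open>lo \<le> b\<close>.\<close>
    define lo where "lo = (if t \<le> i then 0 else 1 :: int)"
    let ?f = "\<lambda>a. ((d - a) * ?g + int i, a * ?g + int i)"
    have ne: "i + i \<noteq> 2 * t - 1" using t by presburger
    have lt: "a * ?g + int i < b * ?g + int i \<longleftrightarrow> a < b" for a b using t by simp
    have "N (i, i) = ?f ` {lo..<level t n i}"
    proof (intro equalityI subsetI)
      fix x assume "x \<in> N (i, i)"
      then obtain u w where x: "x = (u, w)" "hook_pair t n u w" "u mod ?g = int i" "w mod ?g = int i" "u < w"
        by (auto simp: N_def)
      define a b where "a = u div ?g" and "b = w div ?g"
      have uw: "u = a * ?g + int i" "w = b * ?g + int i" using modrep x by (auto simp: a_def b_def)
      have ab: "a < level t n i" "b < level t n i" "a + b = d"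
        using x(2) hook_pair_iff[of i t i n a b] i unfolding uw d_def by auto
      moreover have "a < b" using x(5) lt unfolding uw by blast
      ultimately have "lo \<le> b" by (auto simp: lo_def d_def split: if_splits)
      then show "x \<in> ?f ` {lo..<level t n i}"
        unfolding x(1) uw using ab by (intro image_eqI[of _ _ b]) auto
    next
      fix x assume "x \<in> ?f ` {lo..<level t n i}"
      then obtain a where a: "lo \<le> a" "a < level t n i" "x = ?f a" by auto
      have da: "d - a < a" using a(1) by (auto simp: lo_def d_def split: if_splits)
      have "hook_pair t n ((d - a) * ?g + int i) (a * ?g + int i)"
        using hook_pair_iff[of i t i n "d - a" a] i a da ne by (simp add: d_def)
      then show "x \<in> N (i, i)" using a(3) i lt da by (simp add: N_def)
    qed
    moreover have "inj_on ?f {lo..<level t n i}" using t by (auto simp: inj_on_def)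
    ultimately show ?thesis by (simp add: card_image lo_def)
  qed
  let ?I = "pairs (2 * t) \<union> (\<lambda>i. (i, i)) ` {..<2*t}"
  have "card {(u, w). hook_pair t n u w \<and> w < u} = card {(u, w). hook_pair t n u w \<and> ?R u w}"
    by (rule card_tournament) (auto simp: hook_pair_def add.commute)
  also have "{(u, w). hook_pair t n u w \<and> ?R u w} = (\<Union>p\<in>?I. N p)"
  proof (intro equalityI subsetI)
    fix x assume "x \<in> {(u, w). hook_pair t n u w \<and> ?R u w}"
    then obtain u w where x: "x = (u, w)" "hook_pair t n u w" "?R u w" by auto
    define i j where "i = nat (u mod ?g)" and "j = nat (w mod ?g)"
    have ij: "u mod ?g = int i" "w mod ?g = int j" "i < 2 * t" "j < 2 * t"
      using t by (auto simp: i_def j_def nat_less_iff)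
    then have "(i, j) \<in> ?I" "x \<in> N (i, j)" using x by (auto simp: N_def pairs_def)
    then show "x \<in> (\<Union>p\<in>?I. N p)" by blast
  next
    fix x assume "x \<in> (\<Union>p\<in>?I. N p)"
    then obtain p where p: "p \<in> ?I" "x \<in> N p" by blast
    moreover obtain i j where "p = (i, j)" by force
    ultimately have ij: "(i, j) \<in> ?I" "x \<in> N (i, j)" by simp_all
    then obtain u w where "x = (u, w)" "hook_pair t n u w" "u mod ?g = int i" "w mod ?g = int j" "i = j \<longrightarrow> u < w"
      by (auto simp: N_def)
    then show "x \<in> {(u, w). hook_pair t n u w \<and> ?R u w}" using ij(1) by (auto simp: pairs_def)
  qed
  also have "card \<dots> = (\<Sum>p\<in>?I. card (N p))"
  proof (rule card_UN_disjoint)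
    show "\<forall>p\<in>?I. finite (N p)" using cN cN' by (auto simp: pairs_def)
    show "\<forall>p\<in>?I. \<forall>q\<in>?I. p \<noteq> q \<longrightarrow> N p \<inter> N q = {}" by (auto simp: N_def)
  qed simp
  also have "\<dots> = (\<Sum>p\<in>pairs (2 * t). card (N p)) + (\<Sum>p\<in>(\<lambda>i. (i, i)) ` {..<2*t}. card (N p))"
    by (intro sum.union_disjoint finite_pairs finite_imageI finite_lessThan) (auto simp: pairs_def)
  also have "(\<Sum>p\<in>pairs (2 * t). card (N p)) = (\<Sum>p\<in>pairs (2 * t). pair_count t n p)"
    by (rule sum.cong) (use cN in \<open>auto simp: pairs_def\<close>)
  also have "(\<Sum>p\<in>(\<lambda>i. (i, i)) ` {..<2*t}. card (N p)) = (\<Sum>i<2*t. nat (level t n i + (if t \<le> i then 0 else - 1)))"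
    by (subst sum.reindex) (use cN' in \<open>auto simp: inj_on_def\<close>)
  finally show ?thesis .
qed

text \<open>Pairs of classes are grouped under the mirror that sends i to 2 t - 1 - i: both classes
  in the lower half, both in the upper half, or one in each. The mixed pairs form a square.\<close>

lemma sum_pairs_double:
  fixes F :: "nat \<times> nat \<Rightarrow> nat"
  shows "(\<Sum>p\<in>pairs (2 * t). F p) = (\<Sum>(i, j)\<in>pairs t. F (i, j) + F (2 * t - 1 - j, 2 * t - 1 - i) +
    F (i, 2 * t - 1 - j) + F (j, 2 * t - 1 - i)) + (\<Sum>i<t. F (i, 2 * t - 1 - i))"
proof -
  let ?m = "\<lambda>i. 2 * t - 1 - i"
  let ?r = "\<lambda>(i, j). (?m j, ?m i)"
  have "pairs (2 * t) = (pairs t \<union> ?r ` pairs t) \<union> {..<t} \<times> {t..<2*t}"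
  proof (intro equalityI subsetI)
    fix p assume "p \<in> pairs (2 * t)"
    then obtain i j where p: "p = (i, j)" "i < j" "j < 2 * t" by (auto simp: pairs_def)
    show "p \<in> (pairs t \<union> ?r ` pairs t) \<union> {..<t} \<times> {t..<2*t}"
    proof (cases "t \<le> i")
      case True
      then have "p = ?r (?m j, ?m i)" "(?m j, ?m i) \<in> pairs t" using p by (auto simp: pairs_def)
      then show ?thesis by blast
    qed (use p in \<open>auto simp: pairs_def\<close>)
  qed (auto simp: pairs_def)
  then have "(\<Sum>p\<in>pairs (2 * t). F p) = (\<Sum>p\<in>(pairs t \<union> ?r ` pairs t) \<union> {..<t} \<times> {t..<2*t}. F p)" by simp
  also have "\<dots> = (\<Sum>p\<in>pairs t \<union> ?r ` pairs t. F p) + (\<Sum>p\<in>{..<t} \<times> {t..<2*t}. F p)"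
    by (intro sum.union_disjoint finite_pairs finite_imageI finite_UnI) (auto simp: pairs_def)
  also have "(\<Sum>p\<in>pairs t \<union> ?r ` pairs t. F p) = (\<Sum>p\<in>pairs t. F p) + (\<Sum>p\<in>?r ` pairs t. F p)"
    by (intro sum.union_disjoint finite_pairs finite_imageI) (auto simp: pairs_def)
  also have "(\<Sum>p\<in>?r ` pairs t. F p) = (\<Sum>p\<in>pairs t. F (?r p))"
    by (subst sum.reindex) (auto simp: inj_on_def pairs_def)
  also have "(\<Sum>p\<in>{..<t} \<times> {t..<2*t}. F p) = (\<Sum>i<t. \<Sum>j\<in>{t..<2*t}. F (i, j))"
    by (simp add: sum.cartesian_product)
  also have "\<dots> = (\<Sum>i<t. \<Sum>j<t. F (i, ?m j))"
    by (intro sum.cong refl sum.reindex_bij_witness[of _ ?m ?m]) auto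
  also have "\<dots> = (\<Sum>(i, j)\<in>pairs t. F (i, ?m j) + F (j, ?m i)) + (\<Sum>i<t. F (i, ?m i))"
    by (rule sum.square_split)
  finally show ?thesis by (simp add: sum.distrib case_prod_unfold)
qed

text \<open>One factor for each positive root of type B: n_j for the short roots, n_i + n_j and n_i
  - n_j for the long ones.\<close>

definition level_sign :: "nat \<Rightarrow> (nat \<Rightarrow> int) \<Rightarrow> int" where
  "level_sign t n = (\<Prod>j<t. if n j < 0 then - 1 else 1) *
     (\<Prod>(i, j)\<in>pairs t. (if n i + n j < 0 then - 1 else 1) * (if n i < n j then - 1 else 1))"

text \<open>Modulo 2, nat (- x - 1) + nat x is x plus the indicator of x < 0. For x = n_j the length
  of the diagonal adds another \<bar>x\<bar>, and for a pair the two arguments n_i + n_j and n_i -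
  n_j have equal parity, so only indicators remain.\<close>

lemma core_partition_sign:
  fixes n :: "nat \<Rightarrow> int"
  assumes t: "t > 0"
  defines "l \<equiv> core_partition t n"
  shows "(- 1 :: int) ^ (card (H_less_plus (2 * t) l) + card (H_less_plus (2 * t) l \<inter> main_diagonal l) +
      card (main_diagonal l)) = level_sign t n"
proof -
  have l: "is_partition l" "conjugate l = l" using core_partition[OF t] by (auto simp: SC_cores_def l_def)
  have B: "bead_set l = core_beads t n" using core_partition(2)[OF t] by (simp add: l_def)
  have D: "card (main_diagonal l) = (\<Sum>j<t. nat (- n j) + nat (n j))"
  proof -
    have "card (main_diagonal l) = (\<Sum>k | k \<in> core_beads t n \<and> 0 \<le> k. 1)"
      unfolding card_main_diagonal[OF l] B by simp
    also have "\<dots> = (\<Sum>i<2*t. nat (level t n i))"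
      by (subst sum_nonneg_core_beads[OF t]) simp
    also have "\<dots> = (\<Sum>j<t. nat (- n j) + nat (n j))"
      unfolding sum_mirror by (rule sum.cong) (auto simp: level_def)
    finally show ?thesis .
  qed
  have diag: "(\<Sum>i<2*t. nat (level t n i + (if t \<le> i then 0 else - 1))) = (\<Sum>j<t. nat (- n j - 1) + nat (n j))"
    unfolding sum_mirror by (rule sum.cong) (auto simp: level_def)
  let ?m = "\<lambda>i. 2 * t - 1 - i"
  have off: "(\<Sum>p\<in>pairs (2 * t). pair_count t n p) =
    (\<Sum>(i, j)\<in>pairs t. nat (- n i - n j - 1) + nat (n i + n j) + nat (n j - n i - 1) + nat (n i - n j))"
  proof -
    have "pair_count t n (i, ?m i) = 0" if "i < t" for i using that by (simp add: pair_count_def)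
    moreover have "pair_count t n (i, j) + pair_count t n (?m j, ?m i) + pair_count t n (i, ?m j) + pair_count t n (j, ?m i) =
      nat (- n i - n j - 1) + nat (n i + n j) + nat (n j - n i - 1) + nat (n i - n j)" if "(i, j) \<in> pairs t" for i j
    proof -
      have ij: "i < j" "j < t" using that by (auto simp: pairs_def)
      have lv: "level t n i = - n i" "level t n j = - n j" "level t n (?m i) = n i" "level t n (?m j) = n j"
        using ij by (auto simp: level_def)
      have "pair_count t n (i, j) = nat (- n i - n j - 1)"
        unfolding pair_count_def prod.case lv using ij by simp
      moreover have "pair_count t n (?m j, ?m i) = nat (n i + n j)"
        unfolding pair_count_def prod.case lv using ij by (simp add: add.commute)
      moreover have "pair_count t n (i, ?m j) = nat (n j - n i - 1)"
        unfolding pair_count_def prod.case lv using ij by simp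
      moreover have "pair_count t n (j, ?m i) = nat (n i - n j)"
        unfolding pair_count_def prod.case lv using ij by simp
      ultimately show ?thesis by simp
    qed
    ultimately show ?thesis
      unfolding sum_pairs_double by (auto intro!: sum.cong)
  qed
  have eq: "{(u, w). u \<in> bead_set l \<and> w \<in> bead_set l \<and> w < u \<and> 0 \<le> u + w \<and> u + w \<le> int (2 * t) - 2} =
     {(u, w). hook_pair t n u w \<and> w < u}" by (auto simp: B hook_pair_def)
  have "(- 1 :: int) ^ (card (H_less_plus (2 * t) l) + card (H_less_plus (2 * t) l \<inter> main_diagonal l) + card (main_diagonal l)) =
     (- 1) ^ ((\<Sum>p\<in>pairs (2 * t). pair_count t n p) + (\<Sum>j<t. nat (- n j - 1) + nat (n j)) + (\<Sum>j<t. nat (- n j) + nat (n j)))"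
    unfolding power_add[of _ "card (H_less_plus (2 * t) l) + card (H_less_plus (2 * t) l \<inter> main_diagonal l)"]
      H_less_plus_parity[OF l] eq card_hook_pairs[OF t] D diag
    by (simp only: power_add)
  also have "\<dots> = (\<Prod>j<t. (- 1) ^ (nat (- n j - 1) + nat (n j) + (nat (- n j) + nat (n j)))) *
     (\<Prod>(i, j)\<in>pairs t. (- 1) ^ (nat (- n i - n j - 1) + nat (n i + n j) + nat (n j - n i - 1) + nat (n i - n j)))"
  proof -
    have "(\<Sum>p\<in>pairs (2 * t). pair_count t n p) + (\<Sum>j<t. nat (- n j - 1) + nat (n j)) + (\<Sum>j<t. nat (- n j) + nat (n j)) =
      (\<Sum>j<t. nat (- n j - 1) + nat (n j) + (nat (- n j) + nat (n j))) + (\<Sum>p\<in>pairs (2 * t). pair_count t n p)"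
      by (simp add: sum.distrib)
    then show ?thesis
      unfolding off by (simp only: power_add[of _ "\<Sum>j<t. nat (- n j - 1) + nat (n j) + (nat (- n j) + nat (n j))"]
          power_sum case_prod_unfold)
  qed
  also have "\<dots> = level_sign t n"
  proof -
    have even_nat: "even (nat x) \<longleftrightarrow> x \<le> 0 \<or> even x" for x by (cases "x \<ge> 0") (auto simp: even_nat_iff)
    have 1: "(- 1 :: int) ^ (nat (- x - 1) + nat x + (nat (- x) + nat x)) = (if x < 0 then - 1 else 1)" for x
      unfolding minus_one_power_iff by (auto simp: even_nat)
    have 2: "(- 1 :: int) ^ (nat (- x - y - 1) + nat (x + y) + nat (y - x - 1) + nat (x - y)) =
        (if x + y < 0 then - 1 else 1) * (if x < y then - 1 else 1)" for x y
    proof -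
      have "even (nat (- x - y - 1) + nat (x + y) + nat (y - x - 1) + nat (x - y)) \<longleftrightarrow> (x + y < 0 \<longleftrightarrow> x < y)"
        unfolding even_add even_nat by presburger
      then show ?thesis by (simp only: minus_one_power_iff) simp
    qed
    show ?thesis unfolding level_sign_def 1 2 ..
  qed
  finally show ?thesis .
qed

section \<open>Straightening and the main theorem\<close>

text \<open>\<open>so_det\<close> written in terms of its exponents, on which the signed
  permutations centred at 1/2 act.\<close>

definition alt_det :: "nat \<Rightarrow> (nat \<Rightarrow> int) \<Rightarrow> (nat \<Rightarrow> 'a::field) \<Rightarrow> 'a" where
  "alt_det t e x = Determinant.det (mat t t (\<lambda>(i, j). x (Suc i) powi e j - x (Suc i) powi (1 - e j)))"

lemma so_det_eq_alt_det: "so_det t m x = alt_det t (\<lambda>j. m (Suc j) + int t - int j) x"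
  unfolding so_det_def alt_det_def
  by (intro arg_cong[of _ _ Determinant.det] cong_mat refl) (simp add: Let_def algebra_simps)

text \<open>The reflection \<open>e \<mapsto> 1 - e\<close> changes the sign of \<open>x powi e - x powi (1 - e)\<close>.\<close>

definition refl_abs :: "int \<Rightarrow> int" where "refl_abs e = (if e \<ge> 1 then e else 1 - e)"

lemma alt_det_refl_abs:
  "alt_det t e x = of_int (\<Prod>j<t. if e j \<ge> 1 then 1 else - 1) * alt_det t (\<lambda>j. refl_abs (e j)) x"
proof -
  let ?f = "\<lambda>e i. x (Suc i) powi e - x (Suc i) powi (1 - e)"
  have "?f (e j) i = of_int (if e j \<ge> 1 then 1 else - 1) * ?f (refl_abs (e j)) i" for i j
    by (simp add: refl_abs_def)
  then have "(\<Prod>j=0..<t. ?f (e j) (p j)) =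
      of_int (\<Prod>j<t. if e j \<ge> 1 then 1 else - 1) * (\<Prod>j=0..<t. ?f (refl_abs (e j)) (p j))" for p
    unfolding lessThan_atLeast0 of_int_prod prod.distrib[symmetric] by (intro prod.cong) auto
  then show ?thesis
    unfolding alt_det_def det_mat_leibniz' sum_distrib_left by (intro sum.cong refl) (simp only: mult_ac)
qed

lemma alt_det_permute:
  assumes p: "p permutes {0..<t}"
  shows "alt_det t (v \<circ> p) x = of_int (sign p) * alt_det t v x"
proof -
  let ?A = "mat t t (\<lambda>(j, i). x (Suc i) powi v j - x (Suc i) powi (1 - v j))"
  have tr: "alt_det t e x = Determinant.det (mat t t (\<lambda>(j, i). x (Suc i) powi e j - x (Suc i) powi (1 - e j)))" for e
    unfolding alt_det_def by (rule det_mat_swap)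
  have "Determinant.det (mat t t (\<lambda>(i, j). ?A $$ (p i, j))) = of_int (sign p) * Determinant.det ?A"
    by (rule det_permute_rows[of _ t]) (use p in auto)
  moreover have "mat t t (\<lambda>(i, j). ?A $$ (p i, j)) = mat t t (\<lambda>(j, i). x (Suc i) powi v (p j) - x (Suc i) powi (1 - v (p j)))"
    using permutes_in_image[OF p] by (intro eq_matI) auto
  ultimately show ?thesis by (simp add: tr)
qed

lemma prod_pairs_permute:
  fixes f :: "nat \<Rightarrow> nat \<Rightarrow> 'a::comm_ring_1"
  assumes anti: "\<And>i j. i \<noteq> j \<Longrightarrow> f j i = - f i j" and p: "p permutes {0..<t}"
  shows "(\<Prod>(i, j)\<in>pairs t. f (p i) (p j)) = of_int (sign p) * (\<Prod>(i, j)\<in>pairs t. f i j)"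
  using finite_atLeastLessThan p
proof (induction rule: permutes_rev_induct)
  case (swap a b p)
  then have ab: "a < t" "b < t" "a \<noteq> b" and p: "p permutes {0..<t}"
    and IH: "(\<Prod>(i, j)\<in>pairs t. f (p i) (p j)) = of_int (sign p) * (\<Prod>(i, j)\<in>pairs t. f i j)"
    by auto
  have anti': "f (p j) (p i) = - f (p i) (p j)" if "i \<noteq> j" for i j
    using anti[of "p i" "p j"] that permutes_inj[OF p] by (auto dest: injD)
  have "sign (p \<circ> Transposition.transpose a b) = - sign p"
    unfolding sign_compose[OF permutes_imp_permutation[OF finite_atLeastLessThan p] permutation_swap_id]
    using ab(3) by (simp add: sign_swap_id)
  moreover have "(\<Prod>(i, j)\<in>pairs t. f ((p \<circ> Transposition.transpose a b) i) ((p \<circ> Transposition.transpose a b) j)) =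
     - (\<Prod>(i, j)\<in>pairs t. f (p i) (p j))"
    unfolding o_apply by (rule prod_pairs_transpose) (use ab in \<open>blast intro: anti'\<close>)+
  ultimately show ?case unfolding IH by (simp only: of_int_minus mult_minus_left)
qed (simp add: sign_id)

text \<open>Exponents are reflected to values at least 1 and then sorted. The sign of the sorting
  permutation is a product of signs of differences, since these signs are all 1 for the decreasing
  v.\<close>

lemma alt_det_straighten:
  assumes inj: "inj_on (\<lambda>j. refl_abs (e j)) {0..<t}"
    and dec: "\<And>i j. i < j \<Longrightarrow> j < t \<Longrightarrow> v j < v i"
    and img: "(\<lambda>j. refl_abs (e j)) ` {0..<t} = v ` {0..<t}"
  shows "alt_det t e x = of_int ((\<Prod>j<t. if e j \<ge> 1 then 1 else - 1) *
    (\<Prod>(i, j)\<in>pairs t. sgn (refl_abs (e i) - refl_abs (e j)))) * alt_det t v x"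
proof -
  have injv: "inj_on v {0..<t}"
    by (rule linorder_inj_onI') (use dec in force)
  define p where "p j = (if j < t then inv_into {0..<t} v (refl_abs (e j)) else j)" for j
  have vp: "v (p j) = refl_abs (e j)" "p j < t" if "j < t" for j
  proof -
    have "refl_abs (e j) \<in> v ` {0..<t}" using img that by auto
    from f_inv_into_f[OF this] inv_into_into[OF this] show "v (p j) = refl_abs (e j)" "p j < t"
      using that by (auto simp: p_def)
  qed
  have p: "p permutes {0..<t}"
  proof (rule bij_imp_permutes)
    have "inj_on p {0..<t}"
    proof (rule inj_onI)
      fix i j assume ij: "i \<in> {0..<t}" "j \<in> {0..<t}" "p i = p j"
      then have "refl_abs (e i) = refl_abs (e j)" using vp(1)[of i] vp(1)[of j] by simp
      then show "i = j" using inj ij(1,2) by (auto dest: inj_onD)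
    qed
    moreover have "p ` {0..<t} \<subseteq> {0..<t}" using vp by auto
    ultimately show "bij_betw p {0..<t} {0..<t}"
      by (metis bij_betw_def endo_inj_surj finite_atLeastLessThan)
  qed (simp add: p_def)
  have "(\<Prod>(i, j)\<in>pairs t. sgn (refl_abs (e i) - refl_abs (e j))) = (\<Prod>(i, j)\<in>pairs t. sgn (v (p i) - v (p j)))"
    by (rule prod.cong) (auto simp: pairs_def vp)
  also have "\<dots> = sign p * (\<Prod>(i, j)\<in>pairs t. sgn (v i - v j))"
    using prod_pairs_permute[of "\<lambda>i j. sgn (v i - v j)" p t] p by (simp add: sgn_if)
  also have "(\<Prod>(i, j)\<in>pairs t. sgn (v i - v j)) = 1"
    by (rule prod.neutral) (use dec in \<open>auto simp: pairs_def\<close>)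
  finally have s: "(\<Prod>(i, j)\<in>pairs t. sgn (refl_abs (e i) - refl_abs (e j))) = sign p" by simp
  have "alt_det t (\<lambda>j. refl_abs (e j)) x = alt_det t (v \<circ> p) x"
    unfolding alt_det_def by (intro arg_cong[of _ _ Determinant.det] cong_mat refl) (simp add: vp)
  also have "\<dots> = of_int (sign p) * alt_det t v x" by (rule alt_det_permute[OF p])
  finally show ?thesis
    unfolding s alt_det_refl_abs[of t e x] by (simp only: of_int_mult mult.assoc)
qed

text \<open>As \<open>refl_abs e\<close> is \<bar>e - 1/2\<bar> + 1/2, the sign is that of (a -
  1/2)^2 - (b - 1/2)^2 = (a - b) (a + b - 1).\<close>

lemma sgn_refl_abs_diff:
  assumes "a \<noteq> b" "a + b \<noteq> 1"
  shows "sgn (refl_abs a - refl_abs b) = sgn (a - b) * sgn (a + b - 1)"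
  using assms unfolding refl_abs_def sgn_if by (auto split: if_splits)

definition core_exponent :: "nat \<Rightarrow> (nat \<Rightarrow> int) \<Rightarrow> nat \<Rightarrow> int" where
  "core_exponent t n j = 2 * int t * n j + int t - int j"

text \<open>The offsets j - i and 2 t - i - j - 1 lie strictly between 0 and 2 t. So the multiple of
  2 t decides the sign, and when it is 0 the sign is positive.\<close>

lemma core_exponent_sign:
  assumes ij: "i < j" "j < t"
  shows "sgn (refl_abs (core_exponent t n i) - refl_abs (core_exponent t n j)) =
    (if n i + n j < 0 then - 1 else 1) * (if n i < n j then - 1 else 1)"
proof -
  let ?a = "n i" and ?b = "n j" and ?e = "core_exponent t n"
  have d: "?e i - ?e j = 2 * int t * (?a - ?b) + (int j - int i)"
    and s: "?e i + ?e j - 1 = 2 * int t * (?a + ?b) + (2 * int t - int i - int j - 1)"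
    by (simp_all add: core_exponent_def algebra_simps)
  have neg: "2 * int t * z \<le> 2 * int t * (- 1)" if "z < 0" for z using that by (intro mult_left_mono) auto
  have pos: "0 \<le> 2 * int t * z" if "0 \<le> z" for z using that by simp
  have sd: "sgn (?e i - ?e j) = (if ?a < ?b then - 1 else 1)"
  proof (cases "?a < ?b")
    case True
    then have "2 * int t * (?a - ?b) \<le> 2 * int t * (- 1)" by (intro neg) simp
    then have "?e i - ?e j < 0" using ij unfolding d by linarith
    then show ?thesis using True by (simp add: sgn_if)
  next
    case False
    then have "0 \<le> 2 * int t * (?a - ?b)" by (intro pos) simp
    then have "0 < ?e i - ?e j" using ij unfolding d by linarith
    then show ?thesis using False by (simp add: sgn_if)
  qed
  have ss: "sgn (?e i + ?e j - 1) = (if ?a + ?b < 0 then - 1 else 1)"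
  proof (cases "?a + ?b < 0")
    case True
    then have "2 * int t * (?a + ?b) \<le> 2 * int t * (- 1)" by (rule neg)
    then have "?e i + ?e j - 1 < 0" using ij unfolding s by linarith
    then show ?thesis using True by (simp add: sgn_if)
  next
    case False
    then have "0 \<le> 2 * int t * (?a + ?b)" by (intro pos) simp
    then have "0 < ?e i + ?e j - 1" using ij unfolding s by linarith
    then show ?thesis using False by (simp add: sgn_if)
  qed
  have "?e i \<noteq> ?e j" "?e i + ?e j \<noteq> 1" using sd ss by (auto simp: sgn_if split: if_splits)
  from sgn_refl_abs_diff[OF this] show ?thesis unfolding sd ss by simp
qed

section \<open>The coding of a core and straightening\<close>

lemma word_eq_0_iff: "word l k = 0 \<longleftrightarrow> k \<in> bead_set l"
  by (auto simp: word_def bead_set_def bead_def)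

text \<open>The shift by one period in \<open>beta\<close> turns the last bead of a class into its
  first gap.\<close>

lemma beta_core_partition:
  assumes t: "t > 0" and i: "i < 2 * t"
  shows "beta (2 * t) (core_partition t n) i = level t n i * (2 * int t) + int i"
proof -
  have w: "word (core_partition t n) (k * int (2 * t) + int i) = 0 \<longleftrightarrow> k < level t n i" for k
    using mem_core_beads[OF i, of k n] by (simp add: word_eq_0_iff core_partition(2)[OF t])
  show ?thesis
    unfolding beta_def w
  proof (rule Greatest_equality)
    show "\<exists>k. level t n i * (2 * int t) + int i = (k + 1) * int (2 * t) + int i \<and> k < level t n i"
      by (rule exI[of _ "level t n i - 1"]) simp
    fix b assume "\<exists>k. b = (k + 1) * int (2 * t) + int i \<and> k < level t n i"
    then obtain k where k: "b = (k + 1) * int (2 * t) + int i" "k < level t n i" by blast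
    have "(k + 1) * int (2 * t) \<le> level t n i * int (2 * t)" using k by (intro mult_right_mono) auto
    then show "b \<le> level t n i * (2 * int t) + int i" using k by simp
  qed
qed

lemma inj_on_core_exponent: "inj_on (\<lambda>j. refl_abs (core_exponent t n j)) {0..<t}"
proof (rule linorder_inj_onI')
  fix i j assume "i \<in> {0..<t}" "j \<in> {0..<t}" "i < j"
  then have "sgn (refl_abs (core_exponent t n i) - refl_abs (core_exponent t n j)) \<noteq> 0"
    using core_exponent_sign[of i j t n] by simp
  then show "refl_abs (core_exponent t n i) \<noteq> refl_abs (core_exponent t n j)" by auto
qed

text \<open>With e_j the exponent of column j, the first gaps of the classes j and 2 t - 1 - j are t
  - e_j and e_j + t - 1. Replacing e_j by 1 - e_j swaps them, so \<open>refl_abs\<close> may be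
  used, and then the second is at least t and the first below t. Hence the t largest gaps come one
  from each pair of classes.\<close>

lemma V_coding_core_partition:
  fixes n :: "nat \<Rightarrow> int"
  assumes t: "t > 0"
  defines "V \<equiv> V_coding (2 * t) t (core_partition t n)"
  shows "length V = t" "sorted_wrt (>) V"
    "set V = (\<lambda>j. refl_abs (core_exponent t n j) + int t - 1) ` {0..<t}"
proof -
  let ?e = "\<lambda>j. refl_abs (core_exponent t n j)"
  let ?P = "(\<lambda>j. ?e j + int t - 1) ` {0..<t}" and ?M = "(\<lambda>j. int t - ?e j) ` {0..<t}"
  have "beta (2 * t) (core_partition t n) ` {0..<2 * t} = (\<lambda>i. level t n i * (2 * int t) + int i) ` {0..<2 * t}"
    by (rule image_cong) (auto simp: beta_core_partition[OF t])
  also have "\<dots> = (\<Union>j\<in>{0..<t}. {level t n j * (2 * int t) + int j,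
      level t n (2 * t - 1 - j) * (2 * int t) + int (2 * t - 1 - j)})"
  proof (intro equalityI subsetI)
    fix x assume "x \<in> (\<lambda>i. level t n i * (2 * int t) + int i) ` {0..<2 * t}"
    then obtain i where i: "i < 2 * t" "x = level t n i * (2 * int t) + int i" by auto
    show "x \<in> (\<Union>j\<in>{0..<t}. {level t n j * (2 * int t) + int j,
      level t n (2 * t - 1 - j) * (2 * int t) + int (2 * t - 1 - j)})"
    proof (cases "i < t")
      case False
      then have "2 * t - 1 - i \<in> {0..<t}" "2 * t - 1 - (2 * t - 1 - i) = i" using i by auto
      then show ?thesis using i(2) by (intro UN_I[of "2 * t - 1 - i"]) auto
    qed (use i in auto)
  next
    fix x assume "x \<in> (\<Union>j\<in>{0..<t}. {level t n j * (2 * int t) + int j,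
      level t n (2 * t - 1 - j) * (2 * int t) + int (2 * t - 1 - j)})"
    then obtain j where j: "j < t" "x = level t n j * (2 * int t) + int j \<or>
      x = level t n (2 * t - 1 - j) * (2 * int t) + int (2 * t - 1 - j)" by auto
    then have "j \<in> {0..<2 * t}" "2 * t - 1 - j \<in> {0..<2 * t}" by auto
    then show "x \<in> (\<lambda>i. level t n i * (2 * int t) + int i) ` {0..<2 * t}" using j(2) by blast
  qed
  also have "\<dots> = (\<Union>j\<in>{0..<t}. {?e j + int t - 1, int t - ?e j})"
  proof (rule SUP_cong[OF refl])
    fix j assume "j \<in> {0..<t}"
    then have j: "j < t" by simp
    have 1: "level t n j * (2 * int t) + int j = int t - core_exponent t n j"
      using j by (simp add: level_def core_exponent_def)
    have 2: "level t n (2 * t - 1 - j) * (2 * int t) + int (2 * t - 1 - j) = core_exponent t n j + int t - 1"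
    proof -
      have "level t n (2 * t - 1 - j) = n j" using j by (auto simp: level_def)
      moreover have "int (2 * t - 1 - j) = 2 * int t - 1 - int j" using j by auto
      ultimately show ?thesis by (simp add: core_exponent_def algebra_simps)
    qed
    show "{level t n j * (2 * int t) + int j, level t n (2 * t - 1 - j) * (2 * int t) + int (2 * t - 1 - j)} =
        {?e j + int t - 1, int t - ?e j}"
      unfolding 1 2 by (auto simp: refl_abs_def)
  qed
  also have "\<dots> = ?M \<union> ?P" by auto
  finally have img: "beta (2 * t) (core_partition t n) ` {0..<2 * t} = ?M \<union> ?P" .
  have pos: "1 \<le> ?e j" for j by (simp add: refl_abs_def)
  have fin: "finite ?M" "finite ?P" by auto
  have "sorted_list_of_set (?M \<union> ?P) = sorted_list_of_set ?M @ sorted_list_of_set ?P"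
  proof (rule sorted_distinct_set_unique)
    have lt: "x < y" if xy: "x \<in> ?M" "y \<in> ?P" for x y
    proof -
      obtain i j where "x = int t - ?e i" "y = ?e j + int t - 1" using xy by blast
      then show ?thesis using pos[of i] pos[of j] by linarith
    qed
    have "\<forall>x\<in>?M. \<forall>y\<in>?P. x \<le> y" using lt by (meson less_imp_le)
    moreover have "?M \<inter> ?P = {}" using lt by (meson disjoint_iff less_irrefl)
    ultimately show "sorted (sorted_list_of_set ?M @ sorted_list_of_set ?P)"
      "distinct (sorted_list_of_set ?M @ sorted_list_of_set ?P)"
      unfolding sorted_append distinct_append set_sorted_list_of_set[OF fin(1)] set_sorted_list_of_set[OF fin(2)]
      by simp_all
  qed (use fin in simp_all)
  moreover have cP: "card ?P = t"
    using inj_on_core_exponent[of t n] by (subst card_image) (auto simp: inj_on_def)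
  ultimately have V: "V = rev (sorted_list_of_set ?P)"
    unfolding V_def V_coding_def img by (simp add: rev_append)
  show "length V = t" unfolding V using cP by simp
  show "sorted_wrt (>) V"
    unfolding V sorted_wrt_rev using strict_sorted_list_of_set[of ?P] by simp
  show "set V = ?P" unfolding V using fin by simp
qed

text \<open>The exponents in the determinant of \<open>mu\<close> are those of the coding plus 1 -
  t, that is, the reflected exponents of the columns in decreasing order. Straightening applies, and
  its sign is \<open>level_sign\<close>.\<close>

lemma so_det_core_partition:
  assumes t: "t > 0"
  shows "of_int (level_sign t n) * so_det t (mu (2 * t) t (core_partition t n)) x =
    so_det t (\<lambda>j. int (2 * t) * n (j - 1)) x"
proof -
  let ?V = "V_coding (2 * t) t (core_partition t n)" and ?e = "core_exponent t n"
  note V = V_coding_core_partition[OF t, of n]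
  define v where "v j = ?V ! j + 1 - int t" for j
  have "so_det t (mu (2 * t) t (core_partition t n)) x = alt_det t v x"
    unfolding so_det_eq_alt_det by (rule arg_cong[of _ _ "\<lambda>e. alt_det t e x"]) (auto simp: mu_def v_def)
  moreover have "so_det t (\<lambda>j. int (2 * t) * n (j - 1)) x = alt_det t ?e x"
    unfolding so_det_eq_alt_det by (rule arg_cong[of _ _ "\<lambda>e. alt_det t e x"]) (auto simp: core_exponent_def)
  moreover have "alt_det t ?e x = of_int ((\<Prod>j<t. if ?e j \<ge> 1 then 1 else - 1) *
    (\<Prod>(i, j)\<in>pairs t. sgn (refl_abs (?e i) - refl_abs (?e j)))) * alt_det t v x"
  proof (rule alt_det_straighten[OF inj_on_core_exponent])
    show "v j < v i" if "i < j" "j < t" for i j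
      using V(1,2) that by (auto simp: v_def sorted_wrt_iff_nth_less)
    have "v ` {0..<t} = (\<lambda>z. z + 1 - int t) ` set ?V"
      using V(1) by (auto simp: v_def set_conv_nth image_iff)
    also have "\<dots> = (\<lambda>j. refl_abs (?e j)) ` {0..<t}"
      unfolding V(3) image_image by simp
    finally show "(\<lambda>j. refl_abs (?e j)) ` {0..<t} = v ` {0..<t}" by simp
  qed
  moreover have "(\<Prod>j<t. if ?e j \<ge> 1 then 1 else - 1) *
    (\<Prod>(i, j)\<in>pairs t. sgn (refl_abs (?e i) - refl_abs (?e j))) = level_sign t n"
  proof -
    have "?e j \<ge> 1 \<longleftrightarrow> \<not> n j < 0" if "j < t" for j
    proof (cases "n j < 0")
      case True
      then have "2 * int t * n j \<le> 2 * int t * (- 1)" by (intro mult_left_mono) auto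
      then have "\<not> ?e j \<ge> 1" unfolding core_exponent_def by linarith
      then show ?thesis using True by simp
    next
      case False
      then have "0 \<le> 2 * int t * n j" by simp
      then have "?e j \<ge> 1" using that unfolding core_exponent_def by linarith
      then show ?thesis using False by simp
    qed
    then have "(\<Prod>j<t. if ?e j \<ge> 1 then 1 else - 1 :: int) = (\<Prod>j<t. if n j < 0 then - 1 else 1)"
      by (intro prod.cong) auto
    moreover have "(\<Prod>(i, j)\<in>pairs t. sgn (refl_abs (?e i) - refl_abs (?e j))) =
      (\<Prod>(i, j)\<in>pairs t. (if n i + n j < 0 then - 1 else 1) * (if n i < n j then - 1 else 1))"
      by (rule prod.cong) (auto simp: pairs_def core_exponent_sign)
    ultimately show ?thesis by (simp only: level_sign_def)
  qed
  ultimately show ?thesis by simp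
qed

text \<open>A strictly decreasing sequence of integers drops by at least one per place, so adding i
  leaves it weakly decreasing. The smallest entry of the coding is at least t because
  \<open>refl_abs\<close> is at least 1.\<close>

lemma mu_core_partition:
  assumes t: "t > 0"
  shows "antimono_on {1..t} (mu (2 * t) t (core_partition t n))"
    and "i \<in> {1..t} \<Longrightarrow> 0 \<le> mu (2 * t) t (core_partition t n) i"
proof -
  let ?V = "V_coding (2 * t) t (core_partition t n)"
  note V = V_coding_core_partition[OF t, of n]
  have step: "?V ! j + int (j - i) \<le> ?V ! i" if "i \<le> j" "j < t" for i j
    using int_sorted_wrt_gr_nth[OF V(2) that(1)] that V(1) by simp
  show "antimono_on {1..t} (mu (2 * t) t (core_partition t n))"
  proof (rule monotone_onI)
    fix i j assume ij: "i \<in> {1..t}" "j \<in> {1..t}" "i \<le> j"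
    then have "i - 1 \<le> j - 1" "j - 1 < t" "int (j - 1 - (i - 1)) = int j - int i" by auto
    from step[OF this(1,2)] this(3)
    show "mu (2 * t) t (core_partition t n) i \<ge> mu (2 * t) t (core_partition t n) j"
      unfolding mu_def by linarith
  qed
  assume i: "i \<in> {1..t}"
  have "?V ! (t - 1) \<in> set ?V" using V(1) t by (intro nth_mem) simp
  then have "int t \<le> ?V ! (t - 1)" unfolding V(3) by (auto simp: refl_abs_def)
  moreover have "i - 1 \<le> t - 1" "t - 1 < t" "int (t - 1 - (i - 1)) = int t - int i" using i t by auto
  note step[OF this(1,2)] this(3)
  ultimately show "0 \<le> mu (2 * t) t (core_partition t n) i"
    unfolding mu_def by simp
qed

text \<open>Coefficient N of a finite partial sum is constant as soon as the index set contains the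
  fibre of weight N.\<close>

lemma has_sum_fps:
  fixes c :: "'i \<Rightarrow> 'a::field"
  assumes "fin_fibres A w"
  shows "((\<lambda>a. fps_const (c a) * fps_X ^ w a) has_sum fsum A w c) A"
  unfolding has_sum_def
proof (rule tendsto_fpsI)
  fix N
  show "\<forall>\<^sub>F F in finite_subsets_at_top A. (\<Sum>a\<in>F. fps_const (c a) * fps_X ^ w a) $ N = fsum A w c $ N"
    unfolding eventually_finite_subsets_at_top
  proof (intro exI[of _ "{a \<in> A. w a = N}"] conjI allI impI)
    show "finite {a \<in> A. w a = N}" using assms by (simp add: fin_fibres_def)
    fix F assume F: "finite F \<and> {a \<in> A. w a = N} \<subseteq> F \<and> F \<subseteq> A"
    have "(\<Sum>a\<in>F. fps_const (c a) * fps_X ^ w a) $ N = (\<Sum>a\<in>F. if w a = N then c a else 0)"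
      unfolding fps_sum_nth by (rule sum.cong) (auto simp: fps_X_power_nth)
    also have "\<dots> = (\<Sum>a\<in>{a \<in> F. w a = N}. c a)" using F by (intro sum.inter_filter[symmetric]) auto
    also have "{a \<in> F. w a = N} = {a. a \<in> A \<and> w a = N}" using F by auto
    finally show "(\<Sum>a\<in>F. fps_const (c a) * fps_X ^ w a) $ N = fsum A w c $ N" by (simp add: fsum_nth)
  qed auto
qed

lemma prod_side_eq_K_prod:
  "prod_side t (\<lambda>i. x (Suc i)) = K_prod (fps_X\<^sup>2) t x *
    (\<Prod>i\<in>{1..t}. qpoch_inf (fps_X * fps_const (x i)) fps_X * qpoch_inf (fps_X * fps_const (inverse (x i))) fps_X)"
proof -
  have "bij_betw (\<lambda>(i, j). (Suc i, Suc j)) (pairs t) {(i, j). 1 \<le> i \<and> i < j \<and> j \<le> t}"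
    by (rule bij_betwI[of _ _ _ "\<lambda>(i, j). (i - 1, j - 1)"]) (auto simp: pairs_def)
  note r = prod.reindex_bij_betw[OF this, symmetric]
  have s: "(\<Prod>i\<in>{1..t}. f i) = (\<Prod>i<t. f (Suc i))" for f :: "nat \<Rightarrow> 'a fps"
    by (rule prod.reindex_bij_witness[of _ Suc "\<lambda>i. i - 1"]) auto
  show ?thesis
    unfolding prod_side_def K_prod_def r s by (simp add: case_prod_unfold mult.commute)
qed

theorem theorem5p10:
  fixes t g :: nat and q T :: "laurent fract fps"
  assumes "t \<ge> 2" and "g = 2 * t"
    and "q = fps_X" \<comment> \<open>the indeterminate is the square root of \<open>T\<close>\<close>
    and "T = q ^ 2"
  shows "(\<forall>\<omega> \<in> SC_cores g. antimono_on {1..t} (mu g t \<omega>) \<and> (\<forall>i \<in> {1..t}. 0 \<le> mu g t \<omega> i)) \<and>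
    ((\<lambda>\<omega>. (- 1) ^ (card (H_less_plus g \<omega>) + card (H_less_plus g \<omega> \<inter> main_diagonal \<omega>)
                 + card (main_diagonal \<omega>))
          * q ^ sum_list \<omega> * fps_const (so_char t (mu g t \<omega>) X))
      has_sum
        (qpoch_inf q q * qpoch_inf T T ^ (t - 1) * K_prod T t X *
          (\<Prod>i\<in>{1..t}. qpoch_inf (q * fps_const (X i)) q *
                      qpoch_inf (q * fps_const (inverse (X i))) q)))
      (SC_cores g)"
proof -
  have t: "t > 0" using assms(1) by simp
  note bij = bij_betw_core_partition[OF t]
  let ?I = "int_vecs t"
  have cores: "\<exists>n\<in>?I. \<omega> = core_partition t n" if "\<omega> \<in> SC_cores g" for \<omega>
    using bij that assms(2) unfolding bij_betw_def by blast
  have mu: "\<forall>\<omega> \<in> SC_cores g. antimono_on {1..t} (mu g t \<omega>) \<and> (\<forall>i \<in> {1..t}. 0 \<le> mu g t \<omega> i)"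
    using cores mu_core_partition[OF t] unfolding assms(2) by blast
  let ?k = "\<lambda>\<omega>. card (H_less_plus g \<omega>) + card (H_less_plus g \<omega> \<inter> main_diagonal \<omega>) + card (main_diagonal \<omega>)"
  define c :: "nat list \<Rightarrow> laurent fract" where "c \<omega> = (- 1) ^ ?k \<omega> * so_char t (mu g t \<omega>) X" for \<omega>
  let ?D = "so_det t (\<lambda>_. 0) X"
  have W: "weyl_num t (\<lambda>i. X (Suc i)) \<noteq> 0"
    by (rule weyl_num_nonzero) (use X_nonzero X_generic in auto)
  note ident = denominator_identity[of t X, OF t X_nonzero of_int_laurent_fract_eq_0 W]
  \<comment> \<open>The sign of the core is the sign of straightening, so together with the sorted
    determinant it gives back the unsorted one.\<close>
  have cn: "c (core_partition t n) = inverse ?D * so_det t (\<lambda>j. int (2 * t) * n (j - 1)) X" for n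
  proof -
    have "(- 1 :: laurent fract) ^ ?k (core_partition t n) = of_int ((- 1) ^ ?k (core_partition t n))" by simp
    also have "(- 1 :: int) ^ ?k (core_partition t n) = level_sign t n"
      unfolding assms(2) by (rule core_partition_sign[OF t])
    finally have "c (core_partition t n) = of_int (level_sign t n) * so_det t (mu (2 * t) t (core_partition t n)) X / ?D"
      by (simp add: c_def so_char_def assms(2))
    then show ?thesis
      unfolding so_det_core_partition[OF t] divide_inverse by (simp only: mult.commute[of _ "inverse ?D"])
  qed
  have fin: "fin_fibres ?I (phi_wt t)"
    unfolding phi_wt_def[abs_def]
    by (rule conjunct1[OF fsum_prod[of "{0..<t}" "\<lambda>_. UNIV" _ "\<lambda>_ _. 0 :: int"]])
       (use fin_fibres_phi_wt in auto)
  have "{\<omega> \<in> SC_cores g. sum_list \<omega> = N} \<subseteq> core_partition t ` {n \<in> ?I. phi_wt t n = N}" for N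
    using cores sum_list_core_partition[OF t] by fastforce
  then have fin': "fin_fibres (SC_cores g) sum_list"
    using fin unfolding fin_fibres_def by (meson finite_imageI finite_subset)
  have "fsum (SC_cores g) sum_list c = fsum ?I (sum_list \<circ> core_partition t) (c \<circ> core_partition t)"
    using fsum_reindex[OF bij] unfolding assms(2) .
  also have "\<dots> = fsum ?I (phi_wt t) (\<lambda>n. inverse ?D * so_det t (\<lambda>j. int (2 * t) * n (j - 1)) X)"
    by (rule fsum_cong) (simp_all add: sum_list_core_partition[OF t] cn)
  also have "\<dots> = fps_const (inverse ?D) * (fps_const ?D * (qpoch_inf fps_X fps_X *
      qpoch_inf (fps_X\<^sup>2) (fps_X\<^sup>2) ^ (t - 1) * prod_side t (\<lambda>i. X (Suc i))))"
    by (simp only: fsum_const_mult ident(2))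
  also have "\<dots> = qpoch_inf fps_X fps_X * qpoch_inf (fps_X\<^sup>2) (fps_X\<^sup>2) ^ (t - 1) * prod_side t (\<lambda>i. X (Suc i))"
    unfolding mult.assoc[symmetric] fps_const_mult using ident(1) by simp
  finally have S: "fsum (SC_cores g) sum_list c = qpoch_inf q q * qpoch_inf T T ^ (t - 1) * K_prod T t X *
          (\<Prod>i\<in>{1..t}. qpoch_inf (q * fps_const (X i)) q * qpoch_inf (q * fps_const (inverse (X i))) q)"
    unfolding assms(3,4) prod_side_eq_K_prod by (simp only: mult.assoc)
  have "(\<lambda>\<omega>. (- 1) ^ ?k \<omega> * q ^ sum_list \<omega> * fps_const (so_char t (mu g t \<omega>) X)) =
      (\<lambda>\<omega>. fps_const (c \<omega>) * fps_X ^ sum_list \<omega>)"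
  proof
    fix \<omega>
    have "(- 1) ^ m = fps_const ((- 1 :: laurent fract) ^ m)" for m
      by (simp add: minus_one_power_iff flip: fps_const_neg)
    then show "(- 1) ^ ?k \<omega> * q ^ sum_list \<omega> * fps_const (so_char t (mu g t \<omega>) X) =
        fps_const (c \<omega>) * fps_X ^ sum_list \<omega>"
      unfolding c_def assms(3) fps_const_mult[symmetric] by (simp only: mult_ac)
  qed
  then show ?thesis using mu has_sum_fps[OF fin', of c] unfolding S by simp
qed

end
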